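(* Consider $s+1$ scalar Gaussian channels from one transmitter, $Y_r[t]=\sqrt{h_r}\,X[t]+Z_r[t]$ for $r\in\{0,\dots,s\}$. Let $P_1,\dots,P_s\ge 0$ with $\sum_{i=1}^sP_i\le P_{\max}$, put $I_i:=\sum_{j=i+1}^sP_j$, and define for $i=1,\dots,s$ $$R_i=\frac12\Big[\log\Big(1+\frac{h_iP_i}{1+h_iI_i}\Big)-\log\Big(1+\frac{h_{i-1}P_i}{1+h_{i-1}I_i}\Big)\Big].$$ Then $(R_1,\dots,R_s)$ is achievable for the nested-message-set degraded wiretap problem described in the context.
   Context: Channel model: - $Z_r[t]\sim N(0,1)$ are i.i.d. over $t$. - $0<h_0<h_1<\cdots<h_s$ are constants. - The input must satisfy $\frac1L\sum_{t=1}^L\mathbb E[X[t]^2]\le P_{\max}$. Messages: $W_1,\dots,W_s$ are independent, with $W_i$ uniform on $\{1,\dots,2^{LR_i}\}$. A rate tuple $(R_1,\dots,R_s)$ is achievable if for every $\epsilon>0$ and all sufficiently large block length $L$ there exist: - a (possibly randomized) encoder mapping $(W_1,\dots,W_s)$ to $X^{L}=(X[1],\dots,X[L])$ that satisfies the power constraint, and - for each $j\in\{1,\dots,s\}$, a decoder at receiver $j$ that outputs estimates of $W_1,\dots,W_j$ from $Y_j^L$, such that: - (i) each message $W_i$ is decoded correctly by every receiver $Y_i,\dots,Y_s$ with error probability at most $\epsilon$; - (ii) $\frac1L I(W_{i+1},\dots,W_s;Y_i^{L})\le\epsilon$ for every $i\in\{0,\dots,s\}$. Logarithms are base 2. *)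

theory Defs
  imports "HOL-Probability.Probability"
begin

text \<open>Nested-message-set degraded Gaussian wiretap broadcast channel.
  Receivers r = 0..s observe Y_r[t] = sqrt(h r) X[t] + Z_r[t], Z_r[t] iid N(0,1).
  Blocks of length L are functions nat => real restricted to {..<L}.\<close>

definition block_space :: "nat \<Rightarrow> (nat \<Rightarrow> real) measure" where
  "block_space L = PiM {..<L} (\<lambda>_. borel)"

definition msg_size :: "nat \<Rightarrow> real \<Rightarrow> nat" where
  "msg_size L R = nat \<lceil>2 powr (real L * R)\<rceil>"

definition msg_set :: "nat \<Rightarrow> nat \<Rightarrow> (nat \<Rightarrow> real) \<Rightarrow> (nat \<Rightarrow> nat) set" where
  "msg_set s L R = (\<Pi>\<^sub>E i\<in>{1..s}. {1..msg_size L (R i)})"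

definition msg_dist :: "nat \<Rightarrow> nat \<Rightarrow> (nat \<Rightarrow> real) \<Rightarrow> (nat \<Rightarrow> nat) measure" where
  "msg_dist s L R = uniform_measure (count_space (msg_set s L R)) (msg_set s L R)"

definition gauss_channel :: "(nat \<Rightarrow> real) \<Rightarrow> nat \<Rightarrow> nat \<Rightarrow> (nat \<Rightarrow> real) \<Rightarrow> (nat \<Rightarrow> real) measure" where
  "gauss_channel h r L x =
     PiM {..<L} (\<lambda>t. density lborel (\<lambda>y. ennreal (normal_density (sqrt (h r) * x t) 1 y)))"

definition joint_law :: "nat \<Rightarrow> nat \<Rightarrow> (nat \<Rightarrow> real) \<Rightarrow> (nat \<Rightarrow> real)
    \<Rightarrow> ((nat \<Rightarrow> nat) \<Rightarrow> (nat \<Rightarrow> real) measure) \<Rightarrow> nat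
    \<Rightarrow> ((nat \<Rightarrow> nat) \<times> (nat \<Rightarrow> real)) measure" where
  "joint_law s L R h enc r =
     msg_dist s L R \<bind> (\<lambda>w. (enc w \<bind> gauss_channel h r L) \<bind>
        (\<lambda>y. return (count_space (msg_set s L R) \<Otimes>\<^sub>M block_space L) (w, y)))"

definition good_code ::
  "nat \<Rightarrow> (nat \<Rightarrow> real) \<Rightarrow> real \<Rightarrow> (nat \<Rightarrow> real) \<Rightarrow> real \<Rightarrow> nat
   \<Rightarrow> ((nat \<Rightarrow> nat) \<Rightarrow> (nat \<Rightarrow> real) measure)
   \<Rightarrow> (nat \<Rightarrow> (nat \<Rightarrow> real) \<Rightarrow> (nat \<Rightarrow> nat)) \<Rightarrow> bool" where
  "good_code s h Pmax R \<epsilon> L enc dec \<longleftrightarrow>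
     (\<forall>w\<in>msg_set s L R. enc w \<in> space (prob_algebra (block_space L))) \<and>
     (\<Sum>w\<in>msg_set s L R. \<integral>\<^sup>+ x. ennreal (\<Sum>t<L. (x t)\<^sup>2) \<partial>enc w)
        \<le> ennreal (real (card (msg_set s L R)) * real L * Pmax) \<and>
     (\<forall>j\<in>{1..s}. dec j \<in> block_space L \<rightarrow>\<^sub>M count_space UNIV) \<and>
     (\<forall>i\<in>{1..s}. \<forall>j\<in>{i..s}.
        measure (joint_law s L R h enc j)
          {p \<in> space (joint_law s L R h enc j). dec j (snd p) i \<noteq> fst p i} \<le> \<epsilon>) \<and>
     (\<forall>i\<in>{0..s}.
        prob_space.mutual_information (joint_law s L R h enc i) 2
          (count_space ((\<lambda>w. restrict w {i+1..s}) ` msg_set s L R)) (block_space L)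
          (\<lambda>p. restrict (fst p) {i+1..s}) snd / real L \<le> \<epsilon>)"

definition achievable :: "nat \<Rightarrow> (nat \<Rightarrow> real) \<Rightarrow> real \<Rightarrow> (nat \<Rightarrow> real) \<Rightarrow> bool" where
  "achievable s h Pmax R \<longleftrightarrow>
     (\<forall>\<epsilon>>0. \<exists>L0. \<forall>L\<ge>L0. \<exists>enc dec. good_code s h Pmax R \<epsilon> L enc dec)"

end

theory Submission
  imports Defs
begin

text \<open>
  Layer \<open>l\<close> carries a message \<open>w\<^sub>l\<close> and a local randomisation index \<open>v\<^sub>l\<close>; its Gaussian codeword
  of power \<open>p\<^sub>l\<close> is drawn afresh for every prefix \<open>(w\<^sub>1,v\<^sub>1),\<dots>,(w\<^sub>l,v\<^sub>l)\<close>, and \<open>X\<close> is the sum of the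
  layers. Averaging over a codeword turns the Gaussian density of the output given \<open>l\<close> layers into the
  one given \<open>l - 1\<close> layers, so every expectation over the codebook reduces to a second moment of a
  Gaussian block or to a likelihood ratio of mean 1. Threshold tests on the ratios decode layer \<open>l\<close>
  at receivers \<open>j \<ge> l\<close> as long as \<open>|W\<^sub>l| |V\<^sub>l|\<close> stays strictly below the capacity of layer \<open>l\<close>
  at receiver \<open>l\<close>.

  For secrecy at receiver \<open>i\<close>, the mutual information is at most the expectation of
  \<open>ln (1 + a)\<close> up to a constant, where \<open>a\<close> is the ratio of the output density averaged over \<open>v\<close> to
  the density given the cloud of the first \<open>i\<close> layers. Since \<open>ln (1 + a) \<le> ln (1 + b) + a / b\<close> with \<open>b\<close> the
  expectation of \<open>a\<close> given the transmitted codewords, only the terms of \<open>ln b\<close> remain, and these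
  concentrate at \<open>L\<close> times the gap between the eavesdropper's capacity and the randomisation rate.
  As only the leakage rate has to vanish, the randomisation rate may be slightly below that
  capacity; this is the slack that makes the boundary rates achievable.
\<close>

section \<open>Gaussian blocks\<close>

text \<open>The target rates leave no slack: the secret rates are exact differences of capacities,
  and the power budget may be exhausted. Three small losses are needed, and all are charged to the
  randomisation rate. The powers are scaled by a factor \<open>1 - t\<close>, which pays for a
  deviation of order \<open>sqrt L\<close> in the empirical power; the decoding threshold lies below
  capacity; the number of indices backs off further. A layer of zero power has nothing to give away,
  so it gets a single codeword.

  Degradedness enters through the monotonicity of the layer capacities in the gain: layer
  \<open>l\<close> is sized for receiver \<open>l\<close>, the weakest that must decode it, and for
  receiver \<open>l - 1\<close>, the strongest from which it must be hidden.

  No typical sets appear. Bad events are dominated by nonnegative functions whose means are computed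
  or bounded directly, and the leakage by logarithms, for which mean deviations of order
  \<open>sqrt L\<close> are harmless. Finitely many averages are thus small in expectation, and one
  codebook meets all of them at once, up to a factor that depends on \<open>s\<close> alone.\<close>

definition leb_block :: "nat \<Rightarrow> (nat \<Rightarrow> real) measure" where
  "leb_block L = PiM {..<L} (\<lambda>_. lborel)"

definition std_gauss :: "real measure" where
  "std_gauss = density lborel (\<lambda>x. ennreal (std_normal_density x))"

definition gauss_block :: "nat \<Rightarrow> (nat \<Rightarrow> real) measure" where
  "gauss_block L = PiM {..<L} (\<lambda>_. std_gauss)"

text \<open>The parameter \<open>v\<close> is the variance rather than the standard deviation,
  because independent Gaussian layers add variances.\<close>

definition block_density :: "nat \<Rightarrow> real \<Rightarrow> (nat \<Rightarrow> real) \<Rightarrow> (nat \<Rightarrow> real) \<Rightarrow> real" where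
  "block_density L v \<mu> y = (\<Prod>t<L. normal_density (\<mu> t) (sqrt v) (y t))"

lemma sets_std_gauss[measurable_cong, simp]: "sets std_gauss = sets borel"
  by (simp add: std_gauss_def)

lemma prob_space_std_gauss: "prob_space std_gauss"
  unfolding std_gauss_def by (rule prob_space_normal_density) simp

lemma prob_space_gauss_block: "prob_space (gauss_block L)"
  unfolding gauss_block_def by (intro prob_space_PiM prob_space_std_gauss)

text \<open>Densities live over \<open>leb_block\<close>, while codes are stated over
  \<open>block_space\<close>, whose factors \<open>borel\<close> carry no useful measure. Equal
  measurable sets let facts move between the two.\<close>

lemma sets_leb_block[measurable_cong, simp]: "sets (leb_block L) = sets (block_space L)"
  unfolding leb_block_def block_space_def by (intro sets_PiM_cong) auto

lemma sets_gauss_block[measurable_cong, simp]: "sets (gauss_block L) = sets (block_space L)"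
  unfolding gauss_block_def block_space_def by (intro sets_PiM_cong) auto

lemma space_leb_block[simp]: "space (leb_block L) = space (block_space L)"
  by (rule sets_eq_imp_space_eq) simp

lemma sigma_finite_leb_block: "sigma_finite_measure (leb_block L)"
proof -
  interpret product_sigma_finite "\<lambda>_::nat. lborel :: real measure" ..
  show ?thesis unfolding leb_block_def by (intro sigma_finite) simp
qed

lemma measurable_block_component:
  "t < L \<Longrightarrow> (\<lambda>y. y t) \<in> borel_measurable (block_space L)"
  unfolding block_space_def by measurable

lemma measurable_leb_block_component:
  "t < L \<Longrightarrow> (\<lambda>y. y t) \<in> borel_measurable (leb_block L)"
  using measurable_block_component by (subst measurable_cong_sets[OF sets_leb_block refl])

lemma block_density_nonneg[simp]: "0 \<le> block_density L v \<mu> y"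
  unfolding block_density_def by (intro prod_nonneg) auto

lemma block_density_pos: "0 < v \<Longrightarrow> 0 < block_density L v \<mu> y"
  unfolding block_density_def by (intro prod_pos) (auto intro: normal_density_pos)

lemma measurable_normal_density[measurable (raw)]:
  assumes "\<mu> \<in> borel_measurable M" "y \<in> borel_measurable M"
  shows "(\<lambda>x. normal_density (\<mu> x) \<sigma> (y x)) \<in> borel_measurable M"
  unfolding normal_density_def using assms by measurable

lemma measurable_block_density[measurable (raw)]:
  assumes "\<And>t. t < L \<Longrightarrow> (\<lambda>x. \<mu> x t) \<in> borel_measurable M"
    and "\<And>t. t < L \<Longrightarrow> (\<lambda>x. y x t) \<in> borel_measurable M"
  shows "(\<lambda>x. block_density L v (\<mu> x) (y x)) \<in> borel_measurable M"
  unfolding block_density_def using assms by (intro borel_measurable_prod measurable_normal_density) auto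

lemma measurable_block_density_right[measurable]: "block_density L v \<mu> \<in> borel_measurable (block_space L)"
  by (rule measurable_block_density) (auto intro: measurable_block_component)

text \<open>For standard normal \<open>u\<close>, the shift \<open>q * u\<close> is a centred
  Gaussian of variance \<open>q^2\<close>, so this is a convolution of two centred normal densities
  evaluated at \<open>y - \<mu>\<close>. The case \<open>q = 0\<close> is apart because that
  Gaussian degenerates to a point mass.\<close>

lemma normal_density_marginal:
  assumes v: "0 < v"
  shows "(\<integral>\<^sup>+u. ennreal (normal_density (\<mu> + q * u) (sqrt v) y) \<partial>std_gauss)
    = ennreal (normal_density \<mu> (sqrt (v + q\<^sup>2)) y)"
proof (cases "q = 0")
  case True
  interpret prob_space std_gauss by (rule prob_space_std_gauss)
  show ?thesis using True by (simp add: emeasure_space_1[simplified])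
next
  case q: False
  have eq: "\<bar>q\<bar> * (normal_density 0 (sqrt v) (y - \<mu> - q * u) * normal_density 0 \<bar>q\<bar> (q * u))
    = std_normal_density u * normal_density (\<mu> + q * u) (sqrt v) y" for u
  proof -
    have "sqrt (2 * pi * q\<^sup>2) = \<bar>q\<bar> * sqrt (2 * pi)" by (simp add: real_sqrt_mult)
    then have "\<bar>q\<bar> * normal_density 0 \<bar>q\<bar> (q * u) = std_normal_density u"
      using q by (simp add: normal_density_def power_mult_distrib)
    moreover have "normal_density 0 (sqrt v) (y - \<mu> - q * u) = normal_density (\<mu> + q * u) (sqrt v) y"
      by (simp add: normal_density_def algebra_simps)
    ultimately show ?thesis by (metis mult.assoc mult.commute)
  qed
  have "ennreal (normal_density \<mu> (sqrt (v + q\<^sup>2)) y) = ennreal (normal_density 0 (sqrt ((sqrt v)\<^sup>2 + \<bar>q\<bar>\<^sup>2)) (y - \<mu>))"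
    using v by (simp add: normal_density_def)
  also have "\<dots> = (\<integral>\<^sup>+w. ennreal (normal_density 0 (sqrt v) (y - \<mu> - w) * normal_density 0 \<bar>q\<bar> w) \<partial>lborel)"
    using conv_normal_density_zero_mean[of "sqrt v" "\<bar>q\<bar>"] v q by (simp add: fun_eq_iff)
  \<comment> \<open>The convolution variable becomes \<open>q * u\<close>; the Jacobian turns the
    density of variance \<open>q^2\<close> back into the standard one, which is
    \<open>eq\<close>.\<close>
  also have "\<dots> = ennreal \<bar>q\<bar> * (\<integral>\<^sup>+u. ennreal (normal_density 0 (sqrt v) (y - \<mu> - (0 + q * u)) * normal_density 0 \<bar>q\<bar> (0 + q * u)) \<partial>lborel)"
    by (rule nn_integral_real_affine) (use q in auto)
  also have "\<dots> = (\<integral>\<^sup>+u. ennreal (std_normal_density u) * ennreal (normal_density (\<mu> + q * u) (sqrt v) y) \<partial>lborel)"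
    by (simp add: nn_integral_cmult[symmetric] ennreal_mult'[symmetric] eq del: mult_minus_right)
  also have "\<dots> = (\<integral>\<^sup>+u. ennreal (normal_density (\<mu> + q * u) (sqrt v) y) \<partial>std_gauss)"
    unfolding std_gauss_def
    by (subst nn_integral_density) (auto simp: normal_density_def)
  finally show ?thesis ..
qed

lemma block_density_marginal:
  assumes v: "0 < v"
  shows "(\<integral>\<^sup>+u. ennreal (block_density L v (\<lambda>t. \<mu> t + q * u t) y) \<partial>gauss_block L)
    = ennreal (block_density L (v + q\<^sup>2) \<mu> y)"
proof -
  interpret prob_space std_gauss by (rule prob_space_std_gauss)
  interpret product_sigma_finite "\<lambda>_::nat. std_gauss" ..
  have "(\<integral>\<^sup>+u. ennreal (block_density L v (\<lambda>t. \<mu> t + q * u t) y) \<partial>gauss_block L)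
    = (\<integral>\<^sup>+u. (\<Prod>t<L. ennreal (normal_density (\<mu> t + q * u t) (sqrt v) (y t))) \<partial>PiM {..<L} (\<lambda>_. std_gauss))"
    unfolding gauss_block_def block_density_def by (simp add: prod_ennreal)
  also have "\<dots> = (\<Prod>t<L. (\<integral>\<^sup>+u. ennreal (normal_density (\<mu> t + q * u) (sqrt v) (y t)) \<partial>std_gauss))"
    by (rule product_nn_integral_prod) auto
  also have "\<dots> = (\<Prod>t<L. ennreal (normal_density (\<mu> t) (sqrt (v + q\<^sup>2)) (y t)))"
    using v by (simp add: normal_density_marginal)
  finally show ?thesis by (simp add: block_density_def prod_ennreal)
qed

text \<open>Finite product measures are determined by their values on boxes, and on a box both sides
  factor over the coordinates.\<close>

lemma PiM_normal_eq_density: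
  assumes v: "0 < v"
  shows "PiM {..<L} (\<lambda>t. density lborel (\<lambda>x. ennreal (normal_density (\<mu> t) (sqrt v) x)))
    = density (leb_block L) (\<lambda>y. ennreal (block_density L v \<mu> y))"
proof -
  let ?N = "\<lambda>t. density lborel (\<lambda>x. ennreal (normal_density (\<mu> t) (sqrt v) x))"
  interpret N: product_prob_space ?N "{..<L}"
    by (rule product_prob_spaceI) (use v in \<open>auto intro: prob_space_normal_density\<close>)
  interpret B: product_sigma_finite "\<lambda>_::nat. lborel :: real measure" ..
  show ?thesis
  proof (rule N.PiM_eqI[symmetric])
    show "sets (density (leb_block L) (\<lambda>y. ennreal (block_density L v \<mu> y))) = sets (PiM {..<L} ?N)"
      unfolding sets_density leb_block_def by (intro sets_PiM_cong) auto
    fix A assume A: "\<And>t. t \<in> {..<L} \<Longrightarrow> A t \<in> sets (?N t)"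
    then have A': "\<And>t. t \<in> {..<L} \<Longrightarrow> A t \<in> sets borel" by simp
    have PA: "Pi\<^sub>E {..<L} A \<in> sets (leb_block L)"
      unfolding leb_block_def using A' by (intro sets_PiM_I_finite) auto
    have "emeasure (density (leb_block L) (\<lambda>y. ennreal (block_density L v \<mu> y))) (Pi\<^sub>E {..<L} A)
      = (\<integral>\<^sup>+y. ennreal (block_density L v \<mu> y) * indicator (Pi\<^sub>E {..<L} A) y \<partial>leb_block L)"
      using PA by (intro emeasure_density) (measurable, auto intro: measurable_block_component)
    also have "\<dots> = (\<integral>\<^sup>+y. (\<Prod>t<L. ennreal (normal_density (\<mu> t) (sqrt v) (y t)) * indicator (A t) (y t)) \<partial>PiM {..<L} (\<lambda>_. lborel))"
      unfolding leb_block_def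
    proof (rule nn_integral_cong)
      fix y :: "nat \<Rightarrow> real" assume y: "y \<in> space (PiM {..<L} (\<lambda>_. lborel))"
      \<comment> \<open>Membership in the box also asks for \<open>undefined\<close> outside
        \<open>{..<L}\<close>. As a point of the space, \<open>y\<close> has this, so a failure
        shows up in some coordinate.\<close>
      have "indicator (Pi\<^sub>E {..<L} A) y = (\<Prod>t<L. indicator (A t) (y t) :: ennreal)"
      proof (cases "y \<in> Pi\<^sub>E {..<L} A")
        case True then show ?thesis by (simp add: PiE_mem)
      next
        case False
        then obtain t where "t < L" "y t \<notin> A t"
          using y by (auto simp: space_PiM PiE_iff)
        then have "(\<Prod>t<L. indicator (A t) (y t) :: ennreal) = 0"
          by (intro prod_zero) (auto intro!: bexI[of _ t])
        with False show ?thesis by simp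
      qed
      then show "ennreal (block_density L v \<mu> y) * indicator (Pi\<^sub>E {..<L} A) y
        = (\<Prod>t<L. ennreal (normal_density (\<mu> t) (sqrt v) (y t)) * indicator (A t) (y t))"
        by (simp add: block_density_def prod.distrib prod_ennreal)
    qed
    also have "\<dots> = (\<Prod>t<L. \<integral>\<^sup>+x. ennreal (normal_density (\<mu> t) (sqrt v) x) * indicator (A t) x \<partial>lborel)"
      by (rule B.product_nn_integral_prod) (use A' in auto)
    also have "\<dots> = (\<Prod>t<L. emeasure (?N t) (A t))"
      using A' by (intro prod.cong refl) (subst emeasure_density, auto)
    finally show "emeasure (density (leb_block L) (\<lambda>y. ennreal (block_density L v \<mu> y))) (Pi\<^sub>E {..<L} A)
      = (\<Prod>t\<in>{..<L}. emeasure (?N t) (A t))" .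
  qed simp
qed

lemma gauss_channel_eq_density:
  "gauss_channel h r L x = density (leb_block L) (\<lambda>y. ennreal (block_density L 1 (\<lambda>t. sqrt (h r) * x t) y))"
  using PiM_normal_eq_density[of 1 L "\<lambda>t. sqrt (h r) * x t"] by (simp add: gauss_channel_def)

lemma nn_integral_block_density:
  assumes v: "0 < v"
  shows "(\<integral>\<^sup>+y. ennreal (block_density L v \<mu> y) \<partial>leb_block L) = 1"
proof -
  interpret prob_space "PiM {..<L} (\<lambda>t. density lborel (\<lambda>x. ennreal (normal_density (\<mu> t) (sqrt v) x)))"
    by (intro prob_space_PiM prob_space_normal_density) (use v in auto)
  have "1 = (\<integral>\<^sup>+y. 1 \<partial>PiM {..<L} (\<lambda>t. density lborel (\<lambda>x. ennreal (normal_density (\<mu> t) (sqrt v) x))))"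
    by (simp add: emeasure_space_1)
  also have "\<dots> = (\<integral>\<^sup>+y. ennreal (block_density L v \<mu> y) * 1 \<partial>leb_block L)"
    unfolding PiM_normal_eq_density[OF v] by (intro nn_integral_density) measurable
  finally show ?thesis by simp
qed

text \<open>The moments of order 0, 2, 4 about the mean are 1, \<open>v\<close>,
  \<open>3 * v^2\<close>, so the centred normalised square has variance 2. The shift
  \<open>a\<close> stands for the other coordinates and turns the block case into an
  induction.\<close>

lemma nn_integral_normal_chi_square:
  assumes v: "0 < v"
  shows "(\<integral>\<^sup>+x. ennreal ((a + ((x - \<mu>)\<^sup>2 / v - 1))\<^sup>2) \<partial>density lborel (\<lambda>x. ennreal (normal_density \<mu> (sqrt v) x)))
    = ennreal (a\<^sup>2 + 2)"
proof -
  have m: "has_bochner_integral lborel (\<lambda>x. normal_density \<mu> (sqrt v) x * (x - \<mu>) ^ (2 * k))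
      (fact (2 * k) / ((2 / v)^k * fact k))" for k
    using normal_moment_even[of "sqrt v" \<mu> k] v by simp
  have "has_bochner_integral lborel (\<lambda>x. (a - 1)\<^sup>2 * (normal_density \<mu> (sqrt v) x * (x - \<mu>) ^ (2 * 0))
      + (2 * (a - 1) / v * (normal_density \<mu> (sqrt v) x * (x - \<mu>) ^ (2 * 1))
      + 1 / v\<^sup>2 * (normal_density \<mu> (sqrt v) x * (x - \<mu>) ^ (2 * 2))))
      ((a - 1)\<^sup>2 * (fact (2 * 0) / ((2 / v)^0 * fact 0)) + (2 * (a - 1) / v * (fact (2 * 1) / ((2 / v)^1 * fact 1))
      + 1 / v\<^sup>2 * (fact (2 * 2) / ((2 / v)^2 * fact 2))))"
    by (intro has_bochner_integral_add has_bochner_integral_mult_right m)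
  also have "(\<lambda>x. (a - 1)\<^sup>2 * (normal_density \<mu> (sqrt v) x * (x - \<mu>) ^ (2 * 0))
      + (2 * (a - 1) / v * (normal_density \<mu> (sqrt v) x * (x - \<mu>) ^ (2 * 1))
      + 1 / v\<^sup>2 * (normal_density \<mu> (sqrt v) x * (x - \<mu>) ^ (2 * 2))))
    = (\<lambda>x. normal_density \<mu> (sqrt v) x * (a + ((x - \<mu>)\<^sup>2 / v - 1))\<^sup>2)"
    using v by (simp add: fun_eq_iff field_simps power2_eq_square power4_eq_xxxx)
  also have "(a - 1)\<^sup>2 * (fact (2 * 0) / ((2 / v)^0 * fact 0)) + (2 * (a - 1) / v * (fact (2 * 1) / ((2 / v)^1 * fact 1))
      + 1 / v\<^sup>2 * (fact (2 * 2) / ((2 / v)^2 * fact 2))) = a\<^sup>2 + 2"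
    using v by (simp add: fact_numeral field_simps power2_eq_square)
  finally have hb: "has_bochner_integral lborel
    (\<lambda>x. normal_density \<mu> (sqrt v) x * (a + ((x - \<mu>)\<^sup>2 / v - 1))\<^sup>2) (a\<^sup>2 + 2)" .
  have "(\<integral>\<^sup>+x. ennreal ((a + ((x - \<mu>)\<^sup>2 / v - 1))\<^sup>2) \<partial>density lborel (\<lambda>x. ennreal (normal_density \<mu> (sqrt v) x)))
    = (\<integral>\<^sup>+x. ennreal (normal_density \<mu> (sqrt v) x * (a + ((x - \<mu>)\<^sup>2 / v - 1))\<^sup>2) \<partial>lborel)"
    by (subst nn_integral_density) (auto simp: ennreal_mult')
  also have "\<dots> = ennreal (a\<^sup>2 + 2)"
    using hb by (subst nn_integral_eq_integral) (auto simp: has_bochner_integral_iff)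
  finally show ?thesis .
qed

lemma nn_integral_block_density_chi_square:
  assumes v: "0 < v"
  shows "(\<integral>\<^sup>+y. ennreal (block_density L v \<mu> y) * ennreal ((\<Sum>t<L. (y t - \<mu> t)\<^sup>2 / v - 1)\<^sup>2) \<partial>leb_block L) = ennreal (2 * real L)"
proof -
  let ?N = "\<lambda>t. density lborel (\<lambda>x. ennreal (normal_density (\<mu> t) (sqrt v) x))"
  have pN: "prob_space (?N t)" for t by (intro prob_space_normal_density) (use v in auto)
  interpret N: product_prob_space ?N UNIV
    by (rule product_prob_spaceI) (rule pN)
  \<comment> \<open>Arbitrary finite index sets allow an induction that inserts one coordinate at a
    time.\<close>
  have fin: "(\<integral>\<^sup>+y. ennreal ((\<Sum>t\<in>I. (y t - \<mu> t)\<^sup>2 / v - 1)\<^sup>2) \<partial>PiM I ?N) = ennreal (2 * real (card I))"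
    if "finite I" for I using that
  proof (induction I)
    case empty
    interpret prob_space "PiM {} ?N" by (intro prob_space_PiM pN)
    show ?case by simp
  next
    case (insert i I)
    interpret P: prob_space "PiM I ?N" by (intro prob_space_PiM pN)
    have m: "(\<lambda>x. x t) \<in> borel_measurable (PiM J ?N)" if "t \<in> J" for t J
      using measurable_component_singleton[OF that, of ?N] by simp
    have "(\<integral>\<^sup>+y. ennreal ((\<Sum>t\<in>insert i I. (y t - \<mu> t)\<^sup>2 / v - 1)\<^sup>2) \<partial>PiM (insert i I) ?N)
      = (\<integral>\<^sup>+y. (\<integral>\<^sup>+x. ennreal ((\<Sum>t\<in>insert i I. ((y(i := x)) t - \<mu> t)\<^sup>2 / v - 1)\<^sup>2) \<partial>?N i) \<partial>PiM I ?N)"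
      using insert.hyps
      by (intro N.product_nn_integral_insert) (auto intro!: borel_measurable_sum borel_measurable_power borel_measurable_diff borel_measurable_divide m measurable_compose[OF _ measurable_ennreal])
    also have "\<dots> = (\<integral>\<^sup>+y. ennreal ((\<Sum>t\<in>I. (y t - \<mu> t)\<^sup>2 / v - 1)\<^sup>2 + 2) \<partial>PiM I ?N)"
    proof (rule nn_integral_cong)
      fix y
      have "(\<Sum>t\<in>insert i I. ((y(i := x)) t - \<mu> t)\<^sup>2 / v - 1) = (\<Sum>t\<in>I. (y t - \<mu> t)\<^sup>2 / v - 1) + ((x - \<mu> i)\<^sup>2 / v - 1)" for x
        using insert.hyps by (auto intro!: sum.cong)
      then show "(\<integral>\<^sup>+x. ennreal ((\<Sum>t\<in>insert i I. ((y(i := x)) t - \<mu> t)\<^sup>2 / v - 1)\<^sup>2) \<partial>?N i)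
        = ennreal ((\<Sum>t\<in>I. (y t - \<mu> t)\<^sup>2 / v - 1)\<^sup>2 + 2)"
        using v by (simp only: nn_integral_normal_chi_square)
    qed
    also have "\<dots> = (\<integral>\<^sup>+y. ennreal ((\<Sum>t\<in>I. (y t - \<mu> t)\<^sup>2 / v - 1)\<^sup>2) + 2 \<partial>PiM I ?N)"
      by (intro nn_integral_cong) (simp add: ennreal_plus)
    also have "\<dots> = (\<integral>\<^sup>+y. ennreal ((\<Sum>t\<in>I. (y t - \<mu> t)\<^sup>2 / v - 1)\<^sup>2) \<partial>PiM I ?N) + 2"
      by (subst nn_integral_add) (auto intro!: borel_measurable_sum borel_measurable_power borel_measurable_diff borel_measurable_divide m measurable_compose[OF _ measurable_ennreal] simp: P.emeasure_space_1)
    also have "\<dots> = ennreal (2 * real (card (insert i I)))"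
      using insert.hyps by (simp add: insert.IH ennreal_plus[symmetric] algebra_simps flip: ennreal_numeral del: ennreal_plus)
    finally show ?case .
  qed
  have "(\<integral>\<^sup>+y. ennreal (block_density L v \<mu> y) * ennreal ((\<Sum>t<L. (y t - \<mu> t)\<^sup>2 / v - 1)\<^sup>2) \<partial>leb_block L)
    = (\<integral>\<^sup>+y. ennreal ((\<Sum>t<L. (y t - \<mu> t)\<^sup>2 / v - 1)\<^sup>2) \<partial>PiM {..<L} ?N)"
    unfolding PiM_normal_eq_density[OF v]
    by (subst nn_integral_density)
       (auto intro!: borel_measurable_sum borel_measurable_power borel_measurable_diff borel_measurable_divide measurable_leb_block_component measurable_compose[OF _ measurable_ennreal])
  with fin[of "{..<L}"] show ?thesis by simp
qed

section \<open>Tree-structured superposition codebooks\<close>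

locale superposition_code =
  fixes s L :: nat and p h :: "nat \<Rightarrow> real" and A M :: "nat \<Rightarrow> nat"
  assumes p_nonneg: "\<And>k. k \<in> {1..s} \<Longrightarrow> 0 \<le> p k"
    and h_pos: "\<And>r. r \<le> s \<Longrightarrow> 0 < h r"
    and A_pos: "\<And>k. k \<in> {1..s} \<Longrightarrow> 0 < A k"
    and M_pos: "\<And>k. k \<in> {1..s} \<Longrightarrow> 0 < M k"
begin

text \<open>Layer \<open>k\<close> of a message is a pair of a secret value out of \<open>A k\<close> and a randomisation index out of \<open>M k\<close>.\<close>

definition msgs :: "(nat \<Rightarrow> nat \<times> nat) set" where
  "msgs = (\<Pi>\<^sub>E k\<in>{1..s}. {1..A k} \<times> {..<M k})"

text \<open>The label of a codeword is its whole prefix, which gives the codebook its tree shape.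
  The level is stored as well: a restriction is padded with \<open>undefined\<close>, which may
  itself be a legitimate pair, so the prefix alone might not reveal its length.\<close>

definition idx :: "nat \<Rightarrow> (nat \<Rightarrow> nat \<times> nat) \<Rightarrow> nat \<times> (nat \<Rightarrow> nat \<times> nat)" where
  "idx l m = (l, restrict m {1..l})"

definition ixs :: "(nat \<times> (nat \<Rightarrow> nat \<times> nat)) set" where
  "ixs = (\<lambda>(l, m). idx l m) ` ({1..s} \<times> msgs)"

text \<open>Codewords have unit power per letter; the factors \<open>sqrt (p l)\<close> come in with
  \<open>mean\<close>, so the sampling law is the same for all powers.\<close>

definition codebooks :: "(nat \<times> (nat \<Rightarrow> nat \<times> nat) \<Rightarrow> nat \<Rightarrow> real) measure" where
  "codebooks = PiM ixs (\<lambda>_. gauss_block L)"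

text \<open>
  Given the first \<open>k\<close> layers, the layers above act as noise: at receiver \<open>r\<close> every letter is Gaussian
  with mean \<open>mean r k\<close> and variance \<open>vr r k\<close>. The block then has density \<open>f r k\<close>, and \<open>S r k\<close> is the
  deviation of its normalised squared residual from \<open>L\<close>.
\<close>

definition tail :: "nat \<Rightarrow> real" where
  "tail k = (\<Sum>l\<in>{k+1..s}. p l)"

definition vr :: "nat \<Rightarrow> nat \<Rightarrow> real" where
  "vr r k = 1 + h r * tail k"

definition mean where
  "mean r k m c t = sqrt (h r) * (\<Sum>l\<in>{1..k}. sqrt (p l) * c (idx l m) t)"

definition f where
  "f r k m c y = block_density L (vr r k) (mean r k m c) y"

definition S where
  "S r k m c y = (\<Sum>t<L. (y t - mean r k m c t)\<^sup>2 / vr r k - 1)"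

section \<open>Labels, tail powers and the dependence of densities on codewords\<close>

lemma finite_msgs[simp]: "finite msgs"
  unfolding msgs_def by (intro finite_PiE) auto

lemma msgs_nonempty: "msgs \<noteq> {}"
proof -
  have "(\<lambda>k\<in>{1..s}. (1, 0)) \<in> msgs"
    using A_pos M_pos by (fastforce simp: msgs_def)
  then show ?thesis by auto
qed

lemma finite_ixs[simp]: "finite ixs"
  unfolding ixs_def by simp

lemma idx_in_ixs: "l \<in> {1..s} \<Longrightarrow> m \<in> msgs \<Longrightarrow> idx l m \<in> ixs"
  unfolding ixs_def by force

lemma prob_space_codebooks: "prob_space codebooks"
  unfolding codebooks_def by (intro prob_space_PiM prob_space_gauss_block)

lemma tail_nonneg: "0 \<le> tail k"
  unfolding tail_def using p_nonneg by (intro sum_nonneg) auto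

lemma tail_eq: "k < s \<Longrightarrow> tail k = p (Suc k) + tail (Suc k)"
  unfolding tail_def by (subst sum.atLeast_Suc_atMost) auto

lemma tail_s[simp]: "tail s = 0"
  by (simp add: tail_def)

lemma vr_ge_1: "r \<le> s \<Longrightarrow> 1 \<le> vr r k"
  unfolding vr_def using h_pos[of r] tail_nonneg[of k] by simp

lemma vr_pos: "r \<le> s \<Longrightarrow> 0 < vr r k"
  using vr_ge_1[of r k] by simp

lemma f_pos: "r \<le> s \<Longrightarrow> 0 < f r k m c y"
  unfolding f_def by (intro block_density_pos vr_pos)

lemma f_nonneg[simp]: "0 \<le> f r k m c y"
  unfolding f_def by simp

lemma restrict_mono_eq:
  assumes "restrict m {1..k} = restrict m' {1..k}" "l \<le> k"
  shows "restrict m {1..l} = restrict m' {1..l::nat}"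
proof -
  have "restrict (restrict m {1..k}) {1..l} = restrict (restrict m' {1..k}) {1..l}"
    using assms(1) by simp
  then show ?thesis using \<open>l \<le> k\<close> by (simp add: restrict_restrict Int_absorb1)
qed

lemma mean_cong_msg:
  assumes "restrict m {1..k} = restrict m' {1..k}"
  shows "mean r k m c = mean r k m' c"
proof -
  have "idx l m = idx l m'" if "l \<in> {1..k}" for l
    using restrict_mono_eq[OF assms, of l] that unfolding idx_def by simp
  then show ?thesis by (simp add: mean_def fun_eq_iff)
qed

lemma f_cong_msg: "restrict m {1..k} = restrict m' {1..k} \<Longrightarrow> f r k m c y = f r k m' c y"
  unfolding f_def by (subst mean_cong_msg[of m k m']) auto

text \<open>Independence of a codeword is phrased as invariance under overwriting its entry, the
  form in which one coordinate of a product measure is integrated out.\<close>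

lemma mean_upd:
  assumes "\<And>l. l \<in> {1..k} \<Longrightarrow> idx l m \<noteq> \<kappa>"
  shows "mean r k m (c(\<kappa> := u)) = mean r k m c"
  using assms by (simp add: mean_def fun_eq_iff)

lemma f_upd: "(\<And>l. l \<in> {1..k} \<Longrightarrow> idx l m \<noteq> \<kappa>) \<Longrightarrow> f r k m (c(\<kappa> := u)) y = f r k m c y"
  unfolding f_def by (subst mean_upd) auto

lemma S_upd: "(\<And>l. l \<in> {1..k} \<Longrightarrow> idx l m \<noteq> \<kappa>) \<Longrightarrow> S r k m (c(\<kappa> := u)) y = S r k m c y"
  unfolding S_def by (subst mean_upd) auto

section \<open>Joint measurability in the codebook and the output\<close>

lemma measurable_codeword:
  assumes g: "g \<in> N \<rightarrow>\<^sub>M codebooks" and "\<kappa> \<in> ixs" "t < L"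
  shows "(\<lambda>x. g x \<kappa> t) \<in> borel_measurable N"
proof -
  have "(\<lambda>c. c \<kappa>) \<in> codebooks \<rightarrow>\<^sub>M gauss_block L"
    unfolding codebooks_def using \<open>\<kappa> \<in> ixs\<close> by (rule measurable_component_singleton)
  from measurable_compose[OF g this] have "(\<lambda>x. g x \<kappa>) \<in> N \<rightarrow>\<^sub>M block_space L"
    by (subst (asm) measurable_cong_sets[OF refl sets_gauss_block])
  from measurable_compose[OF this measurable_block_component[OF \<open>t < L\<close>]] show ?thesis .
qed

lemma measurable_mean:
  assumes g: "g \<in> N \<rightarrow>\<^sub>M codebooks" and "m \<in> msgs" "k \<le> s" "t < L"
  shows "(\<lambda>x. mean r k m (g x) t) \<in> borel_measurable N"
  unfolding mean_def using assms
  by (intro borel_measurable_times borel_measurable_sum measurable_codeword[OF g] idx_in_ixs) auto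

lemma measurable_leb_component:
  assumes "y \<in> N \<rightarrow>\<^sub>M leb_block L" "t < L"
  shows "(\<lambda>x. y x t) \<in> borel_measurable N"
  using measurable_compose[OF assms(1) measurable_leb_block_component[OF assms(2)]] .

lemma measurable_f:
  assumes "g \<in> N \<rightarrow>\<^sub>M codebooks" "y \<in> N \<rightarrow>\<^sub>M leb_block L" "m \<in> msgs" "k \<le> s"
  shows "(\<lambda>x. f r k m (g x) (y x)) \<in> borel_measurable N"
  unfolding f_def using assms by (intro measurable_block_density measurable_mean measurable_leb_component)

lemma measurable_S:
  assumes "g \<in> N \<rightarrow>\<^sub>M codebooks" "y \<in> N \<rightarrow>\<^sub>M leb_block L" "m \<in> msgs" "k \<le> s"
  shows "(\<lambda>x. S r k m (g x) (y x)) \<in> borel_measurable N"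
  unfolding S_def
proof (rule borel_measurable_sum)
  fix t assume "t \<in> {..<L}"
  then have [measurable]: "(\<lambda>x. y x t) \<in> borel_measurable N" "(\<lambda>x. mean r k m (g x) t) \<in> borel_measurable N"
    using measurable_leb_component[OF assms(2), of t] measurable_mean[OF assms(1,3,4), of t r] by auto
  show "(\<lambda>x. (y x t - mean r k m (g x) t)\<^sup>2 / vr r k - 1) \<in> borel_measurable N"
    by measurable
qed

section \<open>Averages over codewords at a fixed output\<close>

lemma swap_codebook_output:
  assumes "case_prod F \<in> borel_measurable (codebooks \<Otimes>\<^sub>M leb_block L)"
  shows "(\<integral>\<^sup>+c. (\<integral>\<^sup>+y. F c y \<partial>leb_block L) \<partial>codebooks) = (\<integral>\<^sup>+y. (\<integral>\<^sup>+c. F c y \<partial>codebooks) \<partial>leb_block L)"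
proof -
  interpret C: prob_space codebooks by (rule prob_space_codebooks)
  interpret pair_sigma_finite "leb_block L" codebooks
    by (intro pair_sigma_finite.intro sigma_finite_leb_block C.sigma_finite_measure_axioms)
  have "(\<lambda>(y, c). F c y) \<in> borel_measurable (leb_block L \<Otimes>\<^sub>M codebooks)"
    using measurable_pair_swap[OF assms] by (simp add: case_prod_beta')
  then show ?thesis by (rule Fubini')
qed

text \<open>As a function of the codeword \<open>idx l m\<close> alone, \<open>f r l m c y\<close>
  is a Gaussian density with shifted mean, so integrating that codeword adds
  \<open>h r * p l\<close> to the variance. \<open>H\<close> collects all factors that ignore this
  codeword.\<close>

lemma average_codeword:
  assumes r: "r \<le> s" and m: "m \<in> msgs" and l: "l \<in> {1..s}" and y: "y \<in> space (leb_block L)"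
    and H: "H \<in> borel_measurable codebooks" and Hu: "\<And>c u. H (c(idx l m := u)) = H c"
  shows "(\<integral>\<^sup>+c. ennreal (f r l m c y) * H c \<partial>codebooks) = (\<integral>\<^sup>+c. ennreal (f r (l - 1) m c y) * H c \<partial>codebooks)"
proof -
  let ?k = "idx l m"
  interpret G: prob_space "gauss_block L" by (rule prob_space_gauss_block)
  interpret P: product_sigma_finite "\<lambda>_::nat \<times> (nat \<Rightarrow> nat \<times> nat). gauss_block L" ..
  have ix: "ixs = insert ?k (ixs - {?k})" using idx_in_ixs[OF l m] by auto
  have meas: "(\<lambda>c. ennreal (f r j m c y) * H c) \<in> borel_measurable codebooks" if "j \<le> s" for j
    using H m y that by (intro borel_measurable_times_ennreal measurable_compose[OF measurable_f measurable_ennreal]) auto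
  \<comment> \<open>The codeword \<open>?k\<close> becomes the innermost integral.\<close>
  have ins: "(\<integral>\<^sup>+c. F c \<partial>codebooks) = (\<integral>\<^sup>+c. (\<integral>\<^sup>+u. F (c(?k := u)) \<partial>gauss_block L) \<partial>PiM (ixs - {?k}) (\<lambda>_. gauss_block L))"
    if F: "F \<in> borel_measurable codebooks" for F
    unfolding codebooks_def
    by (subst ix, rule P.product_nn_integral_insert)
       (use F in \<open>auto simp: codebooks_def insert_absorb[OF idx_in_ixs[OF l m]]\<close>)
  have ne: "idx l' m' \<noteq> ?k" if "l' \<noteq> l" for l' m' using that by (simp add: idx_def)
  have f1: "f r (l - 1) m (c(?k := u)) y = f r (l - 1) m c y" for c u
    using l by (intro f_upd ne) auto
  have f0: "f r l m (c(?k := u)) y = block_density L (vr r l) (\<lambda>t. mean r (l - 1) m c t + sqrt (h r * p l) * u t) y" for c u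
  proof -
    have "mean r l m (c(?k := u)) t = mean r (l - 1) m c t + sqrt (h r * p l) * u t" for t
    proof -
      have L: "{1..l} = insert l {1..l - 1}" "finite {1..l - 1}" "l \<notin> {1..l - 1}" using l by auto
      have "mean r l m (c(?k := u)) t = mean r (l - 1) m (c(?k := u)) t + sqrt (h r) * (sqrt (p l) * u t)"
        unfolding mean_def L(1) sum.insert[OF L(2,3)] by (simp add: distrib_left)
      also have "mean r (l - 1) m (c(?k := u)) = mean r (l - 1) m c"
        using l by (intro mean_upd ne) auto
      finally show ?thesis by (simp only: real_sqrt_mult mult.assoc)
    qed
    then have "mean r l m (c(?k := u)) = (\<lambda>t. mean r (l - 1) m c t + sqrt (h r * p l) * u t)" by blast
    then show ?thesis by (simp only: f_def)
  qed
  \<comment> \<open>Passing from \<open>l\<close> to \<open>l - 1\<close> hands the power of layer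
    \<open>l\<close> over to the noise.\<close>
  have v: "vr r l + (sqrt (h r * p l))\<^sup>2 = vr r (l - 1)"
  proof -
    have "tail (l - 1) = p l + tail l" using l tail_eq[of "l - 1"] by (cases l) auto
    then show ?thesis using h_pos[OF r] p_nonneg[OF l] by (simp add: vr_def algebra_simps)
  qed
  have inner: "(\<integral>\<^sup>+u. ennreal (f r l m (c(?k := u)) y) \<partial>gauss_block L) = ennreal (f r (l - 1) m c y)" for c
    unfolding f0 using block_density_marginal[OF vr_pos[OF r]] v by (simp add: f_def)
  have mu: "(\<lambda>u. ennreal (f r l m (c(?k := u)) y)) \<in> borel_measurable (gauss_block L)" for c
    unfolding f0 by (intro measurable_compose[OF measurable_block_density measurable_ennreal] borel_measurable_add borel_measurable_times borel_measurable_const)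
       (auto intro: measurable_block_component simp: measurable_cong_sets[OF sets_gauss_block refl])
  have "(\<integral>\<^sup>+c. ennreal (f r l m c y) * H c \<partial>codebooks)
      = (\<integral>\<^sup>+c. (\<integral>\<^sup>+u. ennreal (f r l m (c(?k := u)) y) * H c \<partial>gauss_block L) \<partial>PiM (ixs - {?k}) (\<lambda>_. gauss_block L))"
    using l by (subst ins[OF meas]) (auto simp: Hu)
  also have "\<dots> = (\<integral>\<^sup>+c. ennreal (f r (l - 1) m c y) * H c \<partial>PiM (ixs - {?k}) (\<lambda>_. gauss_block L))"
    by (intro nn_integral_cong) (subst nn_integral_multc[OF mu], simp add: inner)
  \<comment> \<open>Nothing depends on \<open>u\<close> any more; a dummy integral of mass 1
    restores the full codebook measure.\<close>
  also have "\<dots> = (\<integral>\<^sup>+c. (\<integral>\<^sup>+u. ennreal (f r (l - 1) m (c(?k := u)) y) * H (c(?k := u)) \<partial>gauss_block L) \<partial>PiM (ixs - {?k}) (\<lambda>_. gauss_block L))"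
    by (simp only: Hu f1 nn_integral_const G.emeasure_space_1 mult_1_right)
  also have "\<dots> = (\<integral>\<^sup>+c. ennreal (f r (l - 1) m c y) * H c \<partial>codebooks)"
    using l by (subst ins[OF meas]) auto
  finally show ?thesis .
qed

text \<open>Layers \<open>l\<close> down to \<open>k + 1\<close> are removed one at a time, from the
  top. Codewords of \<open>m\<close> at the levels up to \<open>k\<close> may occur in
  \<open>H\<close>.\<close>

lemma average_codewords:
  assumes r: "r \<le> s" and m: "m \<in> msgs" and y: "y \<in> space (leb_block L)"
    and H: "H \<in> borel_measurable codebooks"
    and "k \<le> l" "l \<le> s" and Hu: "\<And>c u l'. k < l' \<Longrightarrow> l' \<le> l \<Longrightarrow> H (c(idx l' m := u)) = H c"
  shows "(\<integral>\<^sup>+c. ennreal (f r l m c y) * H c \<partial>codebooks) = (\<integral>\<^sup>+c. ennreal (f r k m c y) * H c \<partial>codebooks)"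
  using assms(5-7)
proof (induction l)
  case (Suc l)
  show ?case
  proof (cases "k = Suc l")
    case False
    have "(\<integral>\<^sup>+c. ennreal (f r (Suc l) m c y) * H c \<partial>codebooks) = (\<integral>\<^sup>+c. ennreal (f r (Suc l - 1) m c y) * H c \<partial>codebooks)"
      using Suc.prems(1,2) False by (intro average_codeword r m y H Suc.prems(3)) auto
    also have "\<dots> = (\<integral>\<^sup>+c. ennreal (f r k m c y) * H c \<partial>codebooks)"
      unfolding diff_Suc_1 using Suc.prems False by (intro Suc.IH) auto
    finally show ?thesis .
  qed simp
qed simp

lemma nn_integral_f: "r \<le> s \<Longrightarrow> (\<integral>\<^sup>+y. ennreal (f r k m c y) \<partial>leb_block L) = 1"
  unfolding f_def by (rule nn_integral_block_density) (rule vr_pos)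

text \<open>The residual \<open>S r k\<close> ignores the layers above \<open>k\<close>. Averaging
  these replaces the full density by \<open>f r k\<close>, under which the residual is a centred
  chi-square with \<open>L\<close> degrees of freedom. The averaging works at fixed
  \<open>y\<close>, hence the two exchanges of integrals.\<close>

lemma expectation_S_square:
  assumes r: "r \<le> s" and m: "m \<in> msgs" and k: "k \<le> s"
  shows "(\<integral>\<^sup>+c. (\<integral>\<^sup>+y. ennreal (f r s m c y) * ennreal ((S r k m c y)\<^sup>2) \<partial>leb_block L) \<partial>codebooks) = ennreal (2 * real L)"
proof -
  interpret C: prob_space codebooks by (rule prob_space_codebooks)
  have meas: "(\<lambda>(c, y). ennreal (f r j m c y) * ennreal ((S r k m c y)\<^sup>2)) \<in> borel_measurable (codebooks \<Otimes>\<^sub>M leb_block L)"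
    if "j \<le> s" for j
    unfolding case_prod_beta'
    by (intro borel_measurable_times_ennreal measurable_compose[OF _ measurable_ennreal] borel_measurable_power
        measurable_f measurable_S measurable_fst measurable_snd m k that)
  have "(\<integral>\<^sup>+c. (\<integral>\<^sup>+y. ennreal (f r s m c y) * ennreal ((S r k m c y)\<^sup>2) \<partial>leb_block L) \<partial>codebooks)
    = (\<integral>\<^sup>+y. (\<integral>\<^sup>+c. ennreal (f r s m c y) * ennreal ((S r k m c y)\<^sup>2) \<partial>codebooks) \<partial>leb_block L)"
    by (rule swap_codebook_output) (rule meas[OF order_refl])
  also have "\<dots> = (\<integral>\<^sup>+y. (\<integral>\<^sup>+c. ennreal (f r k m c y) * ennreal ((S r k m c y)\<^sup>2) \<partial>codebooks) \<partial>leb_block L)"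
  proof (rule nn_integral_cong, rule average_codewords[OF r m])
    fix y assume y: "y \<in> space (leb_block L)"
    show "(\<lambda>c. ennreal ((S r k m c y)\<^sup>2)) \<in> borel_measurable codebooks"
      using y by (intro measurable_compose[OF _ measurable_ennreal] borel_measurable_power measurable_S m k) auto
    fix c u l' assume "k < l'" "l' \<le> s"
    then show "ennreal ((S r k m (c(idx l' m := u)) y)\<^sup>2) = ennreal ((S r k m c y)\<^sup>2)"
      by (subst S_upd) (auto simp: idx_def)
  qed (use k in auto)
  also have "\<dots> = (\<integral>\<^sup>+c. (\<integral>\<^sup>+y. ennreal (f r k m c y) * ennreal ((S r k m c y)\<^sup>2) \<partial>leb_block L) \<partial>codebooks)"
    by (rule swap_codebook_output[symmetric]) (rule meas[OF k])
  also have "\<dots> = ennreal (2 * real L)"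
    using nn_integral_block_density_chi_square[OF vr_pos[OF r]] by (simp add: f_def S_def C.emeasure_space_1)
  finally show ?thesis .
qed

text \<open>The layer \<open>k\<close> codeword of \<open>m'\<close> is off the path of
  \<open>m\<close>. Averaging it turns the numerator into \<open>f r (k - 1) m'\<close>, which
  cancels the denominator because the prefixes agree; the total mass of the law of \<open>m\<close>
  remains.\<close>

lemma expectation_wrong_codeword:
  assumes r: "r \<le> s" and m: "m \<in> msgs" and m': "m' \<in> msgs" and k: "k \<in> {1..s}"
    and eq: "restrict m {1..k - 1} = restrict m' {1..k - 1}" and ne: "m k \<noteq> m' k"
  shows "(\<integral>\<^sup>+c. (\<integral>\<^sup>+y. ennreal (f r s m c y) * ennreal (f r k m' c y / f r (k - 1) m c y) \<partial>leb_block L) \<partial>codebooks) = 1"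
proof -
  interpret C: prob_space codebooks by (rule prob_space_codebooks)
  \<comment> \<open>Levels other than \<open>k\<close> are told apart by the first component of the
    label, level \<open>k\<close> by the entry at \<open>k\<close>.\<close>
  have nidx: "idx l m \<noteq> idx k m'" for l
    using ne k by (auto simp: idx_def fun_eq_iff restrict_def split: if_splits dest!: spec[of _ k])
  let ?H = "\<lambda>y c. ennreal (f r s m c y / f r (k - 1) m c y)"
  have meas: "(\<lambda>(c, y). ennreal (f r s m c y) * ennreal (f r k m' c y / f r (k - 1) m c y)) \<in> borel_measurable (codebooks \<Otimes>\<^sub>M leb_block L)"
    unfolding case_prod_beta' using k
    by (intro borel_measurable_times_ennreal measurable_compose[OF _ measurable_ennreal] borel_measurable_divide
        measurable_f measurable_fst measurable_snd m m') auto
  have meas2: "(\<lambda>(c, y). ennreal (f r s m c y)) \<in> borel_measurable (codebooks \<Otimes>\<^sub>M leb_block L)"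
    unfolding case_prod_beta'
    by (intro measurable_compose[OF _ measurable_ennreal] measurable_f measurable_fst measurable_snd m order_refl)
  have "(\<integral>\<^sup>+c. (\<integral>\<^sup>+y. ennreal (f r s m c y) * ennreal (f r k m' c y / f r (k - 1) m c y) \<partial>leb_block L) \<partial>codebooks)
    = (\<integral>\<^sup>+y. (\<integral>\<^sup>+c. ennreal (f r s m c y) * ennreal (f r k m' c y / f r (k - 1) m c y) \<partial>codebooks) \<partial>leb_block L)"
    by (rule swap_codebook_output) (rule meas)
  also have "\<dots> = (\<integral>\<^sup>+y. (\<integral>\<^sup>+c. ennreal (f r k m' c y) * ?H y c \<partial>codebooks) \<partial>leb_block L)"
    by (simp add: ennreal_mult'[symmetric] mult.commute)
  also have "\<dots> = (\<integral>\<^sup>+y. (\<integral>\<^sup>+c. ennreal (f r (k - 1) m' c y) * ?H y c \<partial>codebooks) \<partial>leb_block L)"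
  proof (rule nn_integral_cong, rule average_codeword[OF r m' k])
    fix y assume y: "y \<in> space (leb_block L)"
    show "?H y \<in> borel_measurable codebooks"
      using y k by (intro measurable_compose[OF _ measurable_ennreal] borel_measurable_divide measurable_f m) auto
    fix c u
    show "?H y (c(idx k m' := u)) = ?H y c"
      by (simp add: f_upd[OF nidx])
  qed
  also have "\<dots> = (\<integral>\<^sup>+y. (\<integral>\<^sup>+c. ennreal (f r s m c y) \<partial>codebooks) \<partial>leb_block L)"
    using f_pos[OF r] f_cong_msg[OF eq, of r]
    by (simp add: ennreal_mult'[symmetric] less_imp_neq[THEN not_sym])
  also have "\<dots> = (\<integral>\<^sup>+c. (\<integral>\<^sup>+y. ennreal (f r s m c y) \<partial>leb_block L) \<partial>codebooks)"
    by (rule swap_codebook_output[symmetric]) (rule meas2)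
  also have "\<dots> = 1" by (simp add: nn_integral_f[OF r] C.emeasure_space_1)
  finally show ?thesis .
qed

end

section \<open>Decoding\<close>

lemma ln_block_density:
  assumes v: "0 < v"
  shows "ln (block_density L v \<mu> y) = - (real L / 2) * ln (2 * pi * v) - (1/2) * (\<Sum>t<L. (y t - \<mu> t)\<^sup>2 / v)"
proof -
  have nz: "normal_density (\<mu> t) (sqrt v) (y t) \<noteq> 0" for t
    using normal_density_pos[of "sqrt v" "\<mu> t" "y t"] v by simp
  have "ln (block_density L v \<mu> y) = (\<Sum>t<L. ln (normal_density (\<mu> t) (sqrt v) (y t)))"
    unfolding block_density_def using v by (intro ln_prod) (use nz in auto)
  also have "\<dots> = (\<Sum>t<L. - (1/2) * ln (2 * pi * v) - (1/2) * ((y t - \<mu> t)\<^sup>2 / v))"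
  proof (intro sum.cong refl)
    fix t
    have "ln (normal_density (\<mu> t) (sqrt v) (y t)) = ln (1 / sqrt (2 * pi * v)) + ln (exp (- (y t - \<mu> t)\<^sup>2 / (2 * v)))"
      using v unfolding normal_density_def by (subst ln_mult_pos) auto
    also have "ln (1 / sqrt (2 * pi * v)) = - (1/2) * ln (2 * pi * v)"
      using v by (simp add: ln_div ln_sqrt)
    finally show "ln (normal_density (\<mu> t) (sqrt v) (y t)) = - (1/2) * ln (2 * pi * v) - (1/2) * ((y t - \<mu> t)\<^sup>2 / v)"
      by simp
  qed
  also have "\<dots> = - (real L / 2) * ln (2 * pi * v) - (1/2) * (\<Sum>t<L. (y t - \<mu> t)\<^sup>2 / v)"
    by (simp add: sum_subtractf sum_distrib_left)
  finally show ?thesis .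
qed

context superposition_code
begin

abbreviation codes_outputs where "codes_outputs \<equiv> codebooks \<Otimes>\<^sub>M leb_block L"

abbreviation outputs where "outputs \<equiv> leb_block L"

text \<open>Counts the randomisation choices in the layers \<open>i + 1, ..., k\<close>; kept as a
  real because it divides densities.\<close>

definition T where "T i k = (\<Prod>l\<in>{i+1..k}. real (M l))"

text \<open>Joint law of the random codebook and the output of receiver \<open>r\<close> when the
  path \<open>m\<close> is sent.\<close>

definition law where
  "law r m = density codes_outputs (\<lambda>z. ennreal (f r s m (fst z) (snd z)))"

lemma T_ge_1: "k \<le> s \<Longrightarrow> 1 \<le> T i k"
  unfolding T_def using M_pos by (intro prod_ge_1) (fastforce simp: Suc_le_eq)+

lemma T_pos: "k \<le> s \<Longrightarrow> 0 < T i k"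
  using T_ge_1[of k i] by simp

lemma T_refl[simp]: "T i i = 1"
  by (simp add: T_def)

lemma T_mult: "i \<le> k \<Longrightarrow> k \<le> l \<Longrightarrow> T i k * T k l = T i l"
proof -
  assume "i \<le> k" "k \<le> l"
  then have "{i+1..l} = {i+1..k} \<union> {k+1..l}" "{i+1..k} \<inter> {k+1..l} = {}" by auto
  then show ?thesis unfolding T_def by (simp add: prod.union_disjoint)
qed

lemma ln_f: "r \<le> s \<Longrightarrow> ln (f r k m c y) = - (real L / 2) * ln (2 * pi * vr r k) - (1/2) * (S r k m c y + real L)"
  unfolding f_def S_def by (simp add: ln_block_density vr_pos sum_subtractf)

text \<open>For \<open>j \<le> k\<close> the leading term is \<open>L\<close> times the information
  that the layers \<open>j + 1, ..., k\<close> carry at receiver \<open>r\<close>; the residuals are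
  its fluctuation. Decoding and leakage both rest on this split.\<close>

lemma ln_f_ratio:
  assumes r: "r \<le> s"
  shows "ln (f r k m c y) - ln (f r j m c y) = real L * (1/2 * ln (vr r j / vr r k)) + (1/2) * S r j m c y - (1/2) * S r k m c y"
proof -
  have 1: "ln (2 * pi * vr r i) = ln (2 * pi) + ln (vr r i)" for i
    using vr_pos[OF r, of i] by (subst ln_mult_pos) auto
  have 2: "ln (vr r j / vr r k) = ln (vr r j) - ln (vr r k)"
    using vr_pos[OF r, of j] vr_pos[OF r, of k] by (simp add: ln_div)
  show ?thesis
    unfolding ln_f[OF r] 1 2 by (simp add: algebra_simps)
qed

lemma measurable_f_law[measurable]:
  "m \<in> msgs \<Longrightarrow> k \<le> s \<Longrightarrow> (\<lambda>z. f r k m (fst z) (snd z)) \<in> borel_measurable codes_outputs"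
  by (intro measurable_f measurable_fst measurable_snd)

lemma measurable_S_law[measurable]:
  "m \<in> msgs \<Longrightarrow> k \<le> s \<Longrightarrow> (\<lambda>z. S r k m (fst z) (snd z)) \<in> borel_measurable codes_outputs"
  by (intro measurable_S measurable_fst measurable_snd)

lemma sets_law[measurable_cong, simp]: "sets (law r m) = sets codes_outputs"
  by (simp add: law_def)

lemma nn_integral_law:
  assumes m: "m \<in> msgs" and F: "F \<in> borel_measurable codes_outputs"
  shows "(\<integral>\<^sup>+z. F z \<partial>law r m) = (\<integral>\<^sup>+c. (\<integral>\<^sup>+y. ennreal (f r s m c y) * F (c, y) \<partial>outputs) \<partial>codebooks)"
proof -
  interpret B: sigma_finite_measure "outputs" by (rule sigma_finite_leb_block)
  note m[measurable] F[measurable]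
  have "(\<integral>\<^sup>+z. F z \<partial>law r m) = (\<integral>\<^sup>+z. ennreal (f r s m (fst z) (snd z)) * F z \<partial>codes_outputs)"
    unfolding law_def by (intro nn_integral_density) measurable
  also have "\<dots> = (\<integral>\<^sup>+c. (\<integral>\<^sup>+y. ennreal (f r s m (fst (c, y)) (snd (c, y))) * F (c, y) \<partial>outputs) \<partial>codebooks)"
    by (rule B.nn_integral_fst[symmetric]) measurable
  finally show ?thesis by simp
qed

lemma nn_integral_law_1:
  assumes r: "r \<le> s" and m: "m \<in> msgs"
  shows "(\<integral>\<^sup>+z. 1 \<partial>law r m) = 1"
proof -
  interpret C: prob_space codebooks by (rule prob_space_codebooks)
  show ?thesis by (subst nn_integral_law[OF m]) (auto simp: nn_integral_f[OF r] C.emeasure_space_1)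
qed

lemma law_S_square:
  assumes "r \<le> s" "m \<in> msgs" "k \<le> s"
  shows "(\<integral>\<^sup>+z. ennreal ((S r k m (fst z) (snd z))\<^sup>2) \<partial>law r m) = ennreal (2 * real L)"
  using expectation_S_square[OF assms] assms by (subst nn_integral_law) auto

text \<open>By the inequality of arithmetic and geometric means the modulus is at most
  \<open>x^2 / (2 * sqrt L) + sqrt L / 2\<close>. A second moment of \<open>2 * L\<close> makes this
  \<open>sqrt L + sqrt L / 2\<close>, the origin of the constant 3/2 in all later bounds.\<close>

lemma law_S_abs:
  assumes r: "r \<le> s" and m[measurable]: "m \<in> msgs" and k[measurable]: "k \<le> s" and L: "0 < L"
  shows "(\<integral>\<^sup>+z. ennreal \<bar>S r k m (fst z) (snd z)\<bar> \<partial>law r m) \<le> ennreal (3/2 * sqrt (real L))"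
proof -
  have AG: "\<bar>x\<bar> \<le> x\<^sup>2 * (1 / (2 * sqrt L)) + sqrt L / 2" for x :: real
  proof -
    have q: "0 < sqrt L" "sqrt L * sqrt L = L" using L by auto
    have "0 \<le> (\<bar>x\<bar> - sqrt L)\<^sup>2" by simp
    then have "2 * sqrt L * \<bar>x\<bar> \<le> x\<^sup>2 + sqrt L * sqrt L"
      by (simp add: power2_diff power2_eq_square algebra_simps)
    then have "(2 * sqrt L) * \<bar>x\<bar> \<le> (2 * sqrt L) * (x\<^sup>2 * (1 / (2 * sqrt L)) + sqrt L / 2)"
      using q by (simp add: distrib_left)
    then show ?thesis by (rule mult_left_le_imp_le) (use q in simp)
  qed
  have "(\<integral>\<^sup>+z. ennreal \<bar>S r k m (fst z) (snd z)\<bar> \<partial>law r m)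
    \<le> (\<integral>\<^sup>+z. ennreal ((S r k m (fst z) (snd z))\<^sup>2) * ennreal (1 / (2 * sqrt L)) + ennreal (sqrt L / 2) \<partial>law r m)"
    using AG by (intro nn_integral_mono) (simp add: ennreal_mult'[symmetric] ennreal_plus[symmetric] del: ennreal_plus)
  also have "\<dots> = ennreal (2 * real L) * ennreal (1 / (2 * sqrt L)) + ennreal (sqrt L / 2)"
    using nn_integral_law_1[OF r m]
    by (subst nn_integral_add, measurable) (subst nn_integral_multc, measurable, auto simp: law_S_square[OF r m k])
  also have "\<dots> = ennreal (3/2 * sqrt (real L))"
  proof -
    have "real L / sqrt L = sqrt L" using L by (simp add: real_div_sqrt)
    then show ?thesis by (simp add: ennreal_mult'[symmetric] ennreal_plus[symmetric] del: ennreal_plus)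
  qed
  finally show ?thesis .
qed

lemma law_wrong_codeword:
  assumes r: "r \<le> s" and m: "m \<in> msgs" and k: "k \<in> {1..s}" and n: "n \<in> {1..A k} \<times> {..<M k}" "n \<noteq> m k"
  shows "(\<integral>\<^sup>+z. ennreal (f r k (m(k := n)) (fst z) (snd z) / f r (k - 1) m (fst z) (snd z)) \<partial>law r m) = 1"
proof -
  have m': "m(k := n) \<in> msgs"
    using m n k by (auto simp: msgs_def PiE_iff extensional_def)
  have "restrict m {1..k - 1} = restrict (m(k := n)) {1..k - 1}"
    using k by (auto simp: restrict_def fun_eq_iff)
  from expectation_wrong_codeword[OF r m m' k this] n have
    *: "(\<integral>\<^sup>+c. (\<integral>\<^sup>+y. ennreal (f r s m c y) * ennreal (f r k (m(k := n)) c y / f r (k - 1) m c y) \<partial>outputs) \<partial>codebooks) = 1"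
    by simp
  have [measurable]: "m \<in> msgs" "m(k := n) \<in> msgs" "k \<le> s" "k - 1 \<le> s" using m m' k by auto
  show ?thesis by (subst nn_integral_law[OF m]) (measurable, simp only: fst_conv snd_conv *)
qed

section \<open>Threshold decoding\<close>

definition pass where
  "pass \<gamma> j k m c y \<longleftrightarrow> exp (\<gamma> k) * f j (k - 1) m c y < f j k m c (y :: nat \<Rightarrow> real)"

definition candidates where
  "candidates \<gamma> j c y = {m \<in> msgs. \<forall>k\<in>{1..j}. pass \<gamma> j k m c y}"

text \<open>If no message passes, \<open>SOME\<close> gives an arbitrary value; the true message has
  then failed a test, which the error bound already counts.\<close>

definition decoder :: "(nat \<Rightarrow> real) \<Rightarrow> _ \<Rightarrow> nat \<Rightarrow> (nat \<Rightarrow> real) \<Rightarrow> nat \<Rightarrow> nat" where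
  "decoder \<gamma> c j y = (\<lambda>i. fst ((SOME m. m \<in> candidates \<gamma> j c y) i))"

text \<open>A function in place of an event, so that its mean can be computed: the squares dominate
  failure of the true codeword in layer \<open>k\<close>, as in Chebyshev's inequality, and the
  weighted ratios dominate success of a competitor, as in Markov's.\<close>

definition err_term where
  "err_term \<gamma> \<delta> j k m c y = ennreal ((S j (k - 1) m c y)\<^sup>2) * ennreal (1 / (real L * \<delta>)\<^sup>2)
     + ennreal ((S j k m c y)\<^sup>2) * ennreal (1 / (real L * \<delta>)\<^sup>2)
     + (\<Sum>n\<in>({1..A k} \<times> {..<M k}) - {m k}. ennreal (exp (- \<gamma> k)) * ennreal (f j k (m(k := n)) c y / f j (k - 1) m c y))"

definition err_bound where
  "err_bound \<gamma> \<delta> j m c y = (\<Sum>k\<in>{1..j}. err_term \<gamma> \<delta> j k m c y)"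

lemma pass_cong_msg:
  assumes "restrict m {1..k} = restrict m' {1..k}"
  shows "pass \<gamma> j k m c y = pass \<gamma> j k m' c y"
  unfolding pass_def f_cong_msg[OF assms] f_cong_msg[OF restrict_mono_eq[OF assms diff_le_self]] ..

text \<open>At the lowest layer \<open>k\<close> where the decoded path leaves the true one, it
  coincides up to \<open>k\<close> with the true path altered in the single entry \<open>k\<close>,
  and the test of layer \<open>k\<close> sees nothing above. Hence the union bound ranges over
  one-layer replacements instead of whole paths.\<close>

lemma decoding_error_cases:
  assumes m: "m \<in> msgs" and j: "j \<le> s" and i: "i \<in> {1..j}" and err: "decoder \<gamma> c j y i \<noteq> fst (m i)"
  shows "\<exists>k\<in>{1..j}. \<not> pass \<gamma> j k m c y \<or> (\<exists>n\<in>({1..A k} \<times> {..<M k}) - {m k}. pass \<gamma> j k (m(k := n)) c y)"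
proof (rule ccontr)
  assume neg: "\<not> ?thesis"
  then have "m \<in> candidates \<gamma> j c y" using m by (auto simp: candidates_def)
  define m' where "m' = (SOME m. m \<in> candidates \<gamma> j c y)"
  have m': "m' \<in> candidates \<gamma> j c y" unfolding m'_def by (rule someI[of "\<lambda>m. m \<in> candidates \<gamma> j c y" m]) fact
  have "m' i \<noteq> m i" using err by (auto simp: decoder_def m'_def)
  define k where "k = (LEAST k. k \<in> {1..j} \<and> m' k \<noteq> m k)"
  have k: "k \<in> {1..j} \<and> m' k \<noteq> m k"
    unfolding k_def by (rule LeastI[of _ i]) (use i \<open>m' i \<noteq> m i\<close> in auto)
  have below: "m' l = m l" if "l \<in> {1..<k}" for l
    using not_less_Least[of l "\<lambda>k. k \<in> {1..j} \<and> m' k \<noteq> m k"] that k unfolding k_def[symmetric] by auto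
  have "restrict m' {1..k} = restrict (m(k := m' k)) {1..k}"
    using below by (auto simp: restrict_def fun_eq_iff)
  moreover have "pass \<gamma> j k m' c y"
    using m' k unfolding candidates_def by blast
  ultimately have "pass \<gamma> j k (m(k := m' k)) c y"
    by (rule pass_cong_msg[THEN iffD1])
  moreover have "m' k \<in> ({1..A k} \<times> {..<M k}) - {m k}"
    using m' k j by (auto simp: candidates_def msgs_def PiE_iff)
  ultimately have "\<exists>n\<in>({1..A k} \<times> {..<M k}) - {m k}. pass \<gamma> j k (m(k := n)) c y"
    by (rule bexI[where x = "m' k"])
  then show False using neg k by blast
qed

text \<open>When the test fails, fluctuations have used up the margin \<open>L * \<delta>\<close> in
  the log-ratio, so the two residuals differ by at least \<open>2 * L * \<delta>\<close>. Then
  \<open>(b - a)^2 \<le> 2 * (a^2 + b^2)\<close> bounds the sum of their squares from below.\<close>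

lemma not_pass_imp:
  assumes j: "j \<le> s" and \<gamma>: "\<gamma> k \<le> real L * (1/2 * ln (vr j (k - 1) / vr j k) - \<delta>)"
    and "0 < \<delta>" "0 < L" and np: "\<not> pass \<gamma> j k m c y"
  shows "1 \<le> (S j (k - 1) m c y)\<^sup>2 * (1 / (real L * \<delta>)\<^sup>2) + (S j k m c y)\<^sup>2 * (1 / (real L * \<delta>)\<^sup>2)"
proof -
  let ?a = "S j (k - 1) m c y" and ?b = "S j k m c y" and ?d = "real L * \<delta>"
  have aux: "x \<le> z" if "4 * x \<le> 2 * z" "0 \<le> x" for x z :: real using that by linarith
  have d: "0 < ?d" using \<open>0 < \<delta>\<close> \<open>0 < L\<close> by simp
  have "f j k m c y \<le> exp (\<gamma> k) * f j (k - 1) m c y" using np by (simp add: pass_def)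
  then have "ln (f j k m c y) \<le> ln (exp (\<gamma> k) * f j (k - 1) m c y)"
    using f_pos[OF j] by (subst ln_le_cancel_iff) auto
  also have "\<dots> = \<gamma> k + ln (f j (k - 1) m c y)"
    using f_pos[OF j] by (subst ln_mult_pos) auto
  finally have "ln (f j k m c y) - ln (f j (k - 1) m c y) \<le> \<gamma> k" by simp
  then have "2 * ?d \<le> ?b - ?a"
    using \<gamma> unfolding ln_f_ratio[OF j] by (simp add: algebra_simps)
  then have "(2 * ?d)\<^sup>2 \<le> (?b - ?a)\<^sup>2" using d by (intro power_mono) auto
  also have "\<dots> \<le> 2 * (?a\<^sup>2 + ?b\<^sup>2)"
    using zero_le_power2[of "?a + ?b"] by (simp add: power2_eq_square algebra_simps)
  finally have "4 * ?d\<^sup>2 \<le> 2 * (?a\<^sup>2 + ?b\<^sup>2)" unfolding power_mult_distrib[of 2] by simp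
  \<comment> \<open>A factor two is given away here.\<close>
  then have "?d\<^sup>2 \<le> ?a\<^sup>2 + ?b\<^sup>2" using zero_le_power2[of ?d] by (rule aux)
  then have "1 \<le> (?a\<^sup>2 + ?b\<^sup>2) / ?d\<^sup>2" using zero_less_power[OF d, of 2] by (simp only: le_divide_eq_1_pos)
  then show ?thesis by (simp add: add_divide_distrib)
qed

lemma indicator_error_le:
  assumes j: "j \<le> s" and \<gamma>: "\<And>k. k \<in> {1..j} \<Longrightarrow> \<gamma> k \<le> real L * (1/2 * ln (vr j (k - 1) / vr j k) - \<delta>)"
    and dL: "0 < \<delta>" "0 < L" and m: "m \<in> msgs" and i: "i \<in> {1..j}"
  shows "indicator {y. decoder \<gamma> c j y i \<noteq> fst (m i)} y \<le> err_bound \<gamma> \<delta> j m c y"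
proof (cases "decoder \<gamma> c j y i \<noteq> fst (m i)")
  case True
  from decoding_error_cases[OF m j i True] obtain k where k: "k \<in> {1..j}"
    and or: "\<not> pass \<gamma> j k m c y \<or> (\<exists>n\<in>({1..A k} \<times> {..<M k}) - {m k}. pass \<gamma> j k (m(k := n)) c y)" by blast
  have "1 \<le> err_term \<gamma> \<delta> j k m c y"
  proof (cases "pass \<gamma> j k m c y")
    case False
    have "ennreal 1 \<le> ennreal ((S j (k - 1) m c y)\<^sup>2) * ennreal (1 / (real L * \<delta>)\<^sup>2)
       + ennreal ((S j k m c y)\<^sup>2) * ennreal (1 / (real L * \<delta>)\<^sup>2)"
      using not_pass_imp[OF j \<gamma>[OF k] dL False]
      by (simp only: ennreal_mult'[symmetric] ennreal_plus[symmetric] ennreal_leI zero_le_power2 mult_nonneg_nonneg zero_le_divide_1_iff)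
    then show ?thesis unfolding err_term_def by (simp add: add_increasing2)
  next
    case True
    with or obtain n where n: "n \<in> ({1..A k} \<times> {..<M k}) - {m k}" "pass \<gamma> j k (m(k := n)) c y" by blast
    \<comment> \<open>The competitor shares the prefix below \<open>k\<close>, so its test has the
      same reference density.\<close>
    have "f j (k - 1) (m(k := n)) c y = f j (k - 1) m c y"
      using k by (intro f_cong_msg) (auto simp: restrict_def fun_eq_iff)
    with n(2) f_pos[OF j, of "k - 1" m c y] have "1 \<le> exp (- \<gamma> k) * (f j k (m(k := n)) c y / f j (k - 1) m c y)"
      by (simp add: pass_def exp_minus field_simps)
    then have "ennreal 1 \<le> ennreal (exp (- \<gamma> k)) * ennreal (f j k (m(k := n)) c y / f j (k - 1) m c y)"
      by (simp only: ennreal_mult'[symmetric] exp_ge_zero ennreal_leI)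
    also have "\<dots> \<le> (\<Sum>n\<in>({1..A k} \<times> {..<M k}) - {m k}. ennreal (exp (- \<gamma> k)) * ennreal (f j k (m(k := n)) c y / f j (k - 1) m c y))"
      using n(1) by (intro member_le_sum) auto
    finally show ?thesis unfolding err_term_def by (simp add: add_increasing)
  qed
  also have "err_term \<gamma> \<delta> j k m c y \<le> (\<Sum>k\<in>{1..j}. err_term \<gamma> \<delta> j k m c y)"
    using k by (intro member_le_sum) auto
  finally show ?thesis using True by (simp only: err_bound_def indicator_simps mem_Collect_eq not_False_eq_True)
qed simp

lemma measurable_err_term:
  assumes m: "m \<in> msgs" and k: "k \<in> {1..s}"
  shows "(\<lambda>z. ennreal ((S j (k - 1) m (fst z) (snd z))\<^sup>2) * ennreal q) \<in> borel_measurable codes_outputs"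
    and "(\<lambda>z. ennreal ((S j k m (fst z) (snd z))\<^sup>2) * ennreal q) \<in> borel_measurable codes_outputs"
    and "n \<in> {1..A k} \<times> {..<M k} \<Longrightarrow> (\<lambda>z. ennreal (f j k (m(k := n)) (fst z) (snd z) / f j (k - 1) m (fst z) (snd z))) \<in> borel_measurable codes_outputs"
    and "(\<lambda>z. err_term \<gamma> \<delta> j k m (fst z) (snd z)) \<in> borel_measurable codes_outputs"
proof -
  have [measurable]: "m \<in> msgs" "k \<le> s" "k - 1 \<le> s" using m k by auto
  have [measurable]: "m(k := n) \<in> msgs" if "n \<in> {1..A k} \<times> {..<M k}" for n
    using m k that by (auto simp: msgs_def PiE_iff extensional_def)
  show 1: "(\<lambda>z. ennreal ((S j (k - 1) m (fst z) (snd z))\<^sup>2) * ennreal q) \<in> borel_measurable codes_outputs" for q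
    by measurable
  show 2: "(\<lambda>z. ennreal ((S j k m (fst z) (snd z))\<^sup>2) * ennreal q) \<in> borel_measurable codes_outputs" for q
    by measurable
  show 3: "(\<lambda>z. ennreal (f j k (m(k := n)) (fst z) (snd z) / f j (k - 1) m (fst z) (snd z))) \<in> borel_measurable codes_outputs"
    if "n \<in> {1..A k} \<times> {..<M k}" for n
    using that by measurable
  show "(\<lambda>z. err_term \<gamma> \<delta> j k m (fst z) (snd z)) \<in> borel_measurable codes_outputs"
    unfolding err_term_def
    by (intro borel_measurable_add 1 2 borel_measurable_sum borel_measurable_times_ennreal borel_measurable_const 3) auto
qed

text \<open>Each squared residual has mean \<open>2 * L\<close>, so the two Chebyshev terms add up
  to \<open>4 * L / (L * \<delta>)^2\<close>; each of the \<open>A k * M k - 1\<close> competitors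
  has a likelihood ratio of mean 1.\<close>

lemma law_err_term:
  assumes m: "m \<in> msgs" and j: "j \<le> s" and k: "k \<in> {1..s}" and dL: "0 < \<delta>" "0 < L"
  shows "(\<integral>\<^sup>+z. err_term \<gamma> \<delta> j k m (fst z) (snd z) \<partial>law j m) = ennreal (4 / (real L * \<delta>\<^sup>2) + real (A k * M k - 1) * exp (- \<gamma> k))"
proof -
  let ?q = "ennreal (1 / (real L * \<delta>)\<^sup>2)"
  let ?N = "({1..A k} \<times> {..<M k}) - {m k}"
  let ?Y = "\<lambda>i z. ennreal ((S j i m (fst z) (snd z))\<^sup>2)"
  let ?X = "\<lambda>n z. ennreal (f j k (m(k := n)) (fst z) (snd z) / f j (k - 1) m (fst z) (snd z))"
  have [measurable]: "m \<in> msgs" "k \<le> s" "k - 1 \<le> s" using m k by auto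
  have X: "?X n \<in> borel_measurable (law j m)" if "n \<in> ?N" for n
    using measurable_err_term(3)[OF m k] that by (simp add: measurable_cong_sets[OF sets_law refl])
  have sX: "(\<lambda>z. \<Sum>n\<in>?N. ennreal (exp (- \<gamma> k)) * ?X n z) \<in> borel_measurable (law j m)"
    by (intro borel_measurable_sum borel_measurable_times_ennreal borel_measurable_const X)
  have Y: "?Y i \<in> borel_measurable (law j m)" if [measurable]: "i \<le> s" for i by measurable
  have Yq: "(\<lambda>z. ?Y i z * ?q) \<in> borel_measurable (law j m)" if "i \<le> s" for i
    by (intro borel_measurable_times_ennreal borel_measurable_const Y that)
  have ks: "k - 1 \<le> s" "k \<le> s" by fact+
  have EY: "(\<integral>\<^sup>+z. ?Y i z * ?q \<partial>law j m) = ennreal (2 * real L) * ?q" if "i \<le> s" for i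
    by (simp only: nn_integral_multc[OF Y[OF that]] law_S_square[OF j m that])
  have EX: "(\<integral>\<^sup>+z. (\<Sum>n\<in>?N. ennreal (exp (- \<gamma> k)) * ?X n z) \<partial>law j m) = (\<Sum>n\<in>?N. ennreal (exp (- \<gamma> k)))"
  proof -
    have "(\<integral>\<^sup>+z. (\<Sum>n\<in>?N. ennreal (exp (- \<gamma> k)) * ?X n z) \<partial>law j m) = (\<Sum>n\<in>?N. \<integral>\<^sup>+z. ennreal (exp (- \<gamma> k)) * ?X n z \<partial>law j m)"
      by (intro nn_integral_sum borel_measurable_times_ennreal borel_measurable_const X)
    also have "\<dots> = (\<Sum>n\<in>?N. ennreal (exp (- \<gamma> k)))"
      using law_wrong_codeword[OF j m k] by (intro sum.cong refl) (simp only: nn_integral_cmult[OF X] Diff_iff singleton_iff mult_1_right not_False_eq_True)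
    finally show ?thesis .
  qed
  have "card ?N = A k * M k - 1"
    using m k by (subst card_Diff_singleton) (auto simp: card_cartesian_product msgs_def PiE_iff)
  then have EX': "(\<integral>\<^sup>+z. (\<Sum>n\<in>?N. ennreal (exp (- \<gamma> k)) * ?X n z) \<partial>law j m) = ennreal (real (A k * M k - 1) * exp (- \<gamma> k))"
    unfolding EX by (simp only: sum_constant) (simp add: ennreal_mult' ennreal_of_nat_eq_real_of_nat)
  have "(\<integral>\<^sup>+z. err_term \<gamma> \<delta> j k m (fst z) (snd z) \<partial>law j m)
    = (\<integral>\<^sup>+z. ?Y (k - 1) z * ?q + ?Y k z * ?q \<partial>law j m) + (\<integral>\<^sup>+z. (\<Sum>n\<in>?N. ennreal (exp (- \<gamma> k)) * ?X n z) \<partial>law j m)"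
    unfolding err_term_def by (rule nn_integral_add[OF borel_measurable_add[OF Yq[OF ks(1)] Yq[OF ks(2)]] sX])
  also have "(\<integral>\<^sup>+z. ?Y (k - 1) z * ?q + ?Y k z * ?q \<partial>law j m) = ennreal (2 * real L) * ?q + ennreal (2 * real L) * ?q"
    unfolding nn_integral_add[OF Yq[OF ks(1)] Yq[OF ks(2)]] EY[OF ks(1)] EY[OF ks(2)] ..
  also have "\<dots> = ennreal (4 / (real L * \<delta>\<^sup>2))"
  proof -
    have "2 * real L * (1 / (real L * \<delta>)\<^sup>2) + 2 * real L * (1 / (real L * \<delta>)\<^sup>2) = 4 / (real L * \<delta>\<^sup>2)"
      using dL by (simp add: field_simps power2_eq_square)
    then show ?thesis
      by (simp only: ennreal_mult'[symmetric] ennreal_plus[symmetric] mult_nonneg_nonneg zero_le_divide_1_iff zero_le_power2 of_nat_0_le_iff zero_le_numeral)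
  qed
  also note EX'
  finally show ?thesis by (simp add: ennreal_plus)
qed

lemma measurable_err_bound:
  assumes m: "m \<in> msgs" and j: "j \<le> s"
  shows "(\<lambda>z. err_bound \<gamma> \<delta> j m (fst z) (snd z)) \<in> borel_measurable codes_outputs"
  unfolding err_bound_def using j by (intro borel_measurable_sum measurable_err_term(4) m) auto

lemma law_err_bound:
  assumes m: "m \<in> msgs" and j: "j \<le> s" and dL: "0 < \<delta>" "0 < L"
  shows "(\<integral>\<^sup>+z. err_bound \<gamma> \<delta> j m (fst z) (snd z) \<partial>law j m)
    = ennreal (\<Sum>k\<in>{1..j}. 4 / (real L * \<delta>\<^sup>2) + real (A k * M k - 1) * exp (- \<gamma> k))"
proof -
  have "(\<integral>\<^sup>+z. err_bound \<gamma> \<delta> j m (fst z) (snd z) \<partial>law j m) = (\<Sum>k\<in>{1..j}. \<integral>\<^sup>+z. err_term \<gamma> \<delta> j k m (fst z) (snd z) \<partial>law j m)"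
    unfolding err_bound_def using j measurable_err_term(4)[OF m]
    by (intro nn_integral_sum) (auto simp: measurable_cong_sets[OF sets_law refl])
  also have "\<dots> = (\<Sum>k\<in>{1..j}. ennreal (4 / (real L * \<delta>\<^sup>2) + real (A k * M k - 1) * exp (- \<gamma> k)))"
    using j by (intro sum.cong refl law_err_term m dL) auto
  also have "\<dots> = ennreal (\<Sum>k\<in>{1..j}. 4 / (real L * \<delta>\<^sup>2) + real (A k * M k - 1) * exp (- \<gamma> k))"
    by (intro sum_ennreal) auto
  finally show ?thesis .
qed

end

section \<open>Leakage\<close>

context superposition_code
begin

text \<open>With the cloud of the first \<open>i\<close> layers and the secrets above it held fixed,
  what varies is the local randomisation of the layers above \<open>i\<close>.\<close>

definition fibre where
  "fibre i m = {m' \<in> msgs. restrict m' {1..i} = restrict m {1..i} \<and> (\<forall>l\<in>{i+1..s}. fst (m' l) = fst (m l))}"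

definition leak_ratio where
  "leak_ratio i m c y = (\<Sum>m'\<in>fibre i m. f i s m' c y / (T i s * f i i m c y))"

text \<open>Summand \<open>k\<close> accounts for codewords that branch off after layer
  \<open>k\<close>: at most a fraction \<open>1 / T i k\<close> of the fibre shares the first
  \<open>k\<close> layers, and these average to \<open>f i k\<close>. Summand \<open>i\<close>
  equals 1 and keeps the reference away from zero.\<close>

definition leak_ref where
  "leak_ref i m c y = (\<Sum>k\<in>{i..s}. f i k m c y / (T i k * f i i m c y))"

text \<open>Majorant of \<open>ln (1 + leak_ratio i m c y)\<close>, written as a sum of nonnegative
  terms so that its mean can be taken termwise.\<close>

definition leak_bound where
  "leak_bound i \<tau> m c y = ennreal (leak_ratio i m c y / leak_ref i m c y) + ennreal (ln (real s + 2) + (real s + 1) * \<tau>)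
     + (\<Sum>k\<in>{i..s}. ennreal \<bar>S i i m c y\<bar> * ennreal (1/2) + ennreal \<bar>S i k m c y\<bar> * ennreal (1/2))"

lemma finite_fibre[simp]: "finite (fibre i m)"
  unfolding fibre_def by simp

lemma fibre_msgs: "m' \<in> fibre i m \<Longrightarrow> m' \<in> msgs"
  by (simp add: fibre_def)

text \<open>As a product set, the fibre leaves one choice in each layer up to \<open>i\<close> and
  \<open>M l\<close> choices in each layer \<open>l\<close> above.\<close>

lemma card_fibre:
  assumes m: "m \<in> msgs"
  shows "real (card (fibre i m)) = T i s"
proof -
  have eq: "fibre i m = (\<Pi>\<^sub>E l\<in>{1..s}. if l \<le> i then {m l} else {fst (m l)} \<times> {..<M l})"
  proof (intro set_eqI iffI)
    fix m' assume m': "m' \<in> fibre i m"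
    show "m' \<in> (\<Pi>\<^sub>E l\<in>{1..s}. if l \<le> i then {m l} else {fst (m l)} \<times> {..<M l})"
    proof (rule PiE_I)
      fix l assume l: "l \<in> {1..s}"
      have "m' l \<in> {1..A l} \<times> {..<M l}" using m' l by (auto simp: fibre_def msgs_def PiE_iff)
      moreover have "m' l = m l" if "l \<le> i"
        using m' that l unfolding fibre_def by (auto simp: restrict_def fun_eq_iff) metis
      moreover have "fst (m' l) = fst (m l)" if "\<not> l \<le> i"
        using m' that l by (auto simp: fibre_def)
      ultimately show "m' l \<in> (if l \<le> i then {m l} else {fst (m l)} \<times> {..<M l})"
        by (auto simp: mem_Times_iff)
    next
      fix l assume "l \<notin> {1..s}"
      then show "m' l = undefined" using m' by (auto simp: fibre_def msgs_def PiE_iff extensional_def)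
    qed
  next
    fix m' assume m': "m' \<in> (\<Pi>\<^sub>E l\<in>{1..s}. if l \<le> i then {m l} else {fst (m l)} \<times> {..<M l})"
    have c: "m' l = m l" if "l \<in> {1..s}" "l \<le> i" for l
      using PiE_mem[OF m' that(1)] that(2) by simp
    have d: "m' l \<in> {fst (m l)} \<times> {..<M l}" if "l \<in> {1..s}" "\<not> l \<le> i" for l
      using PiE_mem[OF m' that(1)] that(2) by simp
    have e: "m' l = m l" if "l \<notin> {1..s}" for l
      using PiE_arb[OF m' that] m that by (auto simp: msgs_def PiE_iff extensional_def)
    have "m' \<in> msgs"
      unfolding msgs_def
    proof (rule PiE_I)
      fix l assume l: "l \<in> {1..s}"
      have "m l \<in> {1..A l} \<times> {..<M l}" by (rule PiE_mem[OF m[unfolded msgs_def] l])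
      then show "m' l \<in> {1..A l} \<times> {..<M l}" using c[OF l] d[OF l] by (cases "l \<le> i") auto
    qed (use PiE_arb[OF m'] in auto)
    moreover have "restrict m' {1..i} = restrict m {1..i}"
      using c e by (auto simp: restrict_def fun_eq_iff)
    ultimately show "m' \<in> fibre i m"
      using d by (force simp: fibre_def)
  qed
  have "card (fibre i m) = (\<Prod>l\<in>{1..s}. if l \<le> i then 1 else M l)"
    unfolding eq by (subst card_PiE) (auto intro!: prod.cong simp: card_cartesian_product)
  also have "\<dots> = (\<Prod>l\<in>{i+1..s}. M l)"
    by (intro prod.mono_neutral_cong_right) auto
  finally show ?thesis by (simp add: T_def)
qed

text \<open>Past layer \<open>k\<close> the codewords of \<open>m'\<close> are off the path of
  \<open>m\<close>, hence independent of those that shape the output and \<open>H\<close>; averaging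
  them strips \<open>f r s m'\<close> down to the common prefix. \<open>Hu\<close> says that
  \<open>H\<close> ignores codewords off the path of \<open>m\<close>.\<close>

lemma law_agree:
  assumes r: "r \<le> s" and m: "m \<in> msgs" and m': "m' \<in> msgs" and k: "k \<le> s"
    and eq: "restrict m {1..k} = restrict m' {1..k}" and ne: "k < s \<Longrightarrow> m (k+1) \<noteq> m' (k+1)"
    and H: "(\<lambda>z. H (fst z) (snd z)) \<in> borel_measurable codes_outputs"
    and Hu: "\<And>c \<kappa> u y. (\<And>l. l \<in> {1..s} \<Longrightarrow> idx l m \<noteq> \<kappa>) \<Longrightarrow> H (c(\<kappa> := u)) y = H c y"
  shows "(\<integral>\<^sup>+z. ennreal (f r s m' (fst z) (snd z)) * H (fst z) (snd z) \<partial>law r m)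
    = (\<integral>\<^sup>+z. ennreal (f r k m (fst z) (snd z)) * H (fst z) (snd z) \<partial>law r m)"
proof -
  \<comment> \<open>A disagreement in layer \<open>k + 1\<close> persists in every longer
    prefix.\<close>
  have nidx: "idx l m \<noteq> idx l' m'" if "k < l'" "l' \<le> s" for l l'
  proof
    assume "idx l m = idx l' m'"
    then have "restrict m {1..l'} = restrict m' {1..l'}" by (auto simp: idx_def)
    from fun_cong[OF this, of "k+1"] show False using that ne by simp
  qed
  have Hm: "(\<lambda>c. H c y) \<in> borel_measurable codebooks" if "y \<in> space (outputs)" for y
  proof -
    have "(\<lambda>c. (c, y)) \<in> codebooks \<rightarrow>\<^sub>M codebooks \<Otimes>\<^sub>M outputs" using that by (intro measurable_Pair) auto
    from measurable_compose[OF this H] show ?thesis by simp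
  qed
  have mF: "(\<lambda>(c, y). ennreal (f r s m c y) * (ennreal (f r j n c y) * H c y)) \<in> borel_measurable codes_outputs"
    if "j \<le> s" "n \<in> msgs" for j n
    unfolding case_prod_beta' using that m
    by (intro borel_measurable_times_ennreal measurable_compose[OF measurable_f_law measurable_ennreal] H) auto
  have mG: "(\<lambda>z. ennreal (f r j n (fst z) (snd z)) * H (fst z) (snd z)) \<in> borel_measurable codes_outputs"
    if "j \<le> s" "n \<in> msgs" for j n
    using that by (intro borel_measurable_times_ennreal measurable_compose[OF measurable_f_law measurable_ennreal] H)
  have "(\<integral>\<^sup>+z. ennreal (f r s m' (fst z) (snd z)) * H (fst z) (snd z) \<partial>law r m)
    = (\<integral>\<^sup>+c. (\<integral>\<^sup>+y. ennreal (f r s m c y) * (ennreal (f r s m' c y) * H c y) \<partial>outputs) \<partial>codebooks)"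
    by (simp add: nn_integral_law[OF m mG[OF order_refl m']])
  also have "\<dots> = (\<integral>\<^sup>+y. (\<integral>\<^sup>+c. ennreal (f r s m c y) * (ennreal (f r s m' c y) * H c y) \<partial>codebooks) \<partial>outputs)"
    by (rule swap_codebook_output) (rule mF[OF order_refl m'])
  \<comment> \<open>The roles are exchanged: the density of \<open>m'\<close> is to be averaged, and
    the transmitted one joins \<open>H\<close>.\<close>
  also have "\<dots> = (\<integral>\<^sup>+y. (\<integral>\<^sup>+c. ennreal (f r s m' c y) * (ennreal (f r s m c y) * H c y) \<partial>codebooks) \<partial>outputs)"
    by (simp add: mult.left_commute)
  also have "\<dots> = (\<integral>\<^sup>+y. (\<integral>\<^sup>+c. ennreal (f r k m' c y) * (ennreal (f r s m c y) * H c y) \<partial>codebooks) \<partial>outputs)"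
  proof (rule nn_integral_cong, rule average_codewords[OF r m'])
    fix y assume y: "y \<in> space (outputs)"
    show "(\<lambda>c. ennreal (f r s m c y) * H c y) \<in> borel_measurable codebooks"
      using y by (intro borel_measurable_times_ennreal measurable_compose[OF _ measurable_ennreal] measurable_f Hm m) auto
    fix c u l' assume "k < l'" "l' \<le> s"
    then show "ennreal (f r s m (c(idx l' m' := u)) y) * H (c(idx l' m' := u)) y = ennreal (f r s m c y) * H c y"
      by (subst f_upd, use nidx in blast, subst Hu) (use nidx in auto)
  qed (use k in auto)
  also have "\<dots> = (\<integral>\<^sup>+y. (\<integral>\<^sup>+c. ennreal (f r s m c y) * (ennreal (f r k m c y) * H c y) \<partial>codebooks) \<partial>outputs)"
    unfolding f_cong_msg[OF eq] by (simp add: mult.left_commute)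
  also have "\<dots> = (\<integral>\<^sup>+c. (\<integral>\<^sup>+y. ennreal (f r s m c y) * (ennreal (f r k m c y) * H c y) \<partial>outputs) \<partial>codebooks)"
    by (rule swap_codebook_output[symmetric]) (rule mF[OF k m])
  also have "\<dots> = (\<integral>\<^sup>+z. ennreal (f r k m (fst z) (snd z)) * H (fst z) (snd z) \<partial>law r m)"
    by (simp add: nn_integral_law[OF m mG[OF k m]])
  finally show ?thesis .
qed

lemma leak_ref_ge_1:
  assumes i: "i \<le> s"
  shows "1 \<le> leak_ref i m c y"
proof -
  have 1: "f i i m c y / (T i i * f i i m c y) = 1" using f_pos[OF i, of i m c y] by simp
  have "f i i m c y / (T i i * f i i m c y) \<le> leak_ref i m c y"
    unfolding leak_ref_def using i T_pos by (intro member_le_sum) (auto intro!: divide_nonneg_nonneg mult_nonneg_nonneg less_imp_le[OF T_pos])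
  then show ?thesis unfolding 1 .
qed

lemma leak_ratio_nonneg: "0 \<le> leak_ratio i m c y"
  unfolding leak_ratio_def by (intro sum_nonneg divide_nonneg_nonneg mult_nonneg_nonneg less_imp_le[OF T_pos]) auto

lemma measurable_leak_ratio[measurable]:
  assumes [measurable]: "m \<in> msgs" "i \<le> s"
  shows "(\<lambda>z. leak_ratio i m (fst z) (snd z)) \<in> borel_measurable codes_outputs"
  unfolding leak_ratio_def
proof (rule borel_measurable_sum)
  fix m' assume "m' \<in> fibre i m"
  then have [measurable]: "m' \<in> msgs" "s \<le> s" by (auto dest: fibre_msgs)
  show "(\<lambda>z. f i s m' (fst z) (snd z) / (T i s * f i i m (fst z) (snd z))) \<in> borel_measurable codes_outputs"
    by measurable
qed

lemma measurable_leak_ref[measurable]: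
  assumes [measurable]: "m \<in> msgs" "i \<le> s"
  shows "(\<lambda>z. leak_ref i m (fst z) (snd z)) \<in> borel_measurable codes_outputs"
  unfolding leak_ref_def
proof (rule borel_measurable_sum)
  fix k assume "k \<in> {i..s}"
  then have [measurable]: "k \<le> s" by auto
  show "(\<lambda>z. f i k m (fst z) (snd z) / (T i k * f i i m (fst z) (snd z))) \<in> borel_measurable codes_outputs"
    by measurable
qed

text \<open>Codewords sharing exactly the first \<open>k\<close> layers with the transmitted one contribute in
  expectation the \<open>k\<close>-th term of the reference sum.\<close>

lemma law_leak_ratio:
  assumes i: "i \<le> s" and m: "m \<in> msgs"
  shows "(\<integral>\<^sup>+z. ennreal (leak_ratio i m (fst z) (snd z) / leak_ref i m (fst z) (snd z)) \<partial>law i m) \<le> 1"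
proof -
  note [measurable] = i m
  have [measurable]: "s \<le> s" by simp
  have w: "0 \<le> 1 / (T i s * f i i m c y * leak_ref i m c y)" for c y
    using leak_ref_ge_1[OF i, of m c y] T_pos[OF order_refl, of i]
    by (intro divide_nonneg_nonneg mult_nonneg_nonneg zero_le_one f_nonneg) linarith+
  \<comment> \<open>The common weight of all summands; it depends on codewords of the path of
    \<open>m\<close> alone, as \<open>law_agree\<close> requires.\<close>
  define H where "H c y = ennreal (1 / (T i s * f i i m c y * leak_ref i m c y))" for c y
  have Hm: "(\<lambda>z. H (fst z) (snd z)) \<in> borel_measurable codes_outputs"
    unfolding H_def by measurable
  have fHm: "(\<lambda>z. ennreal (f i k n (fst z) (snd z)) * H (fst z) (snd z)) \<in> borel_measurable (law i m)"
    if "k \<le> s" "n \<in> msgs" for k n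
    using that by (subst measurable_cong_sets[OF sets_law refl])
      (intro borel_measurable_times_ennreal measurable_compose[OF measurable_f_law measurable_ennreal] Hm)
  have Hu: "H (c(\<kappa> := u)) y = H c y" if "\<And>l. l \<in> {1..s} \<Longrightarrow> idx l m \<noteq> \<kappa>" for c \<kappa> u y
  proof -
    have "f i k m (c(\<kappa> := u)) y = f i k m c y" if "k \<le> s" for k
      using that \<open>\<And>l. l \<in> {1..s} \<Longrightarrow> idx l m \<noteq> \<kappa>\<close> by (intro f_upd) auto
    then show ?thesis using i by (simp add: H_def leak_ref_def)
  qed
  \<comment> \<open>The last layer up to which \<open>m'\<close> follows the transmitted path. For
    \<open>m'\<close> in the fibre the set contains \<open>i\<close>, so the maximum exists.\<close>
  define lev where "lev m' = Max {k \<in> {i..s}. restrict m {1..k} = restrict m' {1..k}}" for m'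
  have lev: "lev m' \<in> {i..s}" "restrict m {1..lev m'} = restrict m' {1..lev m'}"
      "lev m' < s \<Longrightarrow> m (lev m' + 1) \<noteq> m' (lev m' + 1)" if "m' \<in> fibre i m" for m'
  proof -
    let ?K = "{k \<in> {i..s}. restrict m {1..k} = restrict m' {1..k}}"
    have "i \<in> ?K" using that i by (auto simp: fibre_def)
    then have "Max ?K \<in> ?K" by (intro Max_in) auto
    then have 1: "lev m' \<in> ?K" unfolding lev_def .
    then show "lev m' \<in> {i..s}" "restrict m {1..lev m'} = restrict m' {1..lev m'}" by auto
    show "m (lev m' + 1) \<noteq> m' (lev m' + 1)" if "lev m' < s"
    proof
      assume e: "m (lev m' + 1) = m' (lev m' + 1)"
      have req: "restrict m {1..lev m'} = restrict m' {1..lev m'}" using 1 by blast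
      have below: "m l = m' l" if "l \<in> {1..lev m'}" for l
        using fun_cong[OF req, of l] that by (simp only: restrict_apply')
      have "restrict m {1..lev m' + 1} = restrict m' {1..lev m' + 1}"
      proof
        fix l
        show "restrict m {1..lev m' + 1} l = restrict m' {1..lev m' + 1} l"
          using e below[of l] by (cases "l = lev m' + 1"; cases "l \<in> {1..lev m'}") auto
      qed
      then have "lev m' + 1 \<in> ?K" using 1 that by auto
      then have "lev m' + 1 \<le> lev m'" unfolding lev_def by (intro Max_ge) auto
      then show False by simp
    qed
  qed
  let ?Y = "\<lambda>k. \<integral>\<^sup>+z. ennreal (f i k m (fst z) (snd z)) * H (fst z) (snd z) \<partial>law i m"
  have "(\<integral>\<^sup>+z. ennreal (leak_ratio i m (fst z) (snd z) / leak_ref i m (fst z) (snd z)) \<partial>law i m)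
    = (\<integral>\<^sup>+z. (\<Sum>m'\<in>fibre i m. ennreal (f i s m' (fst z) (snd z)) * H (fst z) (snd z)) \<partial>law i m)"
  proof (rule nn_integral_cong)
    fix z :: "(nat \<times> (nat \<Rightarrow> nat \<times> nat) \<Rightarrow> nat \<Rightarrow> real) \<times> (nat \<Rightarrow> real)"
    let ?c = "fst z" and ?y = "snd z"
    let ?w = "1 / (T i s * f i i m ?c ?y * leak_ref i m ?c ?y)"
    have "leak_ratio i m ?c ?y / leak_ref i m ?c ?y = (\<Sum>m'\<in>fibre i m. f i s m' ?c ?y * ?w)"
      unfolding leak_ratio_def sum_divide_distrib by (intro sum.cong refl) simp
    then have "ennreal (leak_ratio i m ?c ?y / leak_ref i m ?c ?y) = ennreal (\<Sum>m'\<in>fibre i m. f i s m' ?c ?y * ?w)"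
      by (rule arg_cong)
    also have "\<dots> = (\<Sum>m'\<in>fibre i m. ennreal (f i s m' ?c ?y * ?w))"
      by (intro sum_ennreal[symmetric] mult_nonneg_nonneg f_nonneg w)
    also have "\<dots> = (\<Sum>m'\<in>fibre i m. ennreal (f i s m' ?c ?y) * H ?c ?y)"
      unfolding H_def by (rule sum.cong[OF refl]) (rule ennreal_mult'[OF f_nonneg])
    finally show "ennreal (leak_ratio i m ?c ?y / leak_ref i m ?c ?y) = (\<Sum>m'\<in>fibre i m. ennreal (f i s m' ?c ?y) * H ?c ?y)" .
  qed
  also have "\<dots> = (\<Sum>m'\<in>fibre i m. \<integral>\<^sup>+z. ennreal (f i s m' (fst z) (snd z)) * H (fst z) (snd z) \<partial>law i m)"
  proof (rule nn_integral_sum)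
    fix m' assume "m' \<in> fibre i m"
    then show "(\<lambda>z. ennreal (f i s m' (fst z) (snd z)) * H (fst z) (snd z)) \<in> borel_measurable (law i m)"
      by (intro fHm fibre_msgs order_refl)
  qed
  also have "\<dots> = (\<Sum>m'\<in>fibre i m. ?Y (lev m'))"
    using lev by (intro sum.cong refl law_agree i m Hm Hu) (auto dest: fibre_msgs)
  also have "\<dots> = (\<Sum>k\<in>{i..s}. \<Sum>m'\<in>{m'\<in>fibre i m. lev m' = k}. ?Y (lev m'))"
    using lev by (intro sum.group[symmetric]) auto
  \<comment> \<open>The one loss in the estimate: the messages that branch off at \<open>k\<close>
    are counted as if they filled \<open>fibre k m\<close>.\<close>
  also have "\<dots> \<le> (\<Sum>k\<in>{i..s}. ennreal (T k s) * ?Y k)"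
  proof (rule sum_mono)
    fix k assume k: "k \<in> {i..s}"
    have sub: "{m'\<in>fibre i m. lev m' = k} \<subseteq> fibre k m"
      using lev k by (auto simp: fibre_def)
    have "(\<Sum>m'\<in>{m'\<in>fibre i m. lev m' = k}. ?Y (lev m')) = of_nat (card {m'\<in>fibre i m. lev m' = k}) * ?Y k"
      by simp
    also have "\<dots> \<le> of_nat (card (fibre k m)) * ?Y k"
      using sub by (intro mult_right_mono) (auto intro: card_mono)
    also have "\<dots> = ennreal (T k s) * ?Y k"
      using card_fibre[OF m, of k] by (simp add: ennreal_of_nat_eq_real_of_nat)
    finally show "(\<Sum>m'\<in>{m'\<in>fibre i m. lev m' = k}. ?Y (lev m')) \<le> ennreal (T k s) * ?Y k" .
  qed
  also have "\<dots> = (\<Sum>k\<in>{i..s}. \<integral>\<^sup>+z. ennreal (T k s) * (ennreal (f i k m (fst z) (snd z)) * H (fst z) (snd z)) \<partial>law i m)"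
  proof (rule sum.cong[OF refl])
    fix k assume "k \<in> {i..s}"
    then have k: "k \<le> s" by simp
    show "ennreal (T k s) * ?Y k = (\<integral>\<^sup>+z. ennreal (T k s) * (ennreal (f i k m (fst z) (snd z)) * H (fst z) (snd z)) \<partial>law i m)"
      by (rule nn_integral_cmult[symmetric]) (rule fHm[OF k m])
  qed
  also have "\<dots> = (\<integral>\<^sup>+z. (\<Sum>k\<in>{i..s}. ennreal (T k s) * (ennreal (f i k m (fst z) (snd z)) * H (fst z) (snd z))) \<partial>law i m)"
  proof (rule nn_integral_sum[symmetric])
    fix k assume "k \<in> {i..s}"
    then have k: "k \<le> s" by simp
    show "(\<lambda>z. ennreal (T k s) * (ennreal (f i k m (fst z) (snd z)) * H (fst z) (snd z))) \<in> borel_measurable (law i m)"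
      by (intro borel_measurable_times_ennreal borel_measurable_const fHm k m)
  qed
  also have "\<dots> = (\<integral>\<^sup>+z. 1 \<partial>law i m)"
  proof (rule nn_integral_cong)
    fix z :: "(nat \<times> (nat \<Rightarrow> nat \<times> nat) \<Rightarrow> nat \<Rightarrow> real) \<times> (nat \<Rightarrow> real)"
    let ?c = "fst z" and ?y = "snd z"
    have ref: "0 < leak_ref i m ?c ?y" using leak_ref_ge_1[OF i, of m ?c ?y] by simp
    have Tn: "0 \<le> T k s" for k using T_pos[OF order_refl, of k] by simp
    let ?w = "1 / (T i s * f i i m ?c ?y * leak_ref i m ?c ?y)"
    \<comment> \<open>As \<open>T k s / T i s = 1 / T i k\<close>, the sum is
      \<open>leak_ref\<close> divided by itself.\<close>
    have one: "(\<Sum>k\<in>{i..s}. T k s * (f i k m ?c ?y * ?w)) = 1"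
    proof -
      have "(\<Sum>k\<in>{i..s}. T k s * (f i k m ?c ?y * ?w)) = (\<Sum>k\<in>{i..s}. f i k m ?c ?y / (T i k * f i i m ?c ?y) / leak_ref i m ?c ?y)"
      proof (rule sum.cong[OF refl])
        fix k assume k: "k \<in> {i..s}"
        then have "T i s = T i k * T k s" by (intro T_mult[symmetric]) auto
        then show "T k s * (f i k m ?c ?y * ?w) = f i k m ?c ?y / (T i k * f i i m ?c ?y) / leak_ref i m ?c ?y"
          using T_pos[OF order_refl, of k] by simp
      qed
      also have "\<dots> = leak_ref i m ?c ?y / leak_ref i m ?c ?y"
        unfolding leak_ref_def sum_divide_distrib ..
      finally show ?thesis using ref by simp
    qed
    have "(\<Sum>k\<in>{i..s}. ennreal (T k s) * (ennreal (f i k m ?c ?y) * H ?c ?y))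
      = (\<Sum>k\<in>{i..s}. ennreal (T k s * (f i k m ?c ?y * ?w)))"
      unfolding H_def by (rule sum.cong[OF refl]) (subst ennreal_mult'[OF Tn], subst ennreal_mult'[OF f_nonneg], rule refl)
    also have "\<dots> = ennreal (\<Sum>k\<in>{i..s}. T k s * (f i k m ?c ?y * ?w))"
      by (intro sum_ennreal mult_nonneg_nonneg w Tn f_nonneg)
    finally show "(\<Sum>k\<in>{i..s}. ennreal (T k s) * (ennreal (f i k m ?c ?y) * H ?c ?y)) = 1" by (simp only: one ennreal_1)
  qed
  also have "\<dots> = 1" by (rule nn_integral_law_1[OF i m])
  finally show ?thesis .
qed

text \<open>The reference is a sum of at most \<open>s + 1\<close> exponentials of log-ratios, so
  its logarithm is governed by the largest of them. By \<open>rate\<close> the leading term of a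
  log-ratio exceeds \<open>ln (T i k)\<close> by at most \<open>\<tau>\<close>; the rest consists of
  residuals.\<close>

lemma ln_leak_ratio_le:
  assumes i: "i \<le> s" and \<tau>: "0 \<le> \<tau>"
    and rate: "\<And>k. k \<in> {i..s} \<Longrightarrow> real L * (1/2 * ln (vr i i / vr i k)) - ln (T i k) \<le> \<tau>"
  shows "ennreal (ln (1 + leak_ratio i m c y)) \<le> leak_bound i \<tau> m c y"
proof -
  let ?a = "leak_ratio i m c y" and ?b = "leak_ref i m c y"
  let ?g = "\<lambda>k. f i k m c y / (T i k * f i i m c y)"
  \<comment> \<open>A sum of positive parts takes the place of a maximum: it bounds every
    \<open>ln (?g k)\<close> and, being nonnegative, also covers the summand 1 in
    \<open>1 + ?b\<close>.\<close>
  let ?E = "(\<Sum>k\<in>{i..s}. max 0 (ln (?g k)))"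
  let ?U = "(\<Sum>k\<in>{i..s}. \<bar>S i i m c y\<bar> * (1/2) + \<bar>S i k m c y\<bar> * (1/2))"
  have a: "0 \<le> ?a" by (rule leak_ratio_nonneg)
  have b: "1 \<le> ?b" by (rule leak_ref_ge_1[OF i])
  have gpos: "0 < ?g k" if "k \<in> {i..s}" for k
    using that f_pos[OF i] T_pos[of k i] by (intro divide_pos_pos mult_pos_pos) auto
  have "ln (1 + ?a) - ln (1 + ?b) = ln ((1 + ?a) / (1 + ?b))" using a b by (simp add: ln_div)
  also have "\<dots> \<le> (1 + ?a) / (1 + ?b) - 1" using a b by (intro ln_le_minus_one) auto
  also have "\<dots> \<le> ?a / ?b"
  proof -
    have "(1 + ?a) / (1 + ?b) - 1 = (?a - ?b) / (1 + ?b)" using b by (simp add: field_simps)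
    also have "\<dots> \<le> ?a / (1 + ?b)" using b by (intro divide_right_mono) auto
    also have "\<dots> \<le> ?a / ?b" using a b by (intro divide_left_mono mult_pos_pos) auto
    finally show ?thesis .
  qed
  finally have 1: "ln (1 + ?a) \<le> ?a / ?b + ln (1 + ?b)" by simp
  have gE: "?g k \<le> exp ?E" if k: "k \<in> {i..s}" for k
  proof -
    have "ln (?g k) \<le> max 0 (ln (?g k))" by (rule max.cobounded2)
    also have "\<dots> \<le> ?E" using k by (intro member_le_sum) auto
    finally have "exp (ln (?g k)) \<le> exp ?E" by (simp only: exp_le_cancel_iff)
    then show ?thesis by (simp only: exp_ln[OF gpos[OF k]])
  qed
  have E0: "0 \<le> ?E" by (intro sum_nonneg) auto
  \<comment> \<open>One unit and at most \<open>s + 1\<close> summands, whence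
    \<open>s + 2\<close>.\<close>
  have "1 + ?b \<le> exp ?E + real (card {i..s}) * exp ?E"
    unfolding leak_ref_def using gE E0 by (intro add_mono sum_bounded_above) auto
  also have "\<dots> \<le> (real s + 2) * exp ?E"
  proof -
    have "real (card {i..s}) \<le> real s + 1" by simp
    then have "real (card {i..s}) * exp ?E \<le> (real s + 1) * exp ?E" by (intro mult_right_mono) auto
    then show ?thesis by (simp only: distrib_right)
  qed
  finally have "ln (1 + ?b) \<le> ln ((real s + 2) * exp ?E)" using b by (subst ln_le_cancel_iff) auto
  also have "\<dots> = ln (real s + 2) + ?E" by (subst ln_mult_pos) auto
  finally have 2: "ln (1 + ?b) \<le> ln (real s + 2) + ?E" .
  have "max 0 (ln (?g k)) \<le> \<tau> + (\<bar>S i i m c y\<bar> * (1/2) + \<bar>S i k m c y\<bar> * (1/2))" if k: "k \<in> {i..s}" for k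
  proof -
    have "ln (?g k) = ln (f i k m c y) - ln (f i i m c y) - ln (T i k)"
    proof -
      have p: "0 < f i k m c y" "0 < f i i m c y" "0 < T i k" using f_pos[OF i] T_pos[of k i] k by auto
      have "ln (?g k) = ln (f i k m c y) - ln (T i k * f i i m c y)"
        using p by (simp add: ln_divide_pos)
      also have "ln (T i k * f i i m c y) = ln (T i k) + ln (f i i m c y)"
        using p by (intro ln_mult_pos)
      finally show ?thesis by simp
    qed
    also have "\<dots> \<le> \<tau> + 1/2 * S i i m c y - 1/2 * S i k m c y"
      using rate[OF k] unfolding ln_f_ratio[OF i] by simp
    also have "\<dots> \<le> \<tau> + (\<bar>S i i m c y\<bar> * (1/2) + \<bar>S i k m c y\<bar> * (1/2))"
      using abs_ge_self[of "S i i m c y"] abs_ge_minus_self[of "S i k m c y"] by linarith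
    finally show ?thesis using \<tau> by simp
  qed
  then have "?E \<le> (\<Sum>k\<in>{i..s}. \<tau> + (\<bar>S i i m c y\<bar> * (1/2) + \<bar>S i k m c y\<bar> * (1/2)))"
    by (rule sum_mono)
  also have "\<dots> = real (card {i..s}) * \<tau> + ?U" by (simp add: sum.distrib)
  also have "\<dots> \<le> (real s + 1) * \<tau> + ?U"
    using \<tau> by (intro add_mono mult_right_mono) auto
  finally have 3: "?E \<le> (real s + 1) * \<tau> + ?U" .
  have "ln (1 + ?a) \<le> ?a / ?b + (ln (real s + 2) + (real s + 1) * \<tau>) + ?U" using 1 2 3 by linarith
  then have "ennreal (ln (1 + ?a)) \<le> ennreal (?a / ?b + (ln (real s + 2) + (real s + 1) * \<tau>) + ?U)"
    by (rule ennreal_leI)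
  also have "\<dots> = ennreal (?a / ?b) + ennreal (ln (real s + 2) + (real s + 1) * \<tau>) + ennreal ?U"
    using a b \<tau> by (subst ennreal_plus ennreal_plus, auto intro!: add_nonneg_nonneg sum_nonneg)+
  also have "ennreal ?U = (\<Sum>k\<in>{i..s}. ennreal \<bar>S i i m c y\<bar> * ennreal (1/2) + ennreal \<bar>S i k m c y\<bar> * ennreal (1/2))"
  proof -
    have h: "(0::real) \<le> 1/2" by simp
    have "ennreal ?U = (\<Sum>k\<in>{i..s}. ennreal (\<bar>S i i m c y\<bar> * (1/2) + \<bar>S i k m c y\<bar> * (1/2)))"
      by (rule sum_ennreal[symmetric]) auto
    then show ?thesis
      by (simp only: ennreal_plus[OF mult_nonneg_nonneg[OF abs_ge_zero h] mult_nonneg_nonneg[OF abs_ge_zero h]]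
          ennreal_mult'[OF abs_ge_zero])
  qed
  finally show ?thesis unfolding leak_bound_def .
qed

lemma measurable_leak_bound[measurable]:
  assumes [measurable]: "m \<in> msgs" "i \<le> s"
  shows "(\<lambda>z. leak_bound i \<tau> m (fst z) (snd z)) \<in> borel_measurable codes_outputs"
proof -
  have "(\<lambda>z. \<Sum>k\<in>{i..s}. ennreal \<bar>S i i m (fst z) (snd z)\<bar> * ennreal (1/2) + ennreal \<bar>S i k m (fst z) (snd z)\<bar> * ennreal (1/2))
    \<in> borel_measurable codes_outputs"
  proof (rule borel_measurable_sum)
    fix k assume "k \<in> {i..s}"
    then have [measurable]: "k \<le> s" by simp
    show "(\<lambda>z. ennreal \<bar>S i i m (fst z) (snd z)\<bar> * ennreal (1/2) + ennreal \<bar>S i k m (fst z) (snd z)\<bar> * ennreal (1/2))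
      \<in> borel_measurable codes_outputs" by measurable
  qed
  note [measurable] = this
  show ?thesis unfolding leak_bound_def by measurable
qed

text \<open>The quotient has mean at most 1; for each of the at most \<open>s + 1\<close> indices
  \<open>k\<close>, two halves of a mean deviation make up \<open>3/2 * sqrt L\<close>.\<close>

lemma law_leak_bound:
  assumes i: "i \<le> s" and m: "m \<in> msgs" and \<tau>: "0 \<le> \<tau>" and L: "0 < L"
  shows "(\<integral>\<^sup>+z. leak_bound i \<tau> m (fst z) (snd z) \<partial>law i m)
    \<le> ennreal (1 + ln (real s + 2) + (real s + 1) * (\<tau> + 3/2 * sqrt (real L)))"
proof -
  note [measurable] = i m
  let ?t = "\<lambda>k z. ennreal \<bar>S i i m (fst z) (snd z)\<bar> * ennreal (1/2) + ennreal \<bar>S i k m (fst z) (snd z)\<bar> * ennreal (1/2)"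
  let ?c = "ennreal (ln (real s + 2) + (real s + 1) * \<tau>)"
  let ?r = "\<lambda>z. ennreal (leak_ratio i m (fst z) (snd z) / leak_ref i m (fst z) (snd z))"
  have tm[measurable]: "?t k \<in> borel_measurable (law i m)" if "k \<in> {i..s}" for k
  proof -
    from that have [measurable]: "k \<le> s" by simp
    show ?thesis by measurable
  qed
  have half: "(\<integral>\<^sup>+z. ennreal \<bar>S i k m (fst z) (snd z)\<bar> * ennreal (1/2) \<partial>law i m) \<le> ennreal (3/2 * sqrt (real L) * (1/2))"
    if [measurable]: "k \<le> s" for k
  proof -
    have "(\<integral>\<^sup>+z. ennreal \<bar>S i k m (fst z) (snd z)\<bar> * ennreal (1/2) \<partial>law i m) = (\<integral>\<^sup>+z. ennreal \<bar>S i k m (fst z) (snd z)\<bar> \<partial>law i m) * ennreal (1/2)"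
      by (rule nn_integral_multc) measurable
    also have "\<dots> \<le> ennreal (3/2 * sqrt (real L)) * ennreal (1/2)"
      by (intro mult_right_mono law_S_abs i m that L) auto
    finally show ?thesis by (simp only: ennreal_mult'[symmetric] divide_nonneg_nonneg zero_le_one zero_le_numeral real_sqrt_ge_zero of_nat_0_le_iff mult_nonneg_nonneg)
  qed
  have t: "(\<integral>\<^sup>+z. ?t k z \<partial>law i m) \<le> ennreal (3/2 * sqrt (real L))" if k: "k \<in> {i..s}" for k
  proof -
    from k have [measurable]: "k \<le> s" by simp
    have "(\<integral>\<^sup>+z. ?t k z \<partial>law i m) = (\<integral>\<^sup>+z. ennreal \<bar>S i i m (fst z) (snd z)\<bar> * ennreal (1/2) \<partial>law i m)
      + (\<integral>\<^sup>+z. ennreal \<bar>S i k m (fst z) (snd z)\<bar> * ennreal (1/2) \<partial>law i m)"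
      by (rule nn_integral_add) measurable
    also have "\<dots> \<le> ennreal (3/2 * sqrt (real L) * (1/2)) + ennreal (3/2 * sqrt (real L) * (1/2))"
      using k by (intro add_mono half i) auto
    also have "\<dots> = ennreal (3/2 * sqrt (real L))" by (subst ennreal_plus[symmetric]) auto
    finally show ?thesis .
  qed
  have "(\<integral>\<^sup>+z. leak_bound i \<tau> m (fst z) (snd z) \<partial>law i m)
    = (\<integral>\<^sup>+z. ?r z + ?c \<partial>law i m) + (\<integral>\<^sup>+z. (\<Sum>k\<in>{i..s}. ?t k z) \<partial>law i m)"
    unfolding leak_bound_def by (rule nn_integral_add) measurable
  also have "(\<integral>\<^sup>+z. ?r z + ?c \<partial>law i m) = (\<integral>\<^sup>+z. ?r z \<partial>law i m) + (\<integral>\<^sup>+z. ?c \<partial>law i m)"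
    by (rule nn_integral_add) measurable
  also have "(\<integral>\<^sup>+z. (\<Sum>k\<in>{i..s}. ?t k z) \<partial>law i m) = (\<Sum>k\<in>{i..s}. \<integral>\<^sup>+z. ?t k z \<partial>law i m)"
    by (rule nn_integral_sum) (rule tm)
  also have "(\<integral>\<^sup>+z. ?c \<partial>law i m) = ?c"
    using nn_integral_law_1[OF i m] by simp
  also have "(\<integral>\<^sup>+z. ?r z \<partial>law i m) + ?c + (\<Sum>k\<in>{i..s}. \<integral>\<^sup>+z. ?t k z \<partial>law i m)
    \<le> 1 + ?c + (\<Sum>k\<in>{i..s}. ennreal (3/2 * sqrt (real L)))"
    using t by (intro add_mono law_leak_ratio i m order_refl sum_mono)
  also have "(\<Sum>k\<in>{i..s}. ennreal (3/2 * sqrt (real L))) = ennreal (\<Sum>k\<in>{i..s}. 3/2 * sqrt (real L))"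
    by (rule sum_ennreal) auto
  also have "\<dots> \<le> ennreal ((real s + 1) * (3/2 * sqrt (real L)))"
    unfolding sum_constant by (intro ennreal_leI mult_right_mono) auto
  also have "1 + ?c + ennreal ((real s + 1) * (3/2 * sqrt (real L)))
    = ennreal (1 + (ln (real s + 2) + (real s + 1) * \<tau>) + (real s + 1) * (3/2 * sqrt (real L)))"
    using \<tau> by (subst ennreal_plus ennreal_plus, auto intro!: add_nonneg_nonneg)+
  also have "1 + (ln (real s + 2) + (real s + 1) * \<tau>) + (real s + 1) * (3/2 * sqrt (real L))
    = 1 + ln (real s + 2) + (real s + 1) * (\<tau> + 3/2 * sqrt (real L))"
    by (simp add: distrib_left)
  finally show ?thesis by (simp add: add_mono)
qed

text \<open>The decoder factors through the candidate set, which takes finitely many values and is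
  fixed by finitely many comparisons of densities; on this discrete space any choice function is
  measurable.\<close>

lemma measurable_decoder:
  assumes c: "c \<in> space codebooks" and j: "j \<le> s"
  shows "decoder \<gamma> c j \<in> outputs \<rightarrow>\<^sub>M count_space UNIV"
proof -
  have f[measurable]: "(\<lambda>y. f j k m c y) \<in> borel_measurable (outputs)" if "k \<le> s" "m \<in> msgs" for k m
    using c that by (intro measurable_f) auto
  have [measurable]: "Measurable.pred (outputs) (\<lambda>y. pass \<gamma> j k m c y)" if "k \<in> {1..j}" "m \<in> msgs" for k m
  proof -
    have [measurable]: "k \<le> s" "k - 1 \<le> s" "m \<in> msgs" using that j by auto
    show ?thesis unfolding pass_def by measurable
  qed
  have "(\<lambda>y. candidates \<gamma> j c y) \<in> outputs \<rightarrow>\<^sub>M count_space (Pow msgs)"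
  proof (subst measurable_count_space_eq2, simp, intro conjI ballI)
    show "(\<lambda>y. candidates \<gamma> j c y) \<in> space (outputs) \<rightarrow> Pow msgs"
      by (auto simp: candidates_def)
    fix C assume C: "C \<in> Pow msgs"
    have "(\<lambda>y. candidates \<gamma> j c y) -` {C} \<inter> space (outputs)
      = {y \<in> space (outputs). \<forall>m\<in>msgs. (m \<in> C) = (\<forall>k\<in>{1..j}. pass \<gamma> j k m c y)}"
      using C by (auto simp: candidates_def)
    also have "\<dots> \<in> sets (outputs)" by measurable
    finally show "(\<lambda>y. candidates \<gamma> j c y) -` {C} \<inter> space (outputs) \<in> sets (outputs)" .
  qed
  from measurable_compose[OF this, of "\<lambda>C i. fst ((SOME m. m \<in> C) i)" "count_space UNIV"]
  show ?thesis by (simp add: decoder_def[abs_def])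
qed

end

section \<open>Mixtures and the channel kernel\<close>

lemma log_sum_inequality:
  fixes x y :: "'a \<Rightarrow> real"
  assumes "finite I" "\<And>a. a \<in> I \<Longrightarrow> 0 < x a" "\<And>a. a \<in> I \<Longrightarrow> 0 < y a"
  shows "(\<Sum>a\<in>I. x a) * ln ((\<Sum>a\<in>I. x a) / (\<Sum>a\<in>I. y a)) \<le> (\<Sum>a\<in>I. x a * ln (x a / y a))"
proof (cases "I = {}")
  case False
  let ?X = "\<Sum>a\<in>I. x a" and ?Y = "\<Sum>a\<in>I. y a"
  have X: "0 < ?X" and Y: "0 < ?Y" using assms False by (auto intro: sum_pos)
  have "x a * ln (?X / ?Y) + x a - y a * (?X / ?Y) \<le> x a * ln (x a / y a)" if a: "a \<in> I" for a
  proof -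
    have xa: "0 < x a" "0 < y a" using assms a by auto
    have "ln (?X / ?Y * (y a / x a)) \<le> ?X / ?Y * (y a / x a) - 1"
      using X Y xa by (intro ln_le_minus_one) auto
    moreover have "ln (?X / ?Y * (y a / x a)) = ln (?X / ?Y) - ln (x a / y a)"
      using X Y xa by (simp add: ln_mult_pos ln_divide_pos)
    ultimately have "x a * (ln (?X / ?Y) - ln (x a / y a)) \<le> x a * (?X / ?Y * (y a / x a) - 1)"
      using xa by (intro mult_left_mono) auto
    also have "\<dots> = y a * (?X / ?Y) - x a" using xa by (simp add: field_simps)
    finally show ?thesis by (simp add: algebra_simps)
  qed
  then have "(\<Sum>a\<in>I. x a * ln (?X / ?Y) + x a - y a * (?X / ?Y)) \<le> (\<Sum>a\<in>I. x a * ln (x a / y a))"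
    by (rule sum_mono)
  moreover have "(\<Sum>a\<in>I. x a * ln (?X / ?Y) + x a - y a * (?X / ?Y)) = ?X * ln (?X / ?Y)"
    unfolding sum.distrib sum_subtractf sum_distrib_right[symmetric] using Y by simp
  ultimately show ?thesis by simp
qed simp

text \<open>Pointwise form of the leakage bound: \<open>\<alpha>\<close> is the cloud of a message, \<open>\<beta>\<close> its secret part,
  \<open>g\<close> the output density given the message and \<open>q\<close> an arbitrary reference density given the cloud.\<close>

lemma mixture_divergence_le:
  fixes g :: "'m \<Rightarrow> real" and q :: "'a \<Rightarrow> real" and \<alpha> :: "'m \<Rightarrow> 'a" and \<beta> :: "'m \<Rightarrow> 'b"
  assumes fin: "finite X" and g: "\<And>m. m \<in> X \<Longrightarrow> 0 < g m" and q: "\<And>a. a \<in> \<alpha> ` X \<Longrightarrow> 0 < q a"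
    and card: "\<And>a b. a \<in> \<alpha> ` X \<Longrightarrow> b \<in> \<beta> ` X \<Longrightarrow> real (card {m\<in>X. \<alpha> m = a \<and> \<beta> m = b}) = t" and t: "0 < t"
    and b: "b \<in> \<beta> ` X"
  shows "sum g {m\<in>X. \<beta> m = b} * ln (sum g {m\<in>X. \<beta> m = b} / real (card X) / (real (card {m\<in>X. \<beta> m = b}) / real (card X) * (sum g X / real (card X))))
    \<le> (\<Sum>m\<in>{m\<in>X. \<beta> m = b}. g m * (ln (1 + sum g {m'\<in>X. \<alpha> m' = \<alpha> m \<and> \<beta> m' = b} / (t * q (\<alpha> m)))
        + real (card (\<beta> ` X)) * t * q (\<alpha> m) / sum g {m'\<in>X. \<alpha> m' = \<alpha> m}))"
proof -
  let ?Gab = "\<lambda>a. sum g {m\<in>X. \<alpha> m = a \<and> \<beta> m = b}" and ?Ga = "\<lambda>a. sum g {m\<in>X. \<alpha> m = a}"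
  let ?A = "\<alpha> ` X" and ?nB = "real (card (\<beta> ` X))"
  have X0: "0 < card X" using b fin by (auto simp: card_gt_0_iff)
  have nB: "0 < ?nB" using b fin by (auto simp: card_gt_0_iff)
  \<comment> \<open>Constant intersections mean that, for a uniform message, cloud and secret part
    are uniform and independent.\<close>
  have cb: "real (card {m\<in>X. \<beta> m = b'}) = t * real (card ?A)" if "b' \<in> \<beta> ` X" for b'
  proof -
    have "card {m\<in>X. \<beta> m = b'} = (\<Sum>a\<in>?A. card {m\<in>X. \<alpha> m = a \<and> \<beta> m = b'})"
    proof -
      have "\<alpha> ` {m\<in>X. \<beta> m = b'} \<subseteq> ?A" by auto
      from sum.group[OF _ _ this, of "\<lambda>_. 1::nat"] fin show ?thesis by (simp add: conj_ac)
    qed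
    then have "real (card {m\<in>X. \<beta> m = b'}) = (\<Sum>a\<in>?A. real (card {m\<in>X. \<alpha> m = a \<and> \<beta> m = b'}))" by simp
    also have "\<dots> = (\<Sum>a\<in>?A. t)" using that by (intro sum.cong refl card)
    finally show ?thesis by simp
  qed
  have cX: "real (card X) = ?nB * (t * real (card ?A))"
  proof -
    have "card X = (\<Sum>b\<in>\<beta> ` X. card {m\<in>X. \<beta> m = b})"
      using sum.group[of X "\<beta> ` X" \<beta> "\<lambda>_. 1::nat"] fin by simp
    then have "real (card X) = (\<Sum>b\<in>\<beta> ` X. real (card {m\<in>X. \<beta> m = b}))" by simp
    also have "\<dots> = (\<Sum>b\<in>\<beta> ` X. t * real (card ?A))" by (intro sum.cong refl cb)
    finally show ?thesis by simp
  qed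
  have Gb: "sum g {m\<in>X. \<beta> m = b} = (\<Sum>a\<in>?A. ?Gab a)"
  proof -
    have "\<alpha> ` {m\<in>X. \<beta> m = b} \<subseteq> ?A" by auto
    from sum.group[OF _ _ this, of g] fin show ?thesis by (simp add: conj_ac)
  qed
  have GX: "sum g X = (\<Sum>a\<in>?A. ?Ga a)"
    using sum.group[of X ?A \<alpha> g] fin by simp
  have Gab_pos: "0 < ?Gab a" if "a \<in> ?A" for a
  proof (rule sum_pos)
    show "{m\<in>X. \<alpha> m = a \<and> \<beta> m = b} \<noteq> {}"
    proof
      assume "{m\<in>X. \<alpha> m = a \<and> \<beta> m = b} = {}"
      with card[OF that b] t show False by (simp only: card.empty of_nat_0)
    qed
  qed (use fin g in auto)
  have Ga_pos: "0 < ?Ga a" if "a \<in> ?A" for a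
    using that fin g by (intro sum_pos) auto
  have Apos: "0 < real (card ?A)" using b fin by (auto simp: card_gt_0_iff)
  have "sum g {m\<in>X. \<beta> m = b} / real (card X) / (real (card {m\<in>X. \<beta> m = b}) / real (card X) * (sum g X / real (card X)))
    = (\<Sum>a\<in>?A. ?Gab a) / (\<Sum>a\<in>?A. ?Ga a / ?nB)"
    unfolding Gb[symmetric] sum_divide_distrib[symmetric] GX[symmetric] cb[OF b] cX
    using t Apos nB by (simp add: field_simps)
  then have "sum g {m\<in>X. \<beta> m = b} * ln (sum g {m\<in>X. \<beta> m = b} / real (card X) / (real (card {m\<in>X. \<beta> m = b}) / real (card X) * (sum g X / real (card X))))
    = (\<Sum>a\<in>?A. ?Gab a) * ln ((\<Sum>a\<in>?A. ?Gab a) / (\<Sum>a\<in>?A. ?Ga a / ?nB))"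
    by (simp only: Gb)
  \<comment> \<open>Splitting over clouds amounts to revealing the cloud, which can only increase
    the divergence.\<close>
  also have "\<dots> \<le> (\<Sum>a\<in>?A. ?Gab a * ln (?Gab a / (?Ga a / ?nB)))"
    using fin nB Gab_pos Ga_pos by (intro log_sum_inequality) auto
  also have "\<dots> \<le> (\<Sum>a\<in>?A. ?Gab a * (ln (1 + ?Gab a / (t * q a)) + ?nB * t * q a / ?Ga a))"
  proof (intro sum_mono mult_left_mono)
    fix a assume a: "a \<in> ?A"
    have p: "0 < ?Gab a" "0 < ?Ga a" "0 < q a" using Gab_pos Ga_pos q a by auto
    \<comment> \<open>The true density given the cloud is itself a random mixture; it is traded for
      the reference \<open>q\<close>, and the second factor is the price.\<close>
    have "?Gab a / (?Ga a / ?nB) = (?Gab a / (t * q a)) * (?nB * t * q a / ?Ga a)"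
      using p t by (simp add: field_simps)
    then have "ln (?Gab a / (?Ga a / ?nB)) = ln (?Gab a / (t * q a)) + ln (?nB * t * q a / ?Ga a)"
      using p t nB by (simp only: ln_mult_pos divide_pos_pos mult_pos_pos)
    also have "\<dots> \<le> ln (1 + ?Gab a / (t * q a)) + ?nB * t * q a / ?Ga a"
    proof (rule add_mono)
      have "0 < ?Gab a / (t * q a)" using p t by simp
      then show "ln (?Gab a / (t * q a)) \<le> ln (1 + ?Gab a / (t * q a))" by simp
      have "0 < ?nB * t * q a / ?Ga a" using p t nB by simp
      then show "ln (?nB * t * q a / ?Ga a) \<le> ?nB * t * q a / ?Ga a" using ln_le_minus_one[of "?nB * t * q a / ?Ga a"] by linarith
    qed
    finally show "ln (?Gab a / (?Ga a / ?nB)) \<le> ln (1 + ?Gab a / (t * q a)) + ?nB * t * q a / ?Ga a" .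
    show "0 \<le> ?Gab a" using p by simp
  qed
  also have "\<dots> = (\<Sum>a\<in>?A. \<Sum>m\<in>{m\<in>{m\<in>X. \<beta> m = b}. \<alpha> m = a}. g m * (ln (1 + ?Gab (\<alpha> m) / (t * q (\<alpha> m))) + ?nB * t * q (\<alpha> m) / ?Ga (\<alpha> m)))"
    unfolding sum_distrib_right by (intro sum.cong refl) (auto intro!: sum.cong)
  also have "\<dots> = (\<Sum>m\<in>{m\<in>X. \<beta> m = b}. g m * (ln (1 + ?Gab (\<alpha> m) / (t * q (\<alpha> m))) + ?nB * t * q (\<alpha> m) / ?Ga (\<alpha> m)))"
    using fin by (intro sum.group) auto
  finally show ?thesis .
qed

text \<open>Within a cloud the weights \<open>g m\<close> sum to the denominator, which leaves one
  copy of \<open>q\<close> per message. So the price of the reference density integrates to a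
  constant, the 1 in the bound on the information.\<close>

lemma mixture_reference_sum:
  fixes g :: "'m \<Rightarrow> real" and q :: "'a \<Rightarrow> real" and \<alpha> :: "'m \<Rightarrow> 'a" and \<beta> :: "'m \<Rightarrow> 'b"
  assumes fin: "finite X" and g: "\<And>m. m \<in> X \<Longrightarrow> 0 < g m"
    and card: "\<And>a b. a \<in> \<alpha> ` X \<Longrightarrow> b \<in> \<beta> ` X \<Longrightarrow> real (card {m\<in>X. \<alpha> m = a \<and> \<beta> m = b}) = t"
  shows "(\<Sum>m\<in>X. g m * (real (card (\<beta> ` X)) * t * q (\<alpha> m) / sum g {m'\<in>X. \<alpha> m' = \<alpha> m})) = (\<Sum>m\<in>X. q (\<alpha> m))"
proof -
  let ?A = "\<alpha> ` X" and ?nB = "real (card (\<beta> ` X))"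
  have ca: "real (card {m\<in>X. \<alpha> m = a}) = ?nB * t" if "a \<in> ?A" for a
  proof -
    have "card {m\<in>X. \<alpha> m = a} = (\<Sum>b\<in>\<beta> ` X. card {m\<in>X. \<alpha> m = a \<and> \<beta> m = b})"
    proof -
      have "\<beta> ` {m\<in>X. \<alpha> m = a} \<subseteq> \<beta> ` X" by auto
      from sum.group[OF _ _ this, of "\<lambda>_. 1::nat"] fin show ?thesis by simp
    qed
    then have "real (card {m\<in>X. \<alpha> m = a}) = (\<Sum>b\<in>\<beta> ` X. real (card {m\<in>X. \<alpha> m = a \<and> \<beta> m = b}))" by simp
    also have "\<dots> = (\<Sum>b\<in>\<beta> ` X. t)" using that by (intro sum.cong refl card)
    finally show ?thesis by simp
  qed
  have "(\<Sum>m\<in>X. g m * (?nB * t * q (\<alpha> m) / sum g {m'\<in>X. \<alpha> m' = \<alpha> m}))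
    = (\<Sum>a\<in>?A. \<Sum>m\<in>{m\<in>X. \<alpha> m = a}. g m * (?nB * t * q (\<alpha> m) / sum g {m'\<in>X. \<alpha> m' = \<alpha> m}))"
    using fin by (intro sum.group[symmetric]) auto
  also have "\<dots> = (\<Sum>a\<in>?A. \<Sum>m\<in>{m\<in>X. \<alpha> m = a}. q (\<alpha> m))"
  proof (rule sum.cong[OF refl])
    fix a assume a: "a \<in> ?A"
    have 1: "0 < sum g {m'\<in>X. \<alpha> m' = a}" using a fin g by (intro sum_pos) auto
    have 2: "(\<Sum>m\<in>{m\<in>X. \<alpha> m = a}. g m * (?nB * t * q (\<alpha> m) / sum g {m'\<in>X. \<alpha> m' = \<alpha> m}))
      = (\<Sum>m\<in>{m\<in>X. \<alpha> m = a}. g m) * (?nB * t * q a / sum g {m'\<in>X. \<alpha> m' = a})"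
      unfolding sum_distrib_right by (intro sum.cong refl) auto
    have "(\<Sum>m\<in>{m\<in>X. \<alpha> m = a}. q (\<alpha> m)) = (\<Sum>m\<in>{m\<in>X. \<alpha> m = a}. q a)"
      by (rule sum.cong) auto
    then have 3: "(\<Sum>m\<in>{m\<in>X. \<alpha> m = a}. q (\<alpha> m)) = ?nB * t * q a"
      by (simp only: sum_constant ca[OF a])
    have 4: "S * (K / S) = K" if "0 < S" for S K :: real using that by simp
    show "(\<Sum>m\<in>{m\<in>X. \<alpha> m = a}. g m * (?nB * t * q (\<alpha> m) / sum g {m'\<in>X. \<alpha> m' = \<alpha> m}))
      = (\<Sum>m\<in>{m\<in>X. \<alpha> m = a}. q (\<alpha> m))"
      unfolding 2 3 by (rule 4[OF 1])
  qed
  also have "\<dots> = (\<Sum>m\<in>X. q (\<alpha> m))" using fin by (intro sum.group) auto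
  finally show ?thesis .
qed

text \<open>A Bochner integral is at most that of the positive part, which is what
  \<open>ennreal\<close> keeps; a non-integrable function has integral 0 by convention. The signed
  integrand of the information can thus be bounded through nonnegative integrals.\<close>

lemma integral_le_nn_integral:
  assumes "(\<integral>\<^sup>+x. ennreal (F x) \<partial>N) \<le> ennreal B" "0 \<le> B"
  shows "integral\<^sup>L N F \<le> B"
proof (cases "integrable N F")
  case True
  have "integral\<^sup>L N F \<le> enn2real (\<integral>\<^sup>+x. ennreal (F x) \<partial>N)"
    unfolding real_lebesgue_integral_def[OF True] by simp
  also have "\<dots> \<le> B" using assms by (metis enn2real_ennreal enn2real_mono ennreal_less_top)
  finally show ?thesis .
next
  case False
  with assms show ?thesis by (simp add: not_integrable_integral_eq)
qed

section \<open>Second moments and the channel as a kernel\<close>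

lemma nn_integral_normal_square:
  "(\<integral>\<^sup>+x. ennreal (x\<^sup>2) \<partial>density lborel (\<lambda>x. ennreal (normal_density \<mu> 1 x))) = ennreal (1 + \<mu>\<^sup>2)"
proof -
  have "has_bochner_integral lborel (\<lambda>x. normal_density \<mu> 1 x * (x - \<mu>) ^ (2 * 1)
      + (2 * \<mu> * (normal_density \<mu> 1 x * (x - \<mu>) ^ (2 * 0 + 1)) + \<mu>\<^sup>2 * (normal_density \<mu> 1 x * (x - \<mu>) ^ (2 * 0))))
      (fact (2 * 1) / ((2 / 1\<^sup>2)^1 * fact 1) + (2 * \<mu> * 0 + \<mu>\<^sup>2 * (fact (2 * 0) / ((2 / 1\<^sup>2)^0 * fact 0))))"
    by (intro has_bochner_integral_add has_bochner_integral_mult_right normal_moment_even normal_moment_odd) auto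
  then have hb: "has_bochner_integral lborel (\<lambda>x. normal_density \<mu> 1 x * x\<^sup>2) (1 + \<mu>\<^sup>2)"
    by (rule has_bochner_integral_cong[THEN iffD1, rotated -1]) (auto simp: power2_eq_square algebra_simps)
  have "(\<integral>\<^sup>+x. ennreal (x\<^sup>2) \<partial>density lborel (\<lambda>x. ennreal (normal_density \<mu> 1 x)))
    = (\<integral>\<^sup>+x. ennreal (normal_density \<mu> 1 x * x\<^sup>2) \<partial>lborel)"
    by (subst nn_integral_density) (auto simp: ennreal_mult')
  also have "\<dots> = ennreal (1 + \<mu>\<^sup>2)"
    using hb by (subst nn_integral_eq_integral) (auto simp: has_bochner_integral_iff)
  finally show ?thesis .
qed

text \<open>Signal and noise energies add because the noise is centred. This ties the power of a
  codeword to the output it causes.\<close>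

lemma nn_integral_block_density_norm_square:
  "(\<integral>\<^sup>+y. ennreal (block_density L 1 \<mu> y) * ennreal (\<Sum>t<L. (y t)\<^sup>2) \<partial>leb_block L) = ennreal (real L + (\<Sum>t<L. (\<mu> t)\<^sup>2))"
proof -
  let ?N = "\<lambda>t. density lborel (\<lambda>x. ennreal (normal_density (\<mu> t) (sqrt 1) x))"
  interpret N: product_prob_space ?N "{..<L}"
    by (rule product_prob_spaceI) (auto intro: prob_space_normal_density)
  have "(\<integral>\<^sup>+y. ennreal (block_density L 1 \<mu> y) * ennreal (\<Sum>t<L. (y t)\<^sup>2) \<partial>leb_block L)
    = (\<integral>\<^sup>+y. ennreal (\<Sum>t<L. (y t)\<^sup>2) \<partial>PiM {..<L} ?N)"
    unfolding PiM_normal_eq_density[OF zero_less_one]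
    by (subst nn_integral_density) (auto intro!: borel_measurable_sum borel_measurable_power measurable_leb_block_component measurable_compose[OF _ measurable_ennreal])
  also have "\<dots> = (\<integral>\<^sup>+y. (\<Sum>t<L. ennreal ((y t)\<^sup>2)) \<partial>PiM {..<L} ?N)"
    by (intro nn_integral_cong sum_ennreal[symmetric]) auto
  also have "\<dots> = (\<Sum>t<L. \<integral>\<^sup>+y. ennreal ((y t)\<^sup>2) \<partial>PiM {..<L} ?N)"
  proof (rule nn_integral_sum)
    fix t assume "t \<in> {..<L}"
    then have "(\<lambda>y. y t) \<in> borel_measurable (PiM {..<L} ?N)"
      using measurable_component_singleton[of t "{..<L}" ?N] by simp
    then show "(\<lambda>y. ennreal ((y t)\<^sup>2)) \<in> borel_measurable (PiM {..<L} ?N)" by measurable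
  qed
  also have "\<dots> = (\<Sum>t<L. ennreal (1 + (\<mu> t)\<^sup>2))"
  proof (rule sum.cong[OF refl])
    fix t assume t: "t \<in> {..<L}"
    have "(\<integral>\<^sup>+y. ennreal ((y t)\<^sup>2) \<partial>PiM {..<L} ?N) = (\<integral>\<^sup>+x. ennreal (x\<^sup>2) \<partial>distr (PiM {..<L} ?N) (?N t) (\<lambda>y. y t))"
      using t by (subst nn_integral_distr) auto
    also have "distr (PiM {..<L} ?N) (?N t) (\<lambda>y. y t) = ?N t" using t by (intro N.PiM_component) auto
    finally show "(\<integral>\<^sup>+y. ennreal ((y t)\<^sup>2) \<partial>PiM {..<L} ?N) = ennreal (1 + (\<mu> t)\<^sup>2)"
      by (simp add: nn_integral_normal_square)
  qed
  also have "\<dots> = ennreal (real L + (\<Sum>t<L. (\<mu> t)\<^sup>2))"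
    by (subst sum_ennreal) (auto simp: sum.distrib)
  finally show ?thesis .
qed

text \<open>The density is jointly measurable in input and output, so by Tonelli the probability of
  a fixed event is measurable in the input.\<close>

lemma measurable_gauss_channel: "gauss_channel h r L \<in> block_space L \<rightarrow>\<^sub>M subprob_algebra (block_space L)"
proof (rule measurable_subprob_algebra)
  interpret B: sigma_finite_measure "leb_block L" by (rule sigma_finite_leb_block)
  fix x
  have "prob_space (gauss_channel h r L x)"
    unfolding gauss_channel_def by (intro prob_space_PiM prob_space_normal_density) auto
  then show "subprob_space (gauss_channel h r L x)" by (rule prob_space_imp_subprob_space)
  show "sets (gauss_channel h r L x) = sets (block_space L)" by (simp add: gauss_channel_eq_density)
next
  interpret B: sigma_finite_measure "leb_block L" by (rule sigma_finite_leb_block)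
  fix E assume E: "E \<in> sets (block_space L)"
  have "(\<lambda>z. ennreal (block_density L 1 (\<lambda>t. sqrt (h r) * fst z t) (snd z)) * indicator E (snd z)) \<in> borel_measurable (block_space L \<Otimes>\<^sub>M leb_block L)"
  proof -
    have N: "(\<lambda>z. block_density L 1 (\<lambda>t. sqrt (h r) * fst z t) (snd z)) \<in> borel_measurable (block_space L \<Otimes>\<^sub>M leb_block L)"
    proof (rule measurable_block_density)
      fix t assume "t < L"
      then show "(\<lambda>z. sqrt (h r) * fst z t) \<in> borel_measurable (block_space L \<Otimes>\<^sub>M leb_block L)"
        "(\<lambda>z. snd z t) \<in> borel_measurable (block_space L \<Otimes>\<^sub>M leb_block L)"
        using measurable_compose[OF measurable_fst measurable_block_component] measurable_compose[OF measurable_snd measurable_leb_block_component]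
        by (auto intro!: borel_measurable_times)
    qed
    have "(indicator E :: _ \<Rightarrow> ennreal) \<in> borel_measurable (leb_block L)" using E by simp
    then have "(\<lambda>z. indicator E (snd z) :: ennreal) \<in> borel_measurable (block_space L \<Otimes>\<^sub>M leb_block L)"
      by (rule measurable_compose[OF measurable_snd])
    with N show ?thesis
      by (intro borel_measurable_times_ennreal measurable_compose[OF N measurable_ennreal])
  qed
  then have "(\<lambda>x. \<integral>\<^sup>+y. ennreal (block_density L 1 (\<lambda>t. sqrt (h r) * x t) y) * indicator E y \<partial>leb_block L) \<in> borel_measurable (block_space L)"
    using B.borel_measurable_nn_integral_fst by fastforce
  moreover have "emeasure (gauss_channel h r L x) E = (\<integral>\<^sup>+y. ennreal (block_density L 1 (\<lambda>t. sqrt (h r) * x t) y) * indicator E y \<partial>leb_block L)" for x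
    unfolding gauss_channel_eq_density
    using E by (intro emeasure_density) (auto intro!: measurable_compose[OF _ measurable_ennreal])
  ultimately show "(\<lambda>x. emeasure (gauss_channel h r L x) E) \<in> borel_measurable (block_space L)" by simp
qed

section \<open>The code of a fixed codebook\<close>

locale wiretap_code = superposition_code +
  fixes c :: "nat \<times> (nat \<Rightarrow> nat \<times> nat) \<Rightarrow> nat \<Rightarrow> real" and R :: "nat \<Rightarrow> real"
  assumes c: "c \<in> space codebooks"
    and A_eq: "\<And>k. k \<in> {1..s} \<Longrightarrow> A k = msg_size L (R k)"
begin

definition secret where "secret m = (\<lambda>k\<in>{1..s}. fst (m k))" for m :: "nat \<Rightarrow> nat \<times> nat"

text \<open>Restricted to \<open>{..<L}\<close> so that it is a point of the extensional space of
  \<open>block_space L\<close>.\<close>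

definition codeword where "codeword m = (\<lambda>t\<in>{..<L}. \<Sum>l\<in>{1..s}. sqrt (p l) * c (idx l m) t)"

text \<open>A uniform path with secret part \<open>w\<close> amounts to independent uniform
  randomisation indices in all layers.\<close>

definition encoder where
  "encoder w = distr (measure_pmf (pmf_of_set {m\<in>msgs. secret m = w})) (block_space L) codeword"

abbreviation W where "W \<equiv> msg_set s L R"

abbreviation J where "J r \<equiv> joint_law s L R h encoder r"

lemma W_eq: "W = (\<Pi>\<^sub>E k\<in>{1..s}. {1..A k})"
  unfolding msg_set_def by (intro PiE_cong) (simp add: A_eq)

lemma finite_W[simp]: "finite W"
  unfolding W_eq by (intro finite_PiE) auto

lemma secret_in_W: "m \<in> msgs \<Longrightarrow> secret m \<in> W"
  unfolding W_eq secret_def msgs_def by (auto dest!: PiE_mem simp: mem_Times_iff)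

lemma W_secret_image: "W = secret ` msgs"
proof (intro set_eqI iffI)
  fix w assume w: "w \<in> W"
  \<comment> \<open>Index 0 exists in every layer because \<open>M k\<close> is positive.\<close>
  let ?m = "\<lambda>k\<in>{1..s}. (w k, 0 :: nat)"
  have "?m \<in> msgs"
    unfolding msgs_def using w M_pos unfolding W_eq by (intro PiE_I) (auto dest!: PiE_mem simp: mem_Times_iff)
  moreover have "secret ?m = w"
  proof
    fix k
    show "secret ?m k = w k"
      using w PiE_arb[of w "{1..s}" _ k] unfolding W_eq by (auto simp: secret_def)
  qed
  ultimately show "w \<in> secret ` msgs" by force
qed (auto intro: secret_in_W)

lemma W_nonempty: "W \<noteq> {}"
  using W_secret_image msgs_nonempty by simp

lemma secret_class_eq_fibre:
  assumes "m \<in> msgs"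
  shows "{m'\<in>msgs. secret m' = secret m} = fibre 0 m"
proof -
  have "secret m' = secret m \<longleftrightarrow> (\<forall>l\<in>{1..s}. fst (m' l) = fst (m l))" for m'
    by (auto simp: secret_def fun_eq_iff restrict_def)
  then show ?thesis by (auto simp: fibre_def restrict_def)
qed

lemma card_secret_class:
  assumes "w \<in> W"
  shows "real (card {m\<in>msgs. secret m = w}) = T 0 s"
proof -
  obtain m where m: "m \<in> msgs" "w = secret m" using assms W_secret_image by auto
  show ?thesis using card_fibre[OF m(1), of 0] unfolding m(2) secret_class_eq_fibre[OF m(1)] .
qed

lemma secret_class_nonempty: "w \<in> W \<Longrightarrow> {m\<in>msgs. secret m = w} \<noteq> {}"
  using W_secret_image by auto

lemma card_msgs: "real (card msgs) = real (card W) * T 0 s"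
proof -
  have "card msgs = (\<Sum>w\<in>W. card {m\<in>msgs. secret m = w})"
  proof -
    have "secret ` msgs \<subseteq> W" using secret_in_W by auto
    from sum.group[OF finite_msgs finite_W this, of "\<lambda>_. 1::nat"] show ?thesis by simp
  qed
  then have "real (card msgs) = (\<Sum>w\<in>W. real (card {m\<in>msgs. secret m = w}))" by simp
  then show ?thesis by (simp add: card_secret_class)
qed

lemma card_msgs_pos: "0 < real (card msgs)"
  using msgs_nonempty by (simp add: card_gt_0_iff)

lemma codeword_in_space: "codeword m \<in> space (block_space L)"
  by (simp add: codeword_def block_space_def space_PiM)

lemma measurable_codeword_pmf: "codeword \<in> measure_pmf q \<rightarrow>\<^sub>M block_space L"
  using codeword_in_space by simp

lemma encoder_prob: "w \<in> W \<Longrightarrow> encoder w \<in> space (prob_algebra (block_space L))"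
  unfolding encoder_def space_prob_algebra
  by (auto intro!: prob_space.prob_space_distr measurable_codeword_pmf measure_pmf.prob_space_axioms)

lemma gauss_channel_codeword:
  "gauss_channel h r L (codeword m) = density (outputs) (\<lambda>y. ennreal (f r s m c y))"
proof -
  have "block_density L 1 (\<lambda>t. sqrt (h r) * codeword m t) y = f r s m c y" for y
    unfolding f_def block_density_def by (intro prod.cong) (auto simp: vr_def mean_def codeword_def)
  then show ?thesis by (simp add: gauss_channel_eq_density)
qed

lemma measurable_f_fixed: "m \<in> msgs \<Longrightarrow> k \<le> s \<Longrightarrow> (\<lambda>y. f r k m c y) \<in> borel_measurable (outputs)"
  using c by (intro measurable_f) auto

lemma nn_integral_encoder:
  assumes w: "w \<in> W" and F: "F \<in> borel_measurable (block_space L)"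
  shows "(\<integral>\<^sup>+x. F x \<partial>encoder w) = ennreal (1 / T 0 s) * (\<Sum>m\<in>{m\<in>msgs. secret m = w}. F (codeword m))"
proof -
  have "(\<integral>\<^sup>+x. F x \<partial>encoder w) = (\<Sum>m\<in>{m\<in>msgs. secret m = w}. F (codeword m)) / ennreal (T 0 s)"
    unfolding encoder_def using secret_class_nonempty[OF w]
    by (subst nn_integral_distr[OF measurable_codeword_pmf])
       (simp_all add: F nn_integral_pmf_of_set card_secret_class[OF w, symmetric] ennreal_of_nat_eq_real_of_nat)
  then show ?thesis
    using T_pos[OF order_refl, of 0] by (simp add: divide_ennreal_def inverse_ennreal mult.commute inverse_eq_divide)
qed

section \<open>The joint law of message and output\<close>

lemma measurable_pairing: "w \<in> W \<Longrightarrow> (\<lambda>y. (w, y)) \<in> block_space L \<rightarrow>\<^sub>M count_space W \<Otimes>\<^sub>M block_space L"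
  by (intro measurable_Pair) auto

lemma message_kernel:
  assumes w: "w \<in> W"
  shows "(encoder w \<bind> gauss_channel h r L) \<bind> (\<lambda>y. return (count_space W \<Otimes>\<^sub>M block_space L) (w, y))
    = distr (encoder w \<bind> gauss_channel h r L) (count_space W \<Otimes>\<^sub>M block_space L) (\<lambda>y. (w, y))"
    and "sets (encoder w \<bind> gauss_channel h r L) = sets (block_space L)"
    and "prob_space (encoder w \<bind> gauss_channel h r L)"
proof -
  have gk: "gauss_channel h r L \<in> block_space L \<rightarrow>\<^sub>M prob_algebra (block_space L)"
    using measurable_gauss_channel
    by (intro measurable_prob_algebraI) (auto simp: gauss_channel_def intro!: prob_space_PiM prob_space_normal_density)
  have se: "sets (encoder w) = sets (block_space L)" by (simp add: encoder_def)
  show 2: "sets (encoder w \<bind> gauss_channel h r L) = sets (block_space L)"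
    using measurable_gauss_channel[of h r L] codeword_in_space[of undefined]
    by (intro sets_bind_measurable) (auto simp: measurable_cong_sets[OF se refl] encoder_def)
  show "prob_space (encoder w \<bind> gauss_channel h r L)"
    using encoder_prob[OF w] gk
    by (intro prob_space_bind') auto
  then show "(encoder w \<bind> gauss_channel h r L) \<bind> (\<lambda>y. return (count_space W \<Otimes>\<^sub>M block_space L) (w, y))
    = distr (encoder w \<bind> gauss_channel h r L) (count_space W \<Otimes>\<^sub>M block_space L) (\<lambda>y. (w, y))"
    using measurable_pairing[OF w]
    by (intro bind_return_distr') (auto simp: measurable_cong_sets[OF 2 refl] prob_space.not_empty)
qed

lemma measurable_message_kernel:
  "(\<lambda>w. (encoder w \<bind> gauss_channel h r L) \<bind> (\<lambda>y. return (count_space W \<Otimes>\<^sub>M block_space L) (w, y)))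
    \<in> count_space W \<rightarrow>\<^sub>M prob_algebra (count_space W \<Otimes>\<^sub>M block_space L)"
proof -
  have "distr (encoder w \<bind> gauss_channel h r L) (count_space W \<Otimes>\<^sub>M block_space L) (\<lambda>y. (w, y))
    \<in> space (prob_algebra (count_space W \<Otimes>\<^sub>M block_space L))" if w: "w \<in> W" for w
    using message_kernel(2,3)[OF w] measurable_pairing[OF w]
    by (auto simp: space_prob_algebra intro!: prob_space.prob_space_distr simp: measurable_cong_sets[OF message_kernel(2)[OF w] refl])
  then show ?thesis by (auto simp: message_kernel(1))
qed

lemma msg_dist_prob: "msg_dist s L R \<in> space (prob_algebra (count_space W))"
  unfolding msg_dist_def space_prob_algebra
  using W_nonempty by (auto intro!: prob_space_uniform_measure simp: emeasure_count_space_finite card_gt_0_iff sets_uniform_measure)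

lemma J_prob_algebra: "J r \<in> space (prob_algebra (count_space W \<Otimes>\<^sub>M block_space L))"
proof -
  \<comment> \<open>Closure under bind is available for measurable families of measures; a constant
    family over \<open>unit\<close> yields the single measure.\<close>
  have "(\<lambda>_::unit. J r) \<in> count_space UNIV \<rightarrow>\<^sub>M prob_algebra (count_space W \<Otimes>\<^sub>M block_space L)"
    unfolding joint_law_def
    by (rule measurable_bind_prob_space[OF measurable_const[OF msg_dist_prob] measurable_message_kernel])
  from measurable_space[OF this, of "()"] show ?thesis by simp
qed

lemma prob_space_J: "prob_space (J r)"
  using J_prob_algebra[of r] by (simp add: space_prob_algebra)

lemma sets_J[simp, measurable_cong]: "sets (J r) = sets (count_space W \<Otimes>\<^sub>M block_space L)"
  using J_prob_algebra[of r] by (simp add: space_prob_algebra)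

text \<open>All secret classes have the same size, so a uniform secret followed by a uniform path in
  its class is a uniform path in \<open>msgs\<close>.\<close>

lemma nn_integral_J:
  assumes F: "F \<in> borel_measurable (count_space W \<Otimes>\<^sub>M block_space L)"
  shows "(\<integral>\<^sup>+z. F z \<partial>J r) = ennreal (1 / real (card msgs)) *
    (\<Sum>m\<in>msgs. \<integral>\<^sup>+y. ennreal (f r s m c y) * F (secret m, y) \<partial>outputs)"
proof -
  let ?I = "\<lambda>m. \<integral>\<^sup>+y. ennreal (f r s m c y) * F (secret m, y) \<partial>outputs"
  let ?K = "\<lambda>w. (encoder w \<bind> gauss_channel h r L) \<bind> (\<lambda>y. return (count_space W \<Otimes>\<^sub>M block_space L) (w, y))"
  have Fw: "(\<lambda>y. F (w, y)) \<in> borel_measurable (block_space L)" if "w \<in> W" for w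
    using measurable_compose[OF measurable_pairing[OF that] F] .
  have sm: "sets (msg_dist s L R) = sets (count_space W)" by (simp add: msg_dist_def)
  have inner: "(\<integral>\<^sup>+z. F z \<partial>?K w) = ennreal (1 / T 0 s) * (\<Sum>m\<in>{m\<in>msgs. secret m = w}. ?I m)" if w: "w \<in> W" for w
  proof -
    have se: "sets (encoder w) = sets (block_space L)" by (simp add: encoder_def)
    have "(\<integral>\<^sup>+z. F z \<partial>?K w) = (\<integral>\<^sup>+y. F (w, y) \<partial>(encoder w \<bind> gauss_channel h r L))"
      unfolding message_kernel(1)[OF w] using measurable_pairing[OF w] F
      by (intro nn_integral_distr) (auto simp: measurable_cong_sets[OF message_kernel(2)[OF w] refl])
    also have "\<dots> = (\<integral>\<^sup>+x. (\<integral>\<^sup>+y. F (w, y) \<partial>gauss_channel h r L x) \<partial>encoder w)"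
      using measurable_gauss_channel
      by (intro nn_integral_bind[OF Fw[OF w]]) (simp add: measurable_cong_sets[OF se refl])
    also have "\<dots> = ennreal (1 / T 0 s) * (\<Sum>m\<in>{m\<in>msgs. secret m = w}. \<integral>\<^sup>+y. F (w, y) \<partial>gauss_channel h r L (codeword m))"
      by (intro nn_integral_encoder[OF w] nn_integral_measurable_subprob_algebra2[where N="block_space L"] measurable_gauss_channel measurable_compose[OF measurable_snd Fw[OF w], folded case_prod_beta'])
         (simp add: case_prod_beta' measurable_compose[OF measurable_snd Fw[OF w]])
    also have "(\<Sum>m\<in>{m\<in>msgs. secret m = w}. \<integral>\<^sup>+y. F (w, y) \<partial>gauss_channel h r L (codeword m)) = (\<Sum>m\<in>{m\<in>msgs. secret m = w}. ?I m)"
    proof (rule sum.cong[OF refl])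
      fix m assume m: "m \<in> {m\<in>msgs. secret m = w}"
      then have "(\<lambda>y. ennreal (f r s m c y)) \<in> borel_measurable (outputs)" "(\<lambda>y. F (w, y)) \<in> borel_measurable (outputs)"
        using measurable_compose[OF measurable_f_fixed[of m s r] measurable_ennreal] Fw[OF w] by (simp_all add: measurable_cong_sets[OF sets_leb_block refl])
      with m show "(\<integral>\<^sup>+y. F (w, y) \<partial>gauss_channel h r L (codeword m)) = ?I m"
        unfolding gauss_channel_codeword by (subst nn_integral_density) auto
    qed
    finally show ?thesis .
  qed
  have "(\<integral>\<^sup>+z. F z \<partial>J r) = (\<integral>\<^sup>+w. (\<integral>\<^sup>+z. F z \<partial>?K w) \<partial>msg_dist s L R)"
    unfolding joint_law_def using measurable_prob_algebraD[OF measurable_message_kernel]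
    by (intro nn_integral_bind[OF F]) (simp only: measurable_cong_sets[OF sm refl])
  also have "\<dots> = (\<Sum>w\<in>W. \<integral>\<^sup>+z. F z \<partial>?K w) / ennreal (real (card W))"
    unfolding msg_dist_def
    by (subst nn_integral_uniform_measure) (auto simp: nn_integral_count_space_finite emeasure_count_space_finite ennreal_of_nat_eq_real_of_nat intro!: arg_cong2[where f="(/)"] sum.cong)
  also have "\<dots> = (\<Sum>w\<in>W. ennreal (1 / T 0 s) * (\<Sum>m\<in>{m\<in>msgs. secret m = w}. ?I m)) / ennreal (real (card W))"
    by (simp add: inner)
  also have "\<dots> = (ennreal (1 / T 0 s) * (\<Sum>w\<in>W. \<Sum>m\<in>{m\<in>msgs. secret m = w}. ?I m)) / ennreal (real (card W))"
    by (simp add: sum_distrib_left)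
  also have "(\<Sum>w\<in>W. \<Sum>m\<in>{m\<in>msgs. secret m = w}. ?I m) = (\<Sum>m\<in>msgs. ?I m)"
    using secret_in_W by (intro sum.group) auto
  also have "ennreal (1 / T 0 s) * (\<Sum>m\<in>msgs. ?I m) / ennreal (real (card W)) = ennreal (1 / real (card msgs)) * (\<Sum>m\<in>msgs. ?I m)"
  proof -
    have W0: "0 < real (card W)" using W_nonempty by (simp add: card_gt_0_iff)
    have "ennreal (1 / T 0 s) * (\<Sum>m\<in>msgs. ?I m) / ennreal (real (card W)) = ennreal (1 / T 0 s) * ennreal (1 / real (card W)) * (\<Sum>m\<in>msgs. ?I m)"
      using W0 by (simp add: divide_ennreal_def inverse_ennreal inverse_eq_divide ac_simps)
    also have "ennreal (1 / T 0 s) * ennreal (1 / real (card W)) = ennreal (1 / real (card msgs))"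
      using T_pos[OF order_refl, of 0] unfolding card_msgs by (subst ennreal_mult'[symmetric]) (auto simp: mult.commute)
    finally show ?thesis .
  qed
  finally show ?thesis .
qed

lemma decoding_error_probability:
  assumes j: "j \<le> s" and D: "D \<in> block_space L \<rightarrow>\<^sub>M count_space UNIV" and i: "i \<in> {1..s}"
  shows "ennreal (measure (J j) {z \<in> space (J j). D (snd z) i \<noteq> fst z i})
    = ennreal (1 / real (card msgs)) * (\<Sum>m\<in>msgs. \<integral>\<^sup>+y. ennreal (f j s m c y) * indicator {y. D y i \<noteq> fst (m i)} y \<partial>outputs)"
proof -
  interpret prob_space "J j" by (rule prob_space_J)
  let ?E = "{z \<in> space (J j). D (snd z) i \<noteq> fst z i}"
  have sJ: "space (J j) = W \<times> space (block_space L)"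
    using sets_eq_imp_space_eq[OF sets_J] by (simp add: space_pair_measure)
  have [measurable]: "D \<in> block_space L \<rightarrow>\<^sub>M count_space UNIV" by (rule D)
  have m1: "(\<lambda>z. D (snd z) i) \<in> count_space W \<Otimes>\<^sub>M block_space L \<rightarrow>\<^sub>M count_space UNIV"
    by (rule measurable_compose[OF measurable_compose[OF measurable_snd D]]) simp
  have m2: "(\<lambda>z. fst z i) \<in> count_space W \<Otimes>\<^sub>M block_space L \<rightarrow>\<^sub>M count_space UNIV"
    by (rule measurable_compose[OF measurable_fst]) simp
  have E: "?E \<in> sets (J j)"
  proof -
    \<comment> \<open>Two discrete variables differ on a countable union over the values of one of
      them.\<close>
    have neq: "{z \<in> space N. u z \<noteq> v z} \<in> sets N"
      if uv: "u \<in> N \<rightarrow>\<^sub>M count_space UNIV" "v \<in> N \<rightarrow>\<^sub>M count_space UNIV"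
      for N :: "((nat \<Rightarrow> nat) \<times> (nat \<Rightarrow> real)) measure" and u v :: "_ \<Rightarrow> nat"
    proof -
      have "{z \<in> space N. u z \<noteq> v z} = (\<Union>n. (u -` {n} \<inter> space N) \<inter> (v -` (- {n}) \<inter> space N))" by auto
      also have "\<dots> \<in> sets N"
      proof -
        have "(u -` {n} \<inter> space N) \<inter> (v -` (- {n}) \<inter> space N) \<in> sets N" for n
          by (rule sets.Int[OF measurable_sets[OF uv(1)] measurable_sets[OF uv(2)]]) auto
        then show ?thesis by (intro sets.countable_UN) auto
      qed
      finally show ?thesis .
    qed
    show ?thesis using m1 m2 by (intro neq) (simp_all only: measurable_cong_sets[OF sets_J refl])
  qed
  have "ennreal (measure (J j) ?E) = emeasure (J j) ?E" by (simp add: emeasure_eq_measure)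
  also have "\<dots> = (\<integral>\<^sup>+z. indicator ?E z \<partial>J j)" using E by simp
  also have "\<dots> = ennreal (1 / real (card msgs)) *
    (\<Sum>m\<in>msgs. \<integral>\<^sup>+y. ennreal (f j s m c y) * indicator ?E (secret m, y) \<partial>outputs)"
    using E by (intro nn_integral_J) simp
  also have "(\<Sum>m\<in>msgs. \<integral>\<^sup>+y. ennreal (f j s m c y) * indicator ?E (secret m, y) \<partial>outputs)
    = (\<Sum>m\<in>msgs. \<integral>\<^sup>+y. ennreal (f j s m c y) * indicator {y. D y i \<noteq> fst (m i)} y \<partial>outputs)"
    using i secret_in_W by (intro sum.cong refl nn_integral_cong) (auto simp: sJ secret_def indicator_def)
  finally show ?thesis .
qed

lemma power_sum:
  "(\<Sum>w\<in>W. \<integral>\<^sup>+x. ennreal (\<Sum>t<L. (x t)\<^sup>2) \<partial>encoder w)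
    = ennreal (1 / T 0 s) * ennreal (\<Sum>m\<in>msgs. \<Sum>t<L. (codeword m t)\<^sup>2)"
proof -
  have m: "(\<lambda>x. ennreal (\<Sum>t<L. (x t)\<^sup>2)) \<in> borel_measurable (block_space L)"
    by (intro measurable_compose[OF _ measurable_ennreal] borel_measurable_sum borel_measurable_power measurable_block_component) auto
  have "(\<Sum>w\<in>W. \<integral>\<^sup>+x. ennreal (\<Sum>t<L. (x t)\<^sup>2) \<partial>encoder w)
    = ennreal (1 / T 0 s) * (\<Sum>w\<in>W. \<Sum>m\<in>{m\<in>msgs. secret m = w}. ennreal (\<Sum>t<L. (codeword m t)\<^sup>2))"
    by (simp add: nn_integral_encoder[OF _ m] sum_distrib_left)
  also have "(\<Sum>w\<in>W. \<Sum>m\<in>{m\<in>msgs. secret m = w}. ennreal (\<Sum>t<L. (codeword m t)\<^sup>2)) = (\<Sum>m\<in>msgs. ennreal (\<Sum>t<L. (codeword m t)\<^sup>2))"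
    using secret_in_W by (intro sum.group) auto
  also have "\<dots> = ennreal (\<Sum>m\<in>msgs. \<Sum>t<L. (codeword m t)\<^sup>2)"
    by (intro sum_ennreal sum_nonneg) auto
  finally show ?thesis .
qed

text \<open>The transmitted power is read off from the second moment of the output of receiver 0.\<close>

lemma codeword_power_le:
  assumes dev: "ennreal (1 / real (card msgs)) * (\<Sum>m\<in>msgs. \<integral>\<^sup>+y. ennreal (f 0 s m c y) * ennreal \<bar>S 0 0 m c y\<bar> \<partial>outputs) \<le> ennreal d"
    and d: "0 \<le> d"
  shows "(\<Sum>m\<in>msgs. \<Sum>t<L. (codeword m t)\<^sup>2) \<le> real (card msgs) * ((vr 0 0 * (real L + d) - real L) / h 0)"
proof -
  let ?v = "vr 0 0" and ?N = "real (card msgs)"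
  have v: "0 < ?v" and h0: "0 < h 0" by (auto intro: vr_pos h_pos)
  have N: "0 < ?N" by (rule card_msgs_pos)
  \<comment> \<open>With no layer known the mean is 0, so this residual is the received energy,
    normalised and centred.\<close>
  have S0: "S 0 0 m c y = (\<Sum>t<L. (y t)\<^sup>2) / ?v - real L" for m y
    by (simp add: S_def mean_def sum_subtractf sum_divide_distrib)
  have le: "ennreal (real L + h 0 * (\<Sum>t<L. (codeword m t)\<^sup>2)) \<le> ennreal ?v * ((\<integral>\<^sup>+y. ennreal (f 0 s m c y) * ennreal \<bar>S 0 0 m c y\<bar> \<partial>outputs) + ennreal (real L))"
    if m: "m \<in> msgs" for m
  proof -
    have ms: "(\<lambda>y. S 0 0 m c y) \<in> borel_measurable (outputs)" and mf: "(\<lambda>y. f 0 s m c y) \<in> borel_measurable (outputs)"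
      using m c by (auto intro!: measurable_S measurable_f)
    have "ennreal (real L + h 0 * (\<Sum>t<L. (codeword m t)\<^sup>2)) = ennreal (real L + (\<Sum>t<L. (mean 0 s m c t)\<^sup>2))"
    proof -
      have "(mean 0 s m c t)\<^sup>2 = h 0 * (codeword m t)\<^sup>2" if "t \<in> {..<L}" for t
        using h0 that by (simp add: mean_def codeword_def power_mult_distrib)
      then have "(\<Sum>t<L. (mean 0 s m c t)\<^sup>2) = h 0 * (\<Sum>t<L. (codeword m t)\<^sup>2)"
        by (simp add: sum_distrib_left)
      then show ?thesis by simp
    qed
    \<comment> \<open>At level \<open>s\<close> the variance is 1, so the noise contributes exactly
      \<open>L\<close> to the mean received energy.\<close>
    also have "\<dots> = (\<integral>\<^sup>+y. ennreal (f 0 s m c y) * ennreal (\<Sum>t<L. (y t)\<^sup>2) \<partial>outputs)"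
      using nn_integral_block_density_norm_square[of L "mean 0 s m c"] by (simp add: f_def vr_def)
    also have "\<dots> \<le> (\<integral>\<^sup>+y. ennreal ?v * (ennreal (f 0 s m c y) * ennreal \<bar>S 0 0 m c y\<bar> + ennreal (real L) * ennreal (f 0 s m c y)) \<partial>outputs)"
    proof (rule nn_integral_mono)
      fix y
      have "(\<Sum>t<L. (y t)\<^sup>2) = ?v * (S 0 0 m c y + real L)" using v by (simp add: S0 field_simps)
      also have "\<dots> \<le> ?v * (\<bar>S 0 0 m c y\<bar> + real L)" using v by (intro mult_left_mono) auto
      finally have "f 0 s m c y * (\<Sum>t<L. (y t)\<^sup>2) \<le> f 0 s m c y * (?v * (\<bar>S 0 0 m c y\<bar> + real L))"
        by (intro mult_left_mono) auto
      also have "\<dots> = ?v * (f 0 s m c y * \<bar>S 0 0 m c y\<bar> + real L * f 0 s m c y)" by (simp add: algebra_simps)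
      finally have "ennreal (f 0 s m c y * (\<Sum>t<L. (y t)\<^sup>2)) \<le> ennreal (?v * (f 0 s m c y * \<bar>S 0 0 m c y\<bar> + real L * f 0 s m c y))"
        by (rule ennreal_leI)
      then show "ennreal (f 0 s m c y) * ennreal (\<Sum>t<L. (y t)\<^sup>2) \<le> ennreal ?v * (ennreal (f 0 s m c y) * ennreal \<bar>S 0 0 m c y\<bar> + ennreal (real L) * ennreal (f 0 s m c y))"
        using v by (simp add: ennreal_mult' ennreal_plus)
    qed
    also have "\<dots> = ennreal ?v * ((\<integral>\<^sup>+y. ennreal (f 0 s m c y) * ennreal \<bar>S 0 0 m c y\<bar> \<partial>outputs) + ennreal (real L) * (\<integral>\<^sup>+y. ennreal (f 0 s m c y) \<partial>outputs))"
      using ms mf by (simp add: nn_integral_cmult nn_integral_add)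
    finally show ?thesis by (simp add: nn_integral_f)
  qed
  let ?D = "\<Sum>m\<in>msgs. \<integral>\<^sup>+y. ennreal (f 0 s m c y) * ennreal \<bar>S 0 0 m c y\<bar> \<partial>outputs"
  have D: "?D \<le> ennreal (?N * d)"
  proof -
    have "?D = ennreal ?N * (ennreal (1 / ?N) * ?D)"
      using N by (simp add: mult.assoc[symmetric] ennreal_mult'[symmetric])
    also have "\<dots> \<le> ennreal ?N * ennreal d" by (rule mult_left_mono[OF dev]) simp
    finally show ?thesis using N d by (simp add: ennreal_mult')
  qed
  have "ennreal (?N * real L + h 0 * (\<Sum>m\<in>msgs. \<Sum>t<L. (codeword m t)\<^sup>2))
    = ennreal (\<Sum>m\<in>msgs. real L + h 0 * (\<Sum>t<L. (codeword m t)\<^sup>2))"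
    by (simp add: sum.distrib sum_distrib_left)
  also have "\<dots> = (\<Sum>m\<in>msgs. ennreal (real L + h 0 * (\<Sum>t<L. (codeword m t)\<^sup>2)))"
    using h0 by (intro sum_ennreal[symmetric]) (auto intro!: add_nonneg_nonneg mult_nonneg_nonneg sum_nonneg)
  also have "\<dots> \<le> (\<Sum>m\<in>msgs. ennreal ?v * ((\<integral>\<^sup>+y. ennreal (f 0 s m c y) * ennreal \<bar>S 0 0 m c y\<bar> \<partial>outputs) + ennreal (real L)))"
    by (intro sum_mono le)
  also have "\<dots> = ennreal ?v * (?D + ennreal (?N * real L))"
    by (simp add: sum_distrib_left[symmetric] sum.distrib ennreal_mult' ennreal_of_nat_eq_real_of_nat)
  also have "\<dots> \<le> ennreal ?v * (ennreal (?N * d) + ennreal (?N * real L))"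
    using D by (intro mult_left_mono add_right_mono) auto
  also have "\<dots> = ennreal (?v * (?N * d + ?N * real L))"
    using v N d by (simp add: ennreal_mult' ennreal_plus)
  finally have "?N * real L + h 0 * (\<Sum>m\<in>msgs. \<Sum>t<L. (codeword m t)\<^sup>2) \<le> ?v * (?N * d + ?N * real L)"
    using v N d by (subst (asm) ennreal_le_iff) auto
  then have "h 0 * (\<Sum>m\<in>msgs. \<Sum>t<L. (codeword m t)\<^sup>2) \<le> h 0 * (?N * ((?v * (real L + d) - real L) / h 0))"
  proof -
    assume le: "?N * real L + h 0 * (\<Sum>m\<in>msgs. \<Sum>t<L. (codeword m t)\<^sup>2) \<le> ?v * (?N * d + ?N * real L)"
    have "h 0 * (?N * ((?v * (real L + d) - real L) / h 0)) = ?N * (?v * (real L + d) - real L)" using h0 by simp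
    with le show ?thesis by (simp add: algebra_simps)
  qed
  then show ?thesis using h0 by (simp only: mult_le_cancel_left_pos)
qed

end

section \<open>Mutual information of the code\<close>

context wiretap_code
begin

definition cloud where "cloud i m = restrict m {1..i}" for m :: "nat \<Rightarrow> nat \<times> nat"

definition hidden where "hidden i m = restrict (secret m) {i+1..s}"

lemma measurable_section:
  assumes "F \<in> borel_measurable codes_outputs"
  shows "(\<lambda>y. F (c, y)) \<in> borel_measurable (outputs)"
  using c by (intro measurable_compose[OF measurable_Pair assms]) auto

lemma hidden_image: "(\<lambda>w. restrict w {i+1..s}) ` W = hidden i ` msgs"
  unfolding W_secret_image hidden_def image_image ..

lemma cloud_hidden_class:
  assumes m: "m \<in> msgs"
  shows "{m'\<in>msgs. cloud i m' = cloud i m \<and> hidden i m' = hidden i m} = fibre i m"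
proof -
  have "hidden i m' = hidden i m \<longleftrightarrow> (\<forall>l\<in>{i+1..s}. fst (m' l) = fst (m l))" for m'
    unfolding hidden_def secret_def by (auto simp: fun_eq_iff restrict_def)
  then show ?thesis by (auto simp: fibre_def cloud_def)
qed

text \<open>Splicing the first \<open>i\<close> layers of one message with the rest of another shows
  that every cloud meets every secret part; each intersection is then a fibre.\<close>

lemma card_cloud_hidden_class:
  assumes a: "a \<in> cloud i ` msgs" and b: "b \<in> hidden i ` msgs"
  shows "real (card {m\<in>msgs. cloud i m = a \<and> hidden i m = b}) = T i s"
proof -
  obtain m1 m2 where m: "m1 \<in> msgs" "a = cloud i m1" "m2 \<in> msgs" "b = hidden i m2" using a b by auto
  define m where "m k = (if k \<le> i then m1 k else m2 k)" for k
  have mm: "m \<in> msgs"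
    unfolding msgs_def
  proof (rule PiE_I)
    fix k assume k: "k \<in> {1..s}"
    show "m k \<in> {1..A k} \<times> {..<M k}"
      using PiE_mem[OF m(1)[unfolded msgs_def] k] PiE_mem[OF m(3)[unfolded msgs_def] k] by (simp add: m_def)
  next
    fix k assume k: "k \<notin> {1..s}"
    show "m k = undefined"
      using PiE_arb[OF m(1)[unfolded msgs_def] k] PiE_arb[OF m(3)[unfolded msgs_def] k] by (simp add: m_def)
  qed
  have "cloud i m = a" unfolding m(2) cloud_def m_def by (auto simp: fun_eq_iff restrict_def)
  moreover have "hidden i m = b" unfolding m(4) hidden_def secret_def m_def by (auto simp: fun_eq_iff restrict_def)
  ultimately show ?thesis
    using cloud_hidden_class[OF mm, of i] card_fibre[OF mm, of i] by simp
qed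

lemma f_cloud: "f r i (cloud i m) c y = f r i m c y"
  by (rule f_cong_msg) (simp add: cloud_def)

text \<open>The information is the integral of a pointwise divergence of mixtures. Its logarithmic
  part averages to at most \<open>B\<close> by \<open>leak\<close>, its reference part to 1, and
  \<open>ln 2\<close> converts to bits.\<close>

lemma mutual_information_le:
  assumes i: "i \<le> s" and B: "0 \<le> B"
    and leak: "ennreal (1 / real (card msgs)) * (\<Sum>m\<in>msgs. \<integral>\<^sup>+y. ennreal (f i s m c y) * ennreal (ln (1 + leak_ratio i m c y)) \<partial>outputs) \<le> ennreal B"
  shows "prob_space.mutual_information (J i) 2 (count_space ((\<lambda>w. restrict w {i+1..s}) ` W)) (block_space L)
      (\<lambda>p. restrict (fst p) {i+1..s}) snd \<le> (1 + B) / ln 2"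
proof -
  interpret P: prob_space "J i" by (rule prob_space_J)
  interpret information_space "J i" 2 by standard simp
  interpret Lb: sigma_finite_measure "outputs" by (rule sigma_finite_leb_block)
  let ?N = "real (card msgs)"
  have N: "0 < ?N" by (rule card_msgs_pos)
  define Bs where "Bs = hidden i ` msgs"
  have finB: "finite Bs" by (simp add: Bs_def)
  let ?S = "count_space Bs" and ?X = "\<lambda>p::(nat \<Rightarrow> nat) \<times> (nat \<Rightarrow> real). restrict (fst p) {i+1..s}"
  let ?ST = "?S \<Otimes>\<^sub>M outputs"
  define g where "g y m = f i s m c y" for y m
  have gpos: "0 < g y m" for y m unfolding g_def by (rule f_pos[OF i])
  have gm: "(\<lambda>y. g y m) \<in> borel_measurable (outputs)" if "m \<in> msgs" for m
    unfolding g_def using that by (intro measurable_f_fixed) auto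
  \<comment> \<open>Joint density and marginals over counting and Lebesgue measure;
    \<open>Px\<close> arises because every \<open>g y m\<close> integrates to 1 in
    \<open>y\<close>.\<close>
  define Pxy where "Pxy z = sum (g (snd z)) {m\<in>msgs. hidden i m = fst z} / ?N" for z
  define Px where "Px b = real (card {m\<in>msgs. hidden i m = b}) / ?N" for b
  define Py where "Py y = sum (g y) msgs / ?N" for y
  have nn: "0 \<le> Pxy z" "0 \<le> Px b" "0 \<le> Py y" for z b y
    unfolding Pxy_def Px_def Py_def using gpos by (auto intro!: divide_nonneg_nonneg sum_nonneg simp: less_imp_le)
  have X: "?X \<in> J i \<rightarrow>\<^sub>M ?S"
  proof -
    have "(\<lambda>w. restrict w {i+1..s}) \<in> count_space W \<rightarrow>\<^sub>M ?S"
      by (auto simp: Bs_def hidden_image[symmetric])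
    from measurable_compose[OF measurable_fst this] show ?thesis
      by (simp add: measurable_cong_sets[OF sets_J refl])
  qed
  have Y: "snd \<in> J i \<rightarrow>\<^sub>M outputs"
    using measurable_snd[of "count_space W" "block_space L"]
    by (simp add: measurable_cong_sets[OF sets_J refl] measurable_cong_sets[OF refl sets_leb_block])
  have Pxy_m: "Pxy \<in> borel_measurable ?ST"
    by (rule measurable_pair_measure_countable1)
       (auto simp: finB countable_finite Pxy_def intro!: borel_measurable_divide borel_measurable_sum gm)
  have Py_m: "Py \<in> borel_measurable (outputs)"
    unfolding Py_def by (auto intro!: borel_measurable_divide borel_measurable_sum gm)
  have int_ST: "(\<integral>\<^sup>+z. F z \<partial>?ST) = (\<Sum>b\<in>Bs. \<integral>\<^sup>+y. F (b, y) \<partial>outputs)" if "F \<in> borel_measurable ?ST" for F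
    using Lb.nn_integral_fst[OF that] finB by (simp add: nn_integral_count_space_finite)
  have sub: "hidden i ` msgs \<subseteq> Bs" by (simp add: Bs_def)
  have dXY: "distributed (J i) ?ST (\<lambda>z. (?X z, snd z)) (\<lambda>z. ennreal (Pxy z))"
    unfolding distributed_def
  proof (intro conjI)
    show XY: "(\<lambda>z. (?X z, snd z)) \<in> J i \<rightarrow>\<^sub>M ?ST" by (intro measurable_Pair X Y)
    show Pm: "(\<lambda>z. ennreal (Pxy z)) \<in> borel_measurable ?ST" using Pxy_m by simp
    show "distr (J i) ?ST (\<lambda>z. (?X z, snd z)) = density ?ST (\<lambda>z. ennreal (Pxy z))"
    proof (rule measure_eqI)
      fix E assume "E \<in> sets (distr (J i) ?ST (\<lambda>z. (?X z, snd z)))"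
      then have E: "E \<in> sets ?ST" by simp
      then have Em: "(indicator E :: _ \<Rightarrow> ennreal) \<in> borel_measurable ?ST" by simp
      have Eb: "(\<lambda>y. indicator E (b, y) :: ennreal) \<in> borel_measurable (outputs)" if "b \<in> Bs" for b
        using that by (intro measurable_compose[OF _ Em] measurable_Pair) auto
      have "emeasure (distr (J i) ?ST (\<lambda>z. (?X z, snd z))) E = (\<integral>\<^sup>+z. indicator E z \<partial>distr (J i) ?ST (\<lambda>z. (?X z, snd z)))"
        using E by simp
      also have "\<dots> = (\<integral>\<^sup>+z. indicator E (?X z, snd z) \<partial>J i)"
        using XY Em by (subst nn_integral_distr) auto
      also have "\<dots> = ennreal (1 / ?N) * (\<Sum>m\<in>msgs. \<integral>\<^sup>+y. ennreal (f i s m c y) * indicator E (hidden i m, y) \<partial>outputs)"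
        using measurable_compose[OF XY Em] by (subst nn_integral_J) (auto simp: hidden_def measurable_cong_sets[OF sets_J refl])
      also have "\<dots> = (\<Sum>m\<in>msgs. \<integral>\<^sup>+y. ennreal (1 / ?N) * (ennreal (g y m) * indicator E (hidden i m, y)) \<partial>outputs)"
        unfolding sum_distrib_left g_def
      proof (rule sum.cong[OF refl])
        fix m assume m: "m \<in> msgs"
        then have "(\<lambda>y. ennreal (f i s m c y) * indicator E (hidden i m, y)) \<in> borel_measurable (outputs)"
          using Eb sub by (intro borel_measurable_times_ennreal measurable_compose[OF measurable_f_fixed measurable_ennreal]) auto
        then show "ennreal (1 / ?N) * (\<integral>\<^sup>+y. ennreal (f i s m c y) * indicator E (hidden i m, y) \<partial>outputs)
          = (\<integral>\<^sup>+y. ennreal (1 / ?N) * (ennreal (f i s m c y) * indicator E (hidden i m, y)) \<partial>outputs)"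
          by (rule nn_integral_cmult[symmetric])
      qed
      also have "\<dots> = (\<Sum>b\<in>Bs. \<Sum>m\<in>{m\<in>msgs. hidden i m = b}. \<integral>\<^sup>+y. ennreal (1 / ?N) * (ennreal (g y m) * indicator E (hidden i m, y)) \<partial>outputs)"
        using finB sub by (intro sum.group[symmetric]) auto
      also have "\<dots> = (\<Sum>b\<in>Bs. \<integral>\<^sup>+y. ennreal (Pxy (b, y)) * indicator E (b, y) \<partial>outputs)"
      proof (rule sum.cong[OF refl])
        fix b assume b: "b \<in> Bs"
        have "(\<Sum>m\<in>{m\<in>msgs. hidden i m = b}. \<integral>\<^sup>+y. ennreal (1 / ?N) * (ennreal (g y m) * indicator E (hidden i m, y)) \<partial>outputs)
          = (\<integral>\<^sup>+y. (\<Sum>m\<in>{m\<in>msgs. hidden i m = b}. ennreal (1 / ?N) * (ennreal (g y m) * indicator E (hidden i m, y))) \<partial>outputs)"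
          using Eb b by (intro nn_integral_sum[symmetric] borel_measurable_times_ennreal measurable_compose[OF gm measurable_ennreal]) auto
        also have "\<dots> = (\<integral>\<^sup>+y. ennreal (Pxy (b, y)) * indicator E (b, y) \<partial>outputs)"
        proof (rule nn_integral_cong)
          fix y
          have "(\<Sum>m\<in>{m\<in>msgs. hidden i m = b}. ennreal (1 / ?N) * (ennreal (g y m) * indicator E (hidden i m, y)))
            = ennreal (1 / ?N) * (\<Sum>m\<in>{m\<in>msgs. hidden i m = b}. ennreal (g y m)) * indicator E (b, y)"
            by (simp add: sum_distrib_left sum_distrib_right mult.assoc)
          also have "(\<Sum>m\<in>{m\<in>msgs. hidden i m = b}. ennreal (g y m)) = ennreal (sum (g y) {m\<in>msgs. hidden i m = b})"
            using gpos by (intro sum_ennreal) (auto simp: less_imp_le)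
          also have "ennreal (1 / ?N) * ennreal (sum (g y) {m\<in>msgs. hidden i m = b}) = ennreal (Pxy (b, y))"
            unfolding Pxy_def by (subst ennreal_mult'[symmetric]) auto
          finally show "(\<Sum>m\<in>{m\<in>msgs. hidden i m = b}. ennreal (1 / ?N) * (ennreal (g y m) * indicator E (hidden i m, y)))
            = ennreal (Pxy (b, y)) * indicator E (b, y)" .
        qed
        finally show "(\<Sum>m\<in>{m\<in>msgs. hidden i m = b}. \<integral>\<^sup>+y. ennreal (1 / ?N) * (ennreal (g y m) * indicator E (hidden i m, y)) \<partial>outputs)
          = (\<integral>\<^sup>+y. ennreal (Pxy (b, y)) * indicator E (b, y) \<partial>outputs)" .
      qed
      also have "\<dots> = (\<integral>\<^sup>+z. ennreal (Pxy z) * indicator E z \<partial>?ST)"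
        using Pm Em by (intro int_ST[symmetric]) simp
      also have "\<dots> = emeasure (density ?ST (\<lambda>z. ennreal (Pxy z))) E"
        using Pm E by (intro emeasure_density[symmetric])
      finally show "emeasure (distr (J i) ?ST (\<lambda>z. (?X z, snd z))) E = emeasure (density ?ST (\<lambda>z. ennreal (Pxy z))) E" .
    qed simp
  qed
  have P_eq: "ennreal (1 / ?N) * (\<Sum>m\<in>X. ennreal (g y m)) = ennreal (sum (g y) X / ?N)" for X y
  proof -
    have "(\<Sum>m\<in>X. ennreal (g y m)) = ennreal (sum (g y) X)"
      using gpos by (intro sum_ennreal) (auto simp: less_imp_le)
    then show ?thesis by (simp add: ennreal_mult'[symmetric])
  qed
  have sf: "sigma_finite_measure ?S" by (rule sigma_finite_measure_count_space_finite[OF finB])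
  have "(\<integral>\<^sup>+y. ennreal (Pxy (b, y)) \<partial>outputs) = ennreal (Px b)" for b
  proof -
    have "(\<integral>\<^sup>+y. ennreal (Pxy (b, y)) \<partial>outputs) = (\<integral>\<^sup>+y. ennreal (1 / ?N) * (\<Sum>m\<in>{m\<in>msgs. hidden i m = b}. ennreal (g y m)) \<partial>outputs)"
      unfolding P_eq Pxy_def by simp
    also have "\<dots> = ennreal (1 / ?N) * (\<Sum>m\<in>{m\<in>msgs. hidden i m = b}. \<integral>\<^sup>+y. ennreal (g y m) \<partial>outputs)"
      by (subst nn_integral_cmult)
         (auto intro!: borel_measurable_sum measurable_compose[OF gm measurable_ennreal] nn_integral_sum arg_cong2[where f="(*)"])
    also have "\<dots> = ennreal (Px b)"
      by (simp add: g_def nn_integral_f[OF i] Px_def ennreal_of_nat_eq_real_of_nat ennreal_mult'[symmetric])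
    finally show ?thesis .
  qed
  then have dX: "distributed (J i) ?S ?X (\<lambda>b. ennreal (Px b))"
    using P.distr_marginal1[OF sf sigma_finite_leb_block dXY] by simp
  have "(\<integral>\<^sup>+b. ennreal (Pxy (b, y)) \<partial>?S) = ennreal (Py y)" for y
  proof -
    have "(\<integral>\<^sup>+b. ennreal (Pxy (b, y)) \<partial>?S) = (\<Sum>b\<in>Bs. ennreal (1 / ?N) * (\<Sum>m\<in>{m\<in>msgs. hidden i m = b}. ennreal (g y m)))"
      unfolding P_eq Pxy_def using finB by (simp add: nn_integral_count_space_finite)
    also have "\<dots> = ennreal (1 / ?N) * (\<Sum>m\<in>msgs. ennreal (g y m))"
      unfolding sum_distrib_left[symmetric] using finB sub by (subst sum.group) auto
    finally show ?thesis unfolding P_eq Py_def .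
  qed
  then have dY: "distributed (J i) (outputs) snd (\<lambda>y. ennreal (Py y))"
    using P.distr_marginal2[OF sf sigma_finite_leb_block dXY] by simp
  \<comment> \<open>From here on \<open>h\<close> is the integrand of the information and shadows
    the channel gains.\<close>
  define h where "h z = Pxy z * log 2 (Pxy z / (Px (fst z) * Py (snd z)))" for z
  have hm: "h \<in> borel_measurable ?ST"
  proof -
    have "(\<lambda>z. Px (fst z)) \<in> borel_measurable ?ST" by (intro measurable_compose[OF measurable_fst]) simp
    moreover have "(\<lambda>z. Py (snd z)) \<in> borel_measurable ?ST" by (intro measurable_compose[OF measurable_snd Py_m])
    ultimately show ?thesis using Pxy_m unfolding h_def by (intro borel_measurable_times borel_measurable_log borel_measurable_divide) auto
  qed
  \<comment> \<open>The information sees its target spaces through their measurable sets, so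
    \<open>block_space\<close> may be exchanged for \<open>leb_block\<close>, over which the
    densities are taken.\<close>
  have "P.mutual_information 2 (count_space ((\<lambda>w. restrict w {i+1..s}) ` W)) (block_space L) ?X snd = P.mutual_information 2 ?S (outputs) ?X snd"
    unfolding P.mutual_information_def Bs_def hidden_image
    by (intro arg_cong2[where f="KL_divergence 2"] arg_cong2[where f="(\<Otimes>\<^sub>M)"] distr_cong refl sets_pair_measure_cong) auto
  also have "\<dots> = integral\<^sup>L ?ST h"
    unfolding h_def
    by (rule mutual_information_distr[OF sigma_finite_measure_count_space_finite[OF finB] sigma_finite_leb_block dX _ dY _ dXY]) (auto simp: nn)
  also have "\<dots> \<le> (1 + B) / ln 2"
  proof (rule integral_le_nn_integral)
    let ?K = "1 / (?N * ln 2)"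
    have K: "0 \<le> ?K" using N by simp
    let ?r = "\<lambda>y m. ln (1 + leak_ratio i m c y)"
    let ?w = "\<lambda>y m. real (card (hidden i ` msgs)) * T i s * f i i m c y / sum (g y) {m'\<in>msgs. cloud i m' = cloud i m}"
    define U where "U m y = ennreal ?K * (ennreal (g y m) * ennreal (?r y m)) + ennreal ?K * ennreal (g y m * ?w y m)" for m y
    have Tp: "0 < T i s" by (rule T_pos) simp
    have r0: "0 \<le> ?r y m" for y m by (simp add: leak_ratio_nonneg)
    have w0: "0 \<le> ?w y m" for y m
      using Tp gpos by (intro divide_nonneg_nonneg mult_nonneg_nonneg sum_nonneg f_nonneg) (auto simp: less_imp_le)
    have rm: "(\<lambda>y. ennreal (g y m) * ennreal (?r y m)) \<in> borel_measurable (outputs)" if m: "m \<in> msgs" for m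
    proof -
      have "(\<lambda>y. leak_ratio i m c y) \<in> borel_measurable (outputs)"
        using measurable_section[OF measurable_leak_ratio[OF m i]] by simp
      then show ?thesis using gm[OF m] by measurable
    qed
    have wm: "(\<lambda>y. ennreal (g y m * ?w y m)) \<in> borel_measurable (outputs)" if m: "m \<in> msgs" for m
    proof -
      have "(\<lambda>y. sum (g y) {m'\<in>msgs. cloud i m' = cloud i m}) \<in> borel_measurable (outputs)"
        by (intro borel_measurable_sum gm) auto
      moreover have "(\<lambda>y. f i i m c y) \<in> borel_measurable (outputs)" by (rule measurable_f_fixed[OF m i])
      ultimately show ?thesis using gm[OF m] by measurable
    qed
    have Um: "U m \<in> borel_measurable (outputs)" if "m \<in> msgs" for m
      unfolding U_def[abs_def] using rm[OF that] wm[OF that] by measurable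
    \<comment> \<open>The reference density of a cloud is \<open>f i i\<close>, in which the layers
      above \<open>i\<close> count as Gaussian noise.\<close>
    have point: "ennreal (h (b, y)) \<le> (\<Sum>m\<in>{m\<in>msgs. hidden i m = b}. U m y)" if b: "b \<in> Bs" for b y
    proof -
      have ratio: "sum (g y) {m'\<in>msgs. cloud i m' = cloud i m \<and> hidden i m' = b} / (T i s * f i i m c y) = leak_ratio i m c y"
        if "m \<in> {m\<in>msgs. hidden i m = b}" for m
      proof -
        have "{m'\<in>msgs. cloud i m' = cloud i m \<and> hidden i m' = b} = fibre i m"
          using cloud_hidden_class[of m i] that by auto
        then show ?thesis by (simp add: leak_ratio_def g_def sum_divide_distrib)
      qed
      have "sum (g y) {m\<in>msgs. hidden i m = b} * ln (sum (g y) {m\<in>msgs. hidden i m = b} / ?N / (real (card {m\<in>msgs. hidden i m = b}) / ?N * (sum (g y) msgs / ?N)))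
        \<le> (\<Sum>m\<in>{m\<in>msgs. hidden i m = b}. g y m * (ln (1 + sum (g y) {m'\<in>msgs. cloud i m' = cloud i m \<and> hidden i m' = b} / (T i s * f i i (cloud i m) c y))
          + real (card (hidden i ` msgs)) * T i s * f i i (cloud i m) c y / sum (g y) {m'\<in>msgs. cloud i m' = cloud i m}))"
        using b unfolding Bs_def
        by (intro mixture_divergence_le[where q="\<lambda>a. f i i a c y"] gpos f_pos[OF i] card_cloud_hidden_class Tp) auto
      also have "\<dots> = (\<Sum>m\<in>{m\<in>msgs. hidden i m = b}. g y m * (?r y m + ?w y m))"
        by (intro sum.cong refl) (simp only: ratio f_cloud)
      finally have "?K * (sum (g y) {m\<in>msgs. hidden i m = b} * ln (Pxy (b, y) / (Px b * Py y)))
        \<le> ?K * (\<Sum>m\<in>{m\<in>msgs. hidden i m = b}. g y m * (?r y m + ?w y m))"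
        unfolding Pxy_def Px_def Py_def fst_conv snd_conv by (intro mult_left_mono K)
      then have "h (b, y) \<le> (\<Sum>m\<in>{m\<in>msgs. hidden i m = b}. ?K * (g y m * (?r y m + ?w y m)))"
        by (simp add: h_def Pxy_def log_def sum_distrib_left)
      then have "ennreal (h (b, y)) \<le> ennreal (\<Sum>m\<in>{m\<in>msgs. hidden i m = b}. ?K * (g y m * (?r y m + ?w y m)))"
        by (rule ennreal_leI)
      also have "\<dots> = (\<Sum>m\<in>{m\<in>msgs. hidden i m = b}. ennreal (?K * (g y m * (?r y m + ?w y m))))"
        by (intro sum_ennreal[symmetric] mult_nonneg_nonneg K add_nonneg_nonneg r0 w0 less_imp_le[OF gpos])
      also have "\<dots> = (\<Sum>m\<in>{m\<in>msgs. hidden i m = b}. U m y)"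
      proof (rule sum.cong[OF refl])
        fix m
        have "ennreal (?K * (g y m * (?r y m + ?w y m))) = ennreal (?K * (g y m * ?r y m) + ?K * (g y m * ?w y m))"
          by (simp only: distrib_left)
        also have "\<dots> = ennreal (?K * (g y m * ?r y m)) + ennreal (?K * (g y m * ?w y m))"
          by (intro ennreal_plus mult_nonneg_nonneg K r0 w0 less_imp_le[OF gpos])
        finally show "ennreal (?K * (g y m * (?r y m + ?w y m))) = U m y"
          unfolding U_def by (simp only: ennreal_mult'[OF K] ennreal_mult'[OF less_imp_le[OF gpos]])
      qed
      finally show ?thesis .
    qed
    have "(\<integral>\<^sup>+z. ennreal (h z) \<partial>?ST) = (\<Sum>b\<in>Bs. \<integral>\<^sup>+y. ennreal (h (b, y)) \<partial>outputs)"
      using hm by (intro int_ST) simp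
    also have "\<dots> \<le> (\<Sum>b\<in>Bs. \<integral>\<^sup>+y. (\<Sum>m\<in>{m\<in>msgs. hidden i m = b}. U m y) \<partial>outputs)"
      using point by (intro sum_mono nn_integral_mono) auto
    also have "\<dots> = (\<Sum>b\<in>Bs. \<Sum>m\<in>{m\<in>msgs. hidden i m = b}. \<integral>\<^sup>+y. U m y \<partial>outputs)"
      using Um by (intro sum.cong refl nn_integral_sum) auto
    also have "\<dots> = (\<Sum>m\<in>msgs. \<integral>\<^sup>+y. U m y \<partial>outputs)"
      using finB sub by (intro sum.group) auto
    also have "\<dots> = (\<Sum>m\<in>msgs. ennreal ?K * (\<integral>\<^sup>+y. ennreal (g y m) * ennreal (?r y m) \<partial>outputs) + ennreal ?K * (\<integral>\<^sup>+y. ennreal (g y m * ?w y m) \<partial>outputs))"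
    proof (rule sum.cong[OF refl])
      fix m assume m: "m \<in> msgs"
      show "(\<integral>\<^sup>+y. U m y \<partial>outputs) = ennreal ?K * (\<integral>\<^sup>+y. ennreal (g y m) * ennreal (?r y m) \<partial>outputs) + ennreal ?K * (\<integral>\<^sup>+y. ennreal (g y m * ?w y m) \<partial>outputs)"
        unfolding U_def nn_integral_cmult[OF rm[OF m], symmetric] nn_integral_cmult[OF wm[OF m], symmetric]
        by (rule nn_integral_add[OF borel_measurable_times_ennreal[OF borel_measurable_const rm[OF m]] borel_measurable_times_ennreal[OF borel_measurable_const wm[OF m]]])
    qed
    also have "\<dots> = ennreal ?K * (\<Sum>m\<in>msgs. \<integral>\<^sup>+y. ennreal (g y m) * ennreal (?r y m) \<partial>outputs) + ennreal ?K * (\<Sum>m\<in>msgs. \<integral>\<^sup>+y. ennreal (g y m * ?w y m) \<partial>outputs)"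
      by (simp only: sum.distrib sum_distrib_left)
    \<comment> \<open>The weights cancel within each cloud and leave one probability density
      \<open>f i i m\<close> per message.\<close>
    also have "(\<Sum>m\<in>msgs. \<integral>\<^sup>+y. ennreal (g y m * ?w y m) \<partial>outputs) = ennreal ?N"
    proof -
      have "(\<Sum>m\<in>msgs. \<integral>\<^sup>+y. ennreal (g y m * ?w y m) \<partial>outputs) = (\<integral>\<^sup>+y. (\<Sum>m\<in>msgs. ennreal (g y m * ?w y m)) \<partial>outputs)"
        by (intro nn_integral_sum[symmetric] wm)
      also have "\<dots> = (\<integral>\<^sup>+y. (\<Sum>m\<in>msgs. ennreal (f i i m c y)) \<partial>outputs)"
      proof (rule nn_integral_cong)
        fix y
        have "(\<Sum>m\<in>msgs. ennreal (g y m * ?w y m)) = ennreal (\<Sum>m\<in>msgs. g y m * ?w y m)"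
          by (intro sum_ennreal mult_nonneg_nonneg w0 less_imp_le[OF gpos])
        also have "(\<Sum>m\<in>msgs. g y m * ?w y m) = (\<Sum>m\<in>msgs. f i i m c y)"
          using mixture_reference_sum[where X=msgs and g="g y" and \<alpha>="cloud i" and \<beta>="hidden i" and t="T i s" and q="\<lambda>a. f i i a c y", OF finite_msgs gpos card_cloud_hidden_class]
          by (simp only: f_cloud)
        also have "ennreal \<dots> = (\<Sum>m\<in>msgs. ennreal (f i i m c y))" by (intro sum_ennreal[symmetric] f_nonneg)
        finally show "(\<Sum>m\<in>msgs. ennreal (g y m * ?w y m)) = (\<Sum>m\<in>msgs. ennreal (f i i m c y))" .
      qed
      also have "\<dots> = (\<Sum>m\<in>msgs. \<integral>\<^sup>+y. ennreal (f i i m c y) \<partial>outputs)"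
        using i by (intro nn_integral_sum measurable_compose[OF measurable_f_fixed measurable_ennreal])
      also have "\<dots> = ennreal ?N" by (simp add: nn_integral_f[OF i] ennreal_of_nat_eq_real_of_nat)
      finally show ?thesis .
    qed
    also have "ennreal ?K * (\<Sum>m\<in>msgs. \<integral>\<^sup>+y. ennreal (g y m) * ennreal (?r y m) \<partial>outputs)
      = ennreal (1 / ln 2) * (ennreal (1 / ?N) * (\<Sum>m\<in>msgs. \<integral>\<^sup>+y. ennreal (g y m) * ennreal (?r y m) \<partial>outputs))"
      by (simp add: mult.assoc[symmetric] ennreal_mult'[symmetric] mult.commute)
    also have "\<dots> + ennreal ?K * ennreal ?N \<le> ennreal (1 / ln 2) * ennreal B + ennreal ?K * ennreal ?N"
      using leak unfolding g_def by (intro add_right_mono mult_left_mono) auto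
    also have "\<dots> = ennreal ((1 + B) / ln 2)"
    proof -
      have cancel: "1 / (n * l) * n = 1 / l" if "0 < n" for n l :: real using that by simp
      have "ennreal (1 / ln 2) * ennreal B + ennreal ?K * ennreal ?N = ennreal (1 / ln 2 * B + 1 / ln 2)"
        unfolding ennreal_mult'[OF K, symmetric] cancel[OF N]
        using B by (simp add: ennreal_mult'[symmetric] ennreal_plus[symmetric] del: ennreal_plus)
      also have "1 / ln 2 * B + 1 / ln 2 = (1 + B) / ln 2" by (simp add: add_divide_distrib)
      finally show ?thesis .
    qed
    finally show "(\<integral>\<^sup>+z. ennreal (h z) \<partial>?ST) \<le> ennreal ((1 + B) / ln 2)" .
    show "0 \<le> (1 + B) / ln 2" using B by simp
  qed
  finally show ?thesis .
qed

end

section \<open>Choice of the codebook\<close>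

text \<open>If every point violated some requirement, the sum of the normalised functions would be
  at least 1 everywhere, but its mean is at most \<open>card Q / (card Q + 1)\<close>. The extra 1
  in the factor makes this strict.\<close>

lemma (in prob_space) exists_all_le_expectation_multiple:
  fixes G :: "'q \<Rightarrow> 'a \<Rightarrow> ennreal" and K :: "'q \<Rightarrow> real"
  assumes fin: "finite Q" and G: "\<And>q. q \<in> Q \<Longrightarrow> G q \<in> borel_measurable M"
    and K: "\<And>q. q \<in> Q \<Longrightarrow> 0 < K q" and le: "\<And>q. q \<in> Q \<Longrightarrow> (\<integral>\<^sup>+x. G q x \<partial>M) \<le> ennreal (K q)"
  shows "\<exists>x\<in>space M. \<forall>q\<in>Q. G q x \<le> ennreal ((real (card Q) + 1) * K q)"
proof (rule ccontr)
  assume neg: "\<not> ?thesis"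
  let ?n = "real (card Q) + 1"
  let ?F = "\<lambda>x. \<Sum>q\<in>Q. ennreal (1 / (?n * K q)) * G q x"
  have "1 \<le> ?F x" if x: "x \<in> space M" for x
  proof -
    from neg x obtain q where q: "q \<in> Q" "ennreal (?n * K q) \<le> G q x" by (auto simp: not_le intro: less_imp_le)
    have "1 = ennreal (1 / (?n * K q)) * ennreal (?n * K q)"
      using K[OF q(1)] by (subst ennreal_mult'[symmetric]) (auto simp: add_nonneg_eq_0_iff)
    also have "\<dots> \<le> ennreal (1 / (?n * K q)) * G q x" by (intro mult_left_mono q) simp
    also have "\<dots> \<le> ?F x" using q fin by (intro member_le_sum) auto
    finally show ?thesis .
  qed
  then have "(\<integral>\<^sup>+x. 1 \<partial>M) \<le> (\<integral>\<^sup>+x. ?F x \<partial>M)" by (intro nn_integral_mono)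
  also have "\<dots> = (\<Sum>q\<in>Q. ennreal (1 / (?n * K q)) * (\<integral>\<^sup>+x. G q x \<partial>M))"
    using G by (simp add: nn_integral_sum nn_integral_cmult)
  also have "\<dots> \<le> (\<Sum>q\<in>Q. ennreal (1 / ?n))"
  proof (rule sum_mono)
    fix q assume q: "q \<in> Q"
    have "ennreal (1 / (?n * K q)) * (\<integral>\<^sup>+x. G q x \<partial>M) \<le> ennreal (1 / (?n * K q)) * ennreal (K q)"
      by (intro mult_left_mono le q) simp
    also have "\<dots> = ennreal (1 / ?n)" using K[OF q] by (subst ennreal_mult'[symmetric]) auto
    finally show "ennreal (1 / (?n * K q)) * (\<integral>\<^sup>+x. G q x \<partial>M) \<le> ennreal (1 / ?n)" .
  qed
  also have "\<dots> = ennreal (real (card Q) * (1 / ?n))"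
    by (subst sum_ennreal) auto
  finally have "ennreal 1 \<le> ennreal (real (card Q) * (1 / ?n))"
    by (simp add: emeasure_space_1)
  then have "1 \<le> real (card Q) * (1 / ?n)"
    by (subst (asm) ennreal_le_iff) auto
  then show False by (simp add: field_simps)
qed

context superposition_code
begin

text \<open>Mean over messages and channel noise for one fixed codebook; error probability, leakage
  bound and power deviation all take this form.\<close>

definition avg where
  "avg r \<Phi> c = ennreal (1 / real (card msgs)) * (\<Sum>m\<in>msgs. \<integral>\<^sup>+y. ennreal (f r s m c y) * \<Phi> m c y \<partial>outputs)"

lemma expectation_avg:
  assumes r: "r \<le> s"
    and \<Phi>: "\<And>m. m \<in> msgs \<Longrightarrow> (\<lambda>z. \<Phi> m (fst z) (snd z)) \<in> borel_measurable codes_outputs"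
    and le: "\<And>m. m \<in> msgs \<Longrightarrow> (\<integral>\<^sup>+z. \<Phi> m (fst z) (snd z) \<partial>law r m) \<le> ennreal K" and K: "0 \<le> K"
  shows "avg r \<Phi> \<in> borel_measurable codebooks" and "(\<integral>\<^sup>+c. avg r \<Phi> c \<partial>codebooks) \<le> ennreal K"
proof -
  interpret B: sigma_finite_measure "outputs" by (rule sigma_finite_leb_block)
  have N: "0 < real (card msgs)" using msgs_nonempty by (simp add: card_gt_0_iff)
  have meas: "(\<lambda>c. \<integral>\<^sup>+y. ennreal (f r s m c y) * \<Phi> m c y \<partial>outputs) \<in> borel_measurable codebooks" if m: "m \<in> msgs" for m
  proof -
    have "(\<lambda>z. ennreal (f r s m (fst z) (snd z)) * \<Phi> m (fst z) (snd z)) \<in> borel_measurable codes_outputs"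
      using m by (intro borel_measurable_times_ennreal measurable_compose[OF measurable_f_law measurable_ennreal] \<Phi>) auto
    from B.borel_measurable_nn_integral_fst[OF this] show ?thesis by simp
  qed
  then show "avg r \<Phi> \<in> borel_measurable codebooks"
    unfolding avg_def[abs_def] by (intro borel_measurable_times_ennreal borel_measurable_sum) auto
  have "(\<integral>\<^sup>+c. avg r \<Phi> c \<partial>codebooks) = ennreal (1 / real (card msgs)) * (\<Sum>m\<in>msgs. \<integral>\<^sup>+c. (\<integral>\<^sup>+y. ennreal (f r s m c y) * \<Phi> m c y \<partial>outputs) \<partial>codebooks)"
    unfolding avg_def by (subst nn_integral_cmult) (auto simp: nn_integral_sum meas intro!: borel_measurable_sum)
  also have "(\<Sum>m\<in>msgs. \<integral>\<^sup>+c. (\<integral>\<^sup>+y. ennreal (f r s m c y) * \<Phi> m c y \<partial>outputs) \<partial>codebooks) = (\<Sum>m\<in>msgs. \<integral>\<^sup>+z. \<Phi> m (fst z) (snd z) \<partial>law r m)"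
    by (intro sum.cong refl) (simp add: nn_integral_law \<Phi>)
  also have "\<dots> \<le> (\<Sum>m\<in>msgs. ennreal K)" by (intro sum_mono le)
  also have "\<dots> = ennreal (real (card msgs) * K)" using K by (subst sum_ennreal) auto
  also have "ennreal (1 / real (card msgs)) * \<dots> = ennreal K"
    using N by (subst ennreal_mult'[symmetric]) auto
  finally show "(\<integral>\<^sup>+c. avg r \<Phi> c \<partial>codebooks) \<le> ennreal K" by (simp add: mult_left_mono)
qed

lemma avg_mono:
  assumes "\<And>m y. m \<in> msgs \<Longrightarrow> \<Phi> m c y \<le> \<Psi> m c y"
  shows "avg r \<Phi> c \<le> avg r \<Psi> c"
  unfolding avg_def using assms by (intro mult_left_mono sum_mono nn_integral_mono) auto

definition err_exp where
  "err_exp \<gamma> \<delta> = (\<Sum>k\<in>{1..s}. 4 / (real L * \<delta>\<^sup>2) + real (A k * M k - 1) * exp (- \<gamma> k))"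

definition leak_exp where
  "leak_exp \<tau> = 1 + ln (real s + 2) + (real s + 1) * (\<tau> + 3/2 * sqrt (real L))"

text \<open>There are \<open>s\<close> error averages, \<open>s + 1\<close> leakage averages and one
  power deviation; these \<open>2 * s + 2\<close> requirements give the factor
  \<open>2 * s + 3\<close>.\<close>

lemma exists_codebook:
  assumes dL: "0 < \<delta>" "0 < L" and \<tau>: "0 \<le> \<tau>"
  shows "\<exists>c\<in>space codebooks.
    (\<forall>j\<in>{1..s}. avg j (err_bound \<gamma> \<delta> j) c \<le> ennreal ((2 * real s + 3) * err_exp \<gamma> \<delta>)) \<and>
    (\<forall>i\<le>s. avg i (leak_bound i \<tau>) c \<le> ennreal ((2 * real s + 3) * leak_exp \<tau>)) \<and>
    avg 0 (\<lambda>m c y. ennreal \<bar>S 0 0 m c y\<bar>) c \<le> ennreal ((2 * real s + 3) * (3/2 * sqrt (real L)))"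
proof -
  interpret C: prob_space codebooks by (rule prob_space_codebooks)
  \<comment> \<open>The tags 0, 1, 2 stand for error, leakage and power.\<close>
  let ?Q = "({0} \<times> {1..s}) \<union> ({1} \<times> {..s}) \<union> {(2::nat, 0::nat)}"
  let ?G = "\<lambda>(a, i). if a = 0 then avg i (err_bound \<gamma> \<delta> i) else if a = 1 then avg i (leak_bound i \<tau>)
     else avg 0 (\<lambda>m c y. ennreal \<bar>S 0 0 m c y\<bar>)"
  let ?K = "\<lambda>(a, i). if a = 0 then err_exp \<gamma> \<delta> else if a = 1 then leak_exp \<tau> else 3/2 * sqrt (real L)"
  have card: "real (card ?Q) + 1 = 2 * real s + 3"
  proof -
    have "card ?Q = card ({0::nat} \<times> {1..s}) + card ({1::nat} \<times> {..s}) + card {(2::nat, 0::nat)}"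
      by (subst card_Un_disjoint; (subst card_Un_disjoint)?; auto)
    then show ?thesis by (simp add: card_cartesian_product)
  qed
  \<comment> \<open>For \<open>s = 0\<close> the sum is empty, but then no receiver has an error
    requirement.\<close>
  have e_pos: "0 < err_exp \<gamma> \<delta>" if "0 < s"
    unfolding err_exp_def using that dL by (intro sum_pos add_pos_nonneg) auto
  have l_pos: "0 < leak_exp \<tau>"
    unfolding leak_exp_def using \<tau> by (intro add_pos_nonneg) auto
  have e: "avg j (err_bound \<gamma> \<delta> j) \<in> borel_measurable codebooks" "(\<integral>\<^sup>+c. avg j (err_bound \<gamma> \<delta> j) c \<partial>codebooks) \<le> ennreal (err_exp \<gamma> \<delta>)"
    if j: "j \<in> {1..s}" for j
  proof -
    have js: "j \<le> s" using j by simp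
    have le: "(\<integral>\<^sup>+z. err_bound \<gamma> \<delta> j m (fst z) (snd z) \<partial>law j m) \<le> ennreal (err_exp \<gamma> \<delta>)" if "m \<in> msgs" for m
      unfolding law_err_bound[OF that js dL] err_exp_def using js dL by (intro ennreal_leI sum_mono2) auto
    show "avg j (err_bound \<gamma> \<delta> j) \<in> borel_measurable codebooks" "(\<integral>\<^sup>+c. avg j (err_bound \<gamma> \<delta> j) c \<partial>codebooks) \<le> ennreal (err_exp \<gamma> \<delta>)"
      using e_pos j by (auto intro!: expectation_avg[OF js measurable_err_bound[OF _ js] le] simp: less_imp_le)
  qed
  have l: "avg i (leak_bound i \<tau>) \<in> borel_measurable codebooks" "(\<integral>\<^sup>+c. avg i (leak_bound i \<tau>) c \<partial>codebooks) \<le> ennreal (leak_exp \<tau>)"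
    if i: "i \<le> s" for i
    using expectation_avg[OF i measurable_leak_bound[OF _ i] law_leak_bound[OF i _ \<tau> dL(2)]] l_pos
    unfolding leak_exp_def by (auto simp: less_imp_le)
  have Sm: "(\<lambda>z. ennreal \<bar>S 0 0 m (fst z) (snd z)\<bar>) \<in> borel_measurable codes_outputs" if "m \<in> msgs" for m
    using measurable_S_law[OF that, of 0 0] by measurable
  have d: "avg 0 (\<lambda>m c y. ennreal \<bar>S 0 0 m c y\<bar>) \<in> borel_measurable codebooks"
    "(\<integral>\<^sup>+c. avg 0 (\<lambda>m c y. ennreal \<bar>S 0 0 m c y\<bar>) c \<partial>codebooks) \<le> ennreal (3/2 * sqrt (real L))"
    using expectation_avg[OF _ Sm law_S_abs[OF _ _ _ dL(2)]] by auto
  have "\<exists>c\<in>space codebooks. \<forall>q\<in>?Q. ?G q c \<le> ennreal ((real (card ?Q) + 1) * ?K q)"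
  proof (rule C.exists_all_le_expectation_multiple)
    fix q assume "q \<in> ?Q"
    then show "?G q \<in> borel_measurable codebooks" "0 < ?K q" "(\<integral>\<^sup>+c. ?G q c \<partial>codebooks) \<le> ennreal (?K q)"
      using e l d e_pos l_pos dL by (auto simp: split_beta)
  qed auto
  then obtain c where c: "c \<in> space codebooks" and le: "\<And>q. q \<in> ?Q \<Longrightarrow> ?G q c \<le> ennreal ((2 * real s + 3) * ?K q)"
    unfolding card by blast
  have "avg j (err_bound \<gamma> \<delta> j) c \<le> ennreal ((2 * real s + 3) * err_exp \<gamma> \<delta>)" if "j \<in> {1..s}" for j
    using le[of "(0, j)"] that by simp
  moreover have "avg i (leak_bound i \<tau>) c \<le> ennreal ((2 * real s + 3) * leak_exp \<tau>)" if "i \<le> s" for i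
    using le[of "(1, i)"] that by simp
  moreover have "avg 0 (\<lambda>m c y. ennreal \<bar>S 0 0 m c y\<bar>) c \<le> ennreal ((2 * real s + 3) * (3/2 * sqrt (real L)))"
    using le[of "(2, 0)"] by simp
  ultimately show ?thesis using c by blast
qed

text \<open>Collects what the parameters must satisfy. In \<open>rate\<close>, \<open>\<tau>\<close>
  bounds the shortfall of randomisation against the eavesdropper's capacity. In \<open>pow\<close>,
  zero power is an alternative of its own: an empty budget has no room for a deviation, but the
  codewords are then exactly 0.\<close>

lemma exists_good_code:
  assumes dL: "0 < \<delta>" "0 < L" and \<tau>: "0 \<le> \<tau>"
    and A_eq: "\<And>k. k \<in> {1..s} \<Longrightarrow> A k = msg_size L (R k)"
    and \<gamma>: "\<And>j k. j \<le> s \<Longrightarrow> k \<in> {1..j} \<Longrightarrow> \<gamma> k \<le> real L * (1/2 * ln (vr j (k - 1) / vr j k) - \<delta>)"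
    and rate: "\<And>i k. i \<le> s \<Longrightarrow> k \<in> {i..s} \<Longrightarrow> real L * (1/2 * ln (vr i i / vr i k)) - ln (T i k) \<le> \<tau>"
    and err: "(2 * real s + 3) * err_exp \<gamma> \<delta> \<le> \<epsilon>"
    and sec: "(1 + (2 * real s + 3) * leak_exp \<tau>) / ln 2 / real L \<le> \<epsilon>"
    and pow: "(\<forall>k\<in>{1..s}. p k = 0) \<or> (vr 0 0 * (real L + (2 * real s + 3) * (3/2 * sqrt (real L))) - real L) / h 0 \<le> real L * Pmax"
    and Pmax: "0 \<le> Pmax" and \<epsilon>: "0 < \<epsilon>"
  shows "\<exists>enc dec. good_code s h Pmax R \<epsilon> L enc dec"
proof -
  let ?n = "2 * real s + 3"
  obtain c where c: "c \<in> space codebooks"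
    and ce: "\<And>j. j \<in> {1..s} \<Longrightarrow> avg j (err_bound \<gamma> \<delta> j) c \<le> ennreal (?n * err_exp \<gamma> \<delta>)"
    and cl: "\<And>i. i \<le> s \<Longrightarrow> avg i (leak_bound i \<tau>) c \<le> ennreal (?n * leak_exp \<tau>)"
    and cd: "avg 0 (\<lambda>m c y. ennreal \<bar>S 0 0 m c y\<bar>) c \<le> ennreal (?n * (3/2 * sqrt (real L)))"
    using exists_codebook[OF dL \<tau>, of \<gamma>] by blast
  interpret wc: wiretap_code s L p h A M c R
    by unfold_locales (use c A_eq in auto)
  have "good_code s h Pmax R \<epsilon> L wc.encoder (decoder \<gamma> c)"
    unfolding good_code_def
  proof (intro conjI ballI)
    fix w assume "w \<in> msg_set s L R"
    then show "wc.encoder w \<in> space (prob_algebra (block_space L))" by (rule wc.encoder_prob)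
  next
    have Tp: "0 < T 0 s" by (rule T_pos) simp
    have "(\<Sum>m\<in>msgs. \<Sum>t<L. (wc.codeword m t)\<^sup>2) \<le> real (card msgs) * (real L * Pmax)"
      using pow
    proof
      assume "\<forall>k\<in>{1..s}. p k = 0"
      then have "wc.codeword m t = 0" if "t < L" for m t using that by (simp add: wc.codeword_def)
      then show ?thesis using Pmax by simp
    next
      assume le: "(vr 0 0 * (real L + ?n * (3/2 * sqrt (real L))) - real L) / h 0 \<le> real L * Pmax"
      have "(\<Sum>m\<in>msgs. \<Sum>t<L. (wc.codeword m t)\<^sup>2) \<le> real (card msgs) * ((vr 0 0 * (real L + ?n * (3/2 * sqrt (real L))) - real L) / h 0)"
        using cd unfolding avg_def by (intro wc.codeword_power_le) auto
      also have "\<dots> \<le> real (card msgs) * (real L * Pmax)" by (intro mult_left_mono le) simp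
      finally show ?thesis .
    qed
    then have "1 / T 0 s * (\<Sum>m\<in>msgs. \<Sum>t<L. (wc.codeword m t)\<^sup>2) \<le> 1 / T 0 s * (real (card msgs) * (real L * Pmax))"
      using Tp by (intro mult_left_mono) auto
    also have "\<dots> = real (card (msg_set s L R)) * real L * Pmax"
      unfolding wc.card_msgs using Tp by simp
    finally show "(\<Sum>w\<in>msg_set s L R. \<integral>\<^sup>+x. ennreal (\<Sum>t<L. (x t)\<^sup>2) \<partial>wc.encoder w) \<le> ennreal (real (card (msg_set s L R)) * real L * Pmax)"
      unfolding wc.power_sum using Tp by (subst ennreal_mult'[symmetric]) (auto intro: ennreal_leI)
  next
    fix j assume j: "j \<in> {1..s}"
    then show "decoder \<gamma> c j \<in> block_space L \<rightarrow>\<^sub>M count_space UNIV"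
      using measurable_decoder[OF c, of j \<gamma>] by (simp add: measurable_cong_sets[OF sets_leb_block refl])
  next
    fix i j assume i: "i \<in> {1..s}" and j: "j \<in> {i..s}"
    then have js: "j \<le> s" and j1: "j \<in> {1..s}" and ij: "i \<in> {1..j}" by auto
    have D: "decoder \<gamma> c j \<in> block_space L \<rightarrow>\<^sub>M count_space UNIV"
      using measurable_decoder[OF c js, of \<gamma>] by (simp add: measurable_cong_sets[OF sets_leb_block refl])
    have "ennreal (measure (joint_law s L R h wc.encoder j) {p \<in> space (joint_law s L R h wc.encoder j). decoder \<gamma> c j (snd p) i \<noteq> fst p i})
      = avg j (\<lambda>m c y. indicator {y. decoder \<gamma> c j y i \<noteq> fst (m i)} y) c"
      unfolding avg_def by (rule wc.decoding_error_probability[OF js D i])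
    also have "\<dots> \<le> avg j (err_bound \<gamma> \<delta> j) c"
      using \<gamma>[OF js] by (intro avg_mono indicator_error_le js dL ij) auto
    also have "\<dots> \<le> ennreal \<epsilon>" using ce[OF j1] err by (meson ennreal_leI order_trans)
    finally show "measure (joint_law s L R h wc.encoder j) {p \<in> space (joint_law s L R h wc.encoder j). decoder \<gamma> c j (snd p) i \<noteq> fst p i} \<le> \<epsilon>"
      using \<epsilon> by (simp add: ennreal_le_iff)
  next
    fix i assume "i \<in> {0..s}"
    then have i: "i \<le> s" by simp
    have "avg i (\<lambda>m c y. ennreal (ln (1 + leak_ratio i m c y))) c \<le> avg i (leak_bound i \<tau>) c"
      using rate[OF i] by (intro avg_mono ln_leak_ratio_le i \<tau>)
    also have "\<dots> \<le> ennreal (?n * leak_exp \<tau>)" by (rule cl[OF i])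
    finally have "prob_space.mutual_information (joint_law s L R h wc.encoder i) 2
        (count_space ((\<lambda>w. restrict w {i+1..s}) ` msg_set s L R)) (block_space L) (\<lambda>p. restrict (fst p) {i+1..s}) snd
      \<le> (1 + ?n * leak_exp \<tau>) / ln 2"
      unfolding avg_def
      by (intro wc.mutual_information_le[OF i]) (auto simp: leak_exp_def intro!: mult_nonneg_nonneg add_nonneg_nonneg \<tau>)
    then have "prob_space.mutual_information (joint_law s L R h wc.encoder i) 2
        (count_space ((\<lambda>w. restrict w {i+1..s}) ` msg_set s L R)) (block_space L) (\<lambda>p. restrict (fst p) {i+1..s}) snd / real L
      \<le> (1 + ?n * leak_exp \<tau>) / ln 2 / real L"
      using dL by (intro divide_right_mono) auto
    with sec show "prob_space.mutual_information (joint_law s L R h wc.encoder i) 2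
        (count_space ((\<lambda>w. restrict w {i+1..s}) ` msg_set s L R)) (block_space L) (\<lambda>p. restrict (fst p) {i+1..s}) snd / real L \<le> \<epsilon>"
      by linarith
  qed
  then show ?thesis by blast
qed

end

section \<open>Rates\<close>

text \<open>Measured in nats, with the layers above \<open>k\<close> counted as noise. The powers
  are a parameter because given and scaled powers are compared.\<close>

definition layer_capacity :: "nat \<Rightarrow> (nat \<Rightarrow> real) \<Rightarrow> (nat \<Rightarrow> real) \<Rightarrow> nat \<Rightarrow> nat \<Rightarrow> real" where
  "layer_capacity s h q r k = 1/2 * ln (1 + h r * q k / (1 + h r * (\<Sum>j=k+1..s. q j)))"

lemma snr_mono:
  fixes a b x y :: real
  assumes "0 < a" "a \<le> b" "0 \<le> x" "0 \<le> y"
  shows "a * x / (1 + a * y) \<le> b * x / (1 + b * y)"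
proof -
  have "0 < 1 + a * y" "0 < 1 + b * y" using assms by (auto intro: add_pos_nonneg)
  moreover have "a * x * (1 + b * y) \<le> b * x * (1 + a * y)"
    using mult_right_mono[OF assms(2,3)] by (simp add: algebra_simps)
  ultimately show ?thesis by (simp add: frac_le_eq divide_le_eq le_divide_eq mult.commute)
qed

text \<open>A larger gain amplifies signal and interference alike, but the receiver noise stays
  fixed, so the ratio improves. This is where degradedness enters.\<close>

lemma layer_capacity_mono:
  assumes "0 < h r" "h r \<le> h r'" "\<And>j. j \<in> {1..s} \<Longrightarrow> 0 \<le> q j" "k \<in> {1..s}"
  shows "layer_capacity s h q r k \<le> layer_capacity s h q r' k"
proof -
  have nn: "0 \<le> q k" "0 \<le> (\<Sum>j=k+1..s. q j)" using assms by (auto intro: sum_nonneg)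
  have "0 \<le> h r * q k / (1 + h r * (\<Sum>j=k+1..s. q j))"
    using nn assms by (intro divide_nonneg_nonneg mult_nonneg_nonneg add_nonneg_nonneg) auto
  with snr_mono[OF assms(1,2) nn] show ?thesis unfolding layer_capacity_def by simp
qed

lemma layer_capacity_pos:
  assumes "0 < h r" "\<And>j. j \<in> {1..s} \<Longrightarrow> 0 \<le> q j" "k \<in> {1..s}" "0 < q k"
  shows "0 < layer_capacity s h q r k"
proof -
  have "0 \<le> (\<Sum>j=k+1..s. q j)" using assms by (intro sum_nonneg) auto
  then have "0 < h r * q k / (1 + h r * (\<Sum>j=k+1..s. q j))"
    using assms by (intro divide_pos_pos mult_pos_pos add_pos_nonneg) auto
  then show ?thesis unfolding layer_capacity_def by simp
qed

lemma layer_capacity_0: "q k = 0 \<Longrightarrow> layer_capacity s h q r k = 0"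
  by (simp add: layer_capacity_def)

lemma tendsto_layer_capacity_scale:
  assumes "0 < h r" "\<And>j. j \<in> {1..s} \<Longrightarrow> 0 \<le> P j" "k \<in> {1..s}"
  shows "((\<lambda>t. layer_capacity s h (\<lambda>j. (1 - t) * P j) r k) \<longlongrightarrow> layer_capacity s h P r k) (at_right 0)"
proof -
  let ?I = "\<Sum>j=k+1..s. P j"
  have nn: "0 \<le> P k" "0 \<le> ?I" using assms by (auto intro: sum_nonneg)
  have d: "0 < 1 + h r * ?I" using nn assms(1) by (intro add_pos_nonneg) auto
  have a: "0 < 1 + h r * P k / (1 + h r * ?I)" using nn assms(1) d by (intro add_pos_nonneg divide_nonneg_nonneg mult_nonneg_nonneg) auto
  have "((\<lambda>t. 1/2 * ln (1 + h r * ((1 - t) * P k) / (1 + h r * ((1 - t) * ?I)))) \<longlongrightarrow>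
      1/2 * ln (1 + h r * ((1 - 0) * P k) / (1 + h r * ((1 - 0) * ?I)))) (at_right (0::real))"
    using d a by (intro tendsto_intros) auto
  then show ?thesis by (simp add: layer_capacity_def sum_distrib_left)
qed

text \<open>The number of randomisation indices is as large as reliable decoding permits; it is then
  exponentially close to what the eavesdropper's capacity \<open>Ce\<close> requires.\<close>

lemma randomisation_size:
  fixes L :: nat and \<sigma> Cd Ce Cp :: real
  assumes \<sigma>: "0 < \<sigma>" and L: "ln 4 \<le> real L * \<sigma>" and Ce: "4 * \<sigma> \<le> Ce" "Ce \<le> Cd" and Cp: "Cd - \<sigma> \<le> Cp"
    and A: "A = msg_size L ((Cd - Ce) / ln 2)"
    and M: "M = max 1 (nat \<lfloor>exp (real L * (Cp - 2 * \<sigma>)) / real A\<rfloor>)"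
  shows "real (A * M) \<le> exp (real L * (Cp - 2 * \<sigma>))" and "real L * (Ce - 4 * \<sigma>) \<le> ln (real M)"
proof -
  let ?E = "exp (real L * (Cp - 2 * \<sigma>))" and ?z = "exp (real L * (Ce - 4 * \<sigma>))"
  have pw: "2 powr (real L * ((Cd - Ce) / ln 2)) = exp (real L * (Cd - Ce))"
    by (simp add: powr_def)
  \<comment> \<open>Rounding up a number that is at least 1 costs at most a factor 2.\<close>
  have "1 \<le> exp (real L * (Cd - Ce))" using Ce by simp
  then have A1: "real A \<le> 2 * exp (real L * (Cd - Ce))" and A0: "0 < real A"
    unfolding A msg_size_def pw by linarith+
  have z1: "1 \<le> ?z" using Ce by simp
  \<comment> \<open>One factor 2 pays for the ceiling in \<open>A\<close>, the other for the floor
    in \<open>M\<close>.\<close>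
  have e4: "4 \<le> exp (real L * \<sigma>)" using L by (metis exp_le_cancel_iff exp_ln zero_less_numeral)
  have "2 * ?z * real A \<le> 2 * ?z * (2 * exp (real L * (Cd - Ce)))"
    using A1 by (intro mult_left_mono) auto
  also have "\<dots> = 4 * (?z * exp (real L * (Cd - Ce)))" by simp
  also have "\<dots> \<le> exp (real L * \<sigma>) * (?z * exp (real L * (Cd - Ce)))"
    using e4 by (intro mult_right_mono) auto
  also have "\<dots> = exp (real L * (Cd - 3 * \<sigma>))"
    by (simp add: exp_add[symmetric] algebra_simps)
  also have "\<dots> \<le> ?E" using Cp by (auto intro: mult_left_mono)
  finally have y: "2 * ?z \<le> ?E / real A" using A0 by (simp add: le_divide_eq)
  have fl: "?E / real A - 1 < of_int \<lfloor>?E / real A\<rfloor>" "of_int \<lfloor>?E / real A\<rfloor> \<le> ?E / real A" by linarith+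
  \<comment> \<open>The quotient is at least 1, so \<open>M\<close> is its plain floor.\<close>
  have "1 \<le> ?E / real A" using y z1 by linarith
  then have "1 \<le> \<lfloor>?E / real A\<rfloor>" by (simp only: le_floor_iff of_int_1)
  moreover have "real (max 1 (nat F)) = of_int F" if "1 \<le> F" for F :: int
    using that by (simp add: max_def)
  ultimately have rM: "real M = of_int \<lfloor>?E / real A\<rfloor>" unfolding M by blast
  show "real (A * M) \<le> ?E" using fl(2) A0 unfolding of_nat_mult rM by (simp add: le_divide_eq mult.commute)
  have "?z \<le> real M" using fl(1) y z1 unfolding rM by linarith
  moreover from this have "0 < real M" using z1 by linarith
  ultimately show "real L * (Ce - 4 * \<sigma>) \<le> ln (real M)" by (simp only: ln_ge_iff)
qed

section \<open>Variance ratios as sums of layer capacities\<close>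

context superposition_code
begin

lemma vr_ratio_step:
  assumes r: "r \<le> s" and k: "k \<in> {1..s}"
  shows "1/2 * ln (vr r (k - 1) / vr r k) = layer_capacity s h p r k"
proof -
  have "tail (k - 1) = p k + tail k" using k tail_eq[of "k - 1"] by (cases k) auto
  then have "vr r (k - 1) / vr r k = 1 + h r * p k / vr r k"
    using vr_pos[OF r, of k] by (simp add: vr_def field_simps)
  then show ?thesis by (simp add: layer_capacity_def vr_def tail_def)
qed

text \<open>Chain rule: the ratios telescope, so several layers together carry the sum of their
  capacities.\<close>

lemma vr_ratio_eq_sum:
  assumes i: "i \<le> s" and "i \<le> k" "k \<le> s"
  shows "1/2 * ln (vr i i / vr i k) = (\<Sum>l\<in>{i+1..k}. layer_capacity s h p i l)"
  using assms(2,3)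
proof (induction k)
  case (Suc k)
  show ?case
  proof (cases "i = Suc k")
    case False
    then have ik: "i \<le> k" using Suc.prems by simp
    have "1/2 * ln (vr i i / vr i (Suc k)) = 1/2 * ln (vr i i / vr i k) + 1/2 * ln (vr i (Suc k - 1) / vr i (Suc k))"
      using ln_divide_pos[OF vr_pos[OF i, of i] vr_pos[OF i, of "Suc k"]] ln_divide_pos[OF vr_pos[OF i, of i] vr_pos[OF i, of k]]
        ln_divide_pos[OF vr_pos[OF i, of k] vr_pos[OF i, of "Suc k"]]
      by (simp only: diff_Suc_1 right_diff_distrib)
    also have "1/2 * ln (vr i (Suc k - 1) / vr i (Suc k)) = layer_capacity s h p i (Suc k)"
      using Suc.prems by (intro vr_ratio_step i) auto
    also have "1/2 * ln (vr i i / vr i k) = (\<Sum>l\<in>{i+1..k}. layer_capacity s h p i l)"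
      using Suc.prems ik by (intro Suc.IH) auto
    also have "(\<Sum>l\<in>{i+1..k}. layer_capacity s h p i l) + layer_capacity s h p i (Suc k) = (\<Sum>l\<in>{i+1..Suc k}. layer_capacity s h p i l)"
      using ik by (simp add: atLeastAtMostSuc_conv)
    finally show ?thesis .
  next
    case True
    then show ?thesis using vr_pos[OF i, of i] by simp
  qed
next
  case 0
  then show ?case using vr_pos[OF i, of 0] by simp
qed

lemma ln_T: "k \<le> s \<Longrightarrow> ln (T i k) = (\<Sum>l\<in>{i+1..k}. ln (real (M l)))"
  unfolding T_def using M_pos by (subst ln_prod) (auto simp: less_imp_neq[THEN not_sym] gr0_conv_Suc)

end

text \<open>The error, leakage and power conditions on the block length all have this shape, so one
  limit serves for the three.\<close>

lemma eventually_le_of_tendsto_inverse: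
  fixes a b \<epsilon> :: real
  assumes "c < \<epsilon>"
  shows "eventually (\<lambda>L::nat. c + a / real L + b / sqrt (real L) \<le> \<epsilon>) sequentially"
proof -
  have "((\<lambda>L::nat. c + a * (1 / real L) + b * inverse (sqrt (real L))) \<longlongrightarrow> c + a * 0 + b * 0) sequentially"
    by (intro tendsto_intros lim_1_over_n tendsto_inverse_0_at_top filterlim_compose[OF sqrt_at_top filterlim_real_sequentially])
  then have "eventually (\<lambda>L::nat. c + a * (1 / real L) + b * inverse (sqrt (real L)) < \<epsilon>) sequentially"
    using assms by (intro order_tendstoD(2)) auto
  then show ?thesis by eventually_elim (simp add: divide_inverse)
qed

lemma exp_neg_le_inverse: "0 < x \<Longrightarrow> exp (- x) \<le> 1 / (x::real)"
proof -
  assume x: "0 < x"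
  have "x \<le> exp x" using exp_ge_add_one_self[of x] by linarith
  then show ?thesis using x unfolding exp_minus inverse_eq_divide by (intro divide_left_mono) auto
qed

text \<open>Message sizes belong to the powers \<open>P\<close>, the codebook to
  \<open>(1 - t) * P\<close>. By continuity the scaling shifts capacities by less than
  \<open>\<sigma>\<close> in the harmful direction, and it reserves a fraction \<open>t\<close> of
  the power for deviations.\<close>

theorem theorem9:
  fixes s :: nat and h P :: "nat \<Rightarrow> real" and Pmax :: real
  assumes h0: "0 < h 0"
    and hmono: "\<forall>i<s. h i < h (Suc i)"
    and Pnn: "\<forall>i\<in>{1..s}. 0 \<le> P i"
    and Psum: "(\<Sum>i=1..s. P i) \<le> Pmax"
  shows "achievable s h Pmax
           (\<lambda>i. 1/2 * (log 2 (1 + h i * P i / (1 + h i * (\<Sum>j=i+1..s. P j)))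
                      - log 2 (1 + h (i - 1) * P i / (1 + h (i - 1) * (\<Sum>j=i+1..s. P j)))))"
  (is "achievable s h Pmax ?R")
  unfolding achievable_def
proof (intro allI impI)
  fix \<epsilon> :: real assume \<epsilon>: "0 < \<epsilon>"
  have hle: "h i \<le> h j" if "i \<le> j" "j \<le> s" for i j
    using that
  proof (induction j)
    case (Suc j)
    then show ?case using hmono[rule_format, of j] by (cases "i = Suc j") auto
  qed simp
  have hpos: "0 < h r" if "r \<le> s" for r using hle[of 0 r] that h0 by simp
  have Pn: "0 \<le> P j" if "j \<in> {1..s}" for j using Pnn that by blast
  let ?C = "layer_capacity s h P"
  have R: "?R k = (?C k k - ?C (k - 1) k) / ln 2" for k
    by (simp add: layer_capacity_def log_def diff_divide_distrib)
  define n where "n = 2 * real s + 3"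
  have n: "0 < n" by (simp add: n_def)
  \<comment> \<open>Layers of zero power have capacity 0 and would leave no positive
    \<open>\<sigma>\<close>, so they are set aside.\<close>
  define G where "G = {k\<in>{1..s}. 0 < P k}"
  \<comment> \<open>The first entry keeps the limiting leakage
    \<open>n * (s + 1) * (5 * s * \<sigma>) / ln 2\<close> at most \<open>\<epsilon> / 2\<close>.
    The others keep \<open>4 * \<sigma>\<close> within the eavesdropper's capacity of each active
    layer, so that the back-off leaves room for at least one index.\<close>
  define \<sigma> where "\<sigma> = Min (insert (\<epsilon> * ln 2 / (10 * n * (real s + 1)\<^sup>2)) ((\<lambda>k. ?C (k - 1) k / 4) ` G))"
  have Cpos: "0 < ?C (k - 1) k" if "k \<in> G" for k
    using that by (intro layer_capacity_pos hpos Pn) (auto simp: G_def)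
  have \<sigma>: "0 < \<sigma>"
    unfolding \<sigma>_def using \<epsilon> n Cpos by (subst Min_gr_iff) (auto simp: G_def)
  have \<sigma>1: "\<sigma> \<le> \<epsilon> * ln 2 / (10 * n * (real s + 1)\<^sup>2)"
    unfolding \<sigma>_def by (intro Min_le) (auto simp: G_def)
  have \<sigma>2: "4 * \<sigma> \<le> ?C (k - 1) k" if "k \<in> G" for k
  proof -
    have "\<sigma> \<le> ?C (k - 1) k / 4" unfolding \<sigma>_def using that by (intro Min_le) (auto simp: G_def)
    then show ?thesis by simp
  qed
  have "eventually (\<lambda>t. \<forall>k\<in>{1..s}. ?C k k - \<sigma> < layer_capacity s h (\<lambda>j. (1 - t) * P j) k k \<and>
      layer_capacity s h (\<lambda>j. (1 - t) * P j) (k - 1) k < ?C (k - 1) k + \<sigma>) (at_right (0::real))"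
  proof (intro eventually_ball_finite ballI eventually_conj)
    fix k assume k: "k \<in> {1..s}"
    show "eventually (\<lambda>t. ?C k k - \<sigma> < layer_capacity s h (\<lambda>j. (1 - t) * P j) k k) (at_right (0::real))"
      by (rule order_tendstoD(1)[OF tendsto_layer_capacity_scale[OF hpos Pn k]]) (use k \<sigma> in auto)
    show "eventually (\<lambda>t. layer_capacity s h (\<lambda>j. (1 - t) * P j) (k - 1) k < ?C (k - 1) k + \<sigma>) (at_right (0::real))"
      by (rule order_tendstoD(2)[OF tendsto_layer_capacity_scale[OF hpos Pn k]]) (use k \<sigma> in auto)
  qed simp
  moreover have "eventually (\<lambda>t. t \<in> {0<..<1}) (at_right (0::real))"
    by (rule eventually_at_right_real) simp
  ultimately have "eventually (\<lambda>t. (\<forall>k\<in>{1..s}. ?C k k - \<sigma> < layer_capacity s h (\<lambda>j. (1 - t) * P j) k k \<and>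
      layer_capacity s h (\<lambda>j. (1 - t) * P j) (k - 1) k < ?C (k - 1) k + \<sigma>) \<and> t \<in> {0<..<1}) (at_right (0::real))"
    by (rule eventually_conj)
  from eventually_happens'[OF trivial_limit_at_right_real this]
  obtain t where t: "0 < t" "t < 1"
    and tC: "\<And>k. k \<in> {1..s} \<Longrightarrow> ?C k k - \<sigma> < layer_capacity s h (\<lambda>j. (1 - t) * P j) k k"
      "\<And>k. k \<in> {1..s} \<Longrightarrow> layer_capacity s h (\<lambda>j. (1 - t) * P j) (k - 1) k < ?C (k - 1) k + \<sigma>"
    by (auto simp only: greaterThanLessThan_iff)
  define p where "p = (\<lambda>j. (1 - t) * P j)"
  let ?Cp = "layer_capacity s h p"
  have pn: "0 \<le> p j" if "j \<in> {1..s}" for j using Pn[OF that] t by (simp add: p_def)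
  define Ps where "Ps = (\<Sum>i=1..s. P i)"
  have Ps0: "0 \<le> Ps" unfolding Ps_def using Pn by (intro sum_nonneg) auto
  define v where "v = 1 + h 0 * ((1 - t) * Ps)"
  have v: "0 < v" unfolding v_def using h0 t Ps0 by (intro add_pos_nonneg mult_nonneg_nonneg) auto

  \<comment> \<open>In order: positive length, room for rounding, decoding error, leakage, power.
    The zero terms pad the inequalities to the common shape.\<close>
  have ev: "eventually (\<lambda>L::nat. 1 \<le> L \<and> ln 4 / \<sigma> \<le> real L
      \<and> 0 + n * real s * (4 / \<sigma>\<^sup>2 + 1 / \<sigma>) / real L + 0 / sqrt (real L) \<le> \<epsilon>
      \<and> n * (real s + 1) * (5 * real s * \<sigma>) / ln 2 + ((1 + n * (1 + ln (real s + 2))) / ln 2) / real L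
          + (n * (real s + 1) * (3/2) / ln 2) / sqrt (real L) \<le> \<epsilon>
      \<and> (0 < Ps \<longrightarrow> 0 + 0 / real L + (v * (n * (3/2))) / sqrt (real L) \<le> h 0 * (t * Ps))) sequentially"
  proof (intro eventually_conj)
    show "eventually (\<lambda>L::nat. 1 \<le> L) sequentially" by (rule eventually_ge_at_top)
    show "eventually (\<lambda>L::nat. ln 4 / \<sigma> \<le> real L) sequentially"
      using filterlim_real_sequentially unfolding filterlim_at_top by blast
    show "eventually (\<lambda>L::nat. 0 + n * real s * (4 / \<sigma>\<^sup>2 + 1 / \<sigma>) / real L + 0 / sqrt (real L) \<le> \<epsilon>) sequentially"
      by (rule eventually_le_of_tendsto_inverse[OF \<epsilon>])
    have "n * (real s + 1) * (5 * real s * \<sigma>) / ln 2 < \<epsilon>"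
    proof -
      have "n * (real s + 1) * (5 * real s * \<sigma>) \<le> n * (real s + 1) * (5 * (real s + 1) * \<sigma>)"
        using n \<sigma> by (intro mult_left_mono mult_right_mono) auto
      also have "\<dots> = 5 * n * (real s + 1)\<^sup>2 * \<sigma>" by (simp add: power2_eq_square)
      also have "\<dots> \<le> 5 * n * (real s + 1)\<^sup>2 * (\<epsilon> * ln 2 / (10 * n * (real s + 1)\<^sup>2))"
        using n by (intro mult_left_mono \<sigma>1) auto
      also have "\<dots> = \<epsilon> * ln 2 / 2" using n by (simp add: divide_simps)
      finally have "n * (real s + 1) * (5 * real s * \<sigma>) / ln 2 \<le> \<epsilon> / 2" by (simp add: divide_le_eq)
      with \<epsilon> show ?thesis by linarith
    qed
    then show "eventually (\<lambda>L::nat. n * (real s + 1) * (5 * real s * \<sigma>) / ln 2 + ((1 + n * (1 + ln (real s + 2))) / ln 2) / real L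
          + (n * (real s + 1) * (3/2) / ln 2) / sqrt (real L) \<le> \<epsilon>) sequentially"
      by (rule eventually_le_of_tendsto_inverse)
    show "eventually (\<lambda>L::nat. 0 < Ps \<longrightarrow> 0 + 0 / real L + (v * (n * (3/2))) / sqrt (real L) \<le> h 0 * (t * Ps)) sequentially"
    proof (cases "0 < Ps")
      case True
      then have "0 < h 0 * (t * Ps)" using h0 t by simp
      from eventually_le_of_tendsto_inverse[OF this, of 0 "v * (n * (3/2))"] show ?thesis by simp
    qed simp
  qed
  then obtain L0 where L0: "\<And>L. L0 \<le> L \<Longrightarrow> 1 \<le> L \<and> ln 4 / \<sigma> \<le> real L
      \<and> 0 + n * real s * (4 / \<sigma>\<^sup>2 + 1 / \<sigma>) / real L + 0 / sqrt (real L) \<le> \<epsilon>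
      \<and> n * (real s + 1) * (5 * real s * \<sigma>) / ln 2 + ((1 + n * (1 + ln (real s + 2))) / ln 2) / real L
          + (n * (real s + 1) * (3/2) / ln 2) / sqrt (real L) \<le> \<epsilon>
      \<and> (0 < Ps \<longrightarrow> 0 + 0 / real L + (v * (n * (3/2))) / sqrt (real L) \<le> h 0 * (t * Ps))"
    unfolding eventually_sequentially by blast

  show "\<exists>L0. \<forall>L\<ge>L0. \<exists>enc dec. good_code s h Pmax ?R \<epsilon> L enc dec"
  proof (intro exI[of _ L0] allI impI)
    fix L assume "L0 \<le> L"
    from L0[OF this] have L1: "1 \<le> L" and L2: "ln 4 / \<sigma> \<le> real L"
      and L3: "n * real s * (4 / \<sigma>\<^sup>2 + 1 / \<sigma>) / real L \<le> \<epsilon>"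
      and L4: "n * (real s + 1) * (5 * real s * \<sigma>) / ln 2 + ((1 + n * (1 + ln (real s + 2))) / ln 2) / real L
          + (n * (real s + 1) * (3/2) / ln 2) / sqrt (real L) \<le> \<epsilon>"
      and L5: "0 < Ps \<longrightarrow> (v * (n * (3/2))) / sqrt (real L) \<le> h 0 * (t * Ps)"
      by auto
    have L: "0 < L" "0 < real L" using L1 by auto
    have L2': "ln 4 \<le> real L * \<sigma>" using L2 \<sigma> by (simp add: divide_le_eq)
    define A where "A k = msg_size L (?R k)" for k
    \<comment> \<open>A layer is filled up to \<open>2 * \<sigma>\<close> below its capacity after
      scaling; the threshold \<open>\<gamma>\<close> lies \<open>\<sigma>\<close> below, which
      leaves a margin \<open>\<sigma>\<close> on either side.\<close>
    define M where "M k = max 1 (nat \<lfloor>exp (real L * (?Cp k k - 2 * \<sigma>)) / real (A k)\<rfloor>)" for k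
    define \<gamma> where "\<gamma> k = real L * (?Cp k k - \<sigma>)" for k
    have Apos: "0 < A k" for k by (simp add: A_def msg_size_def)
    have size_pos: "real (A k * M k) \<le> exp (real L * (?Cp k k - 2 * \<sigma>))" "real L * (?C (k - 1) k - 4 * \<sigma>) \<le> ln (real (M k))"
      if k: "k \<in> G" for k
    proof -
      have k': "k \<in> {1..s}" using k by (simp add: G_def)
      have le: "?C (k - 1) k \<le> ?C k k"
        using k' by (intro layer_capacity_mono hpos hle Pn) auto
      have cp: "?C k k - \<sigma> \<le> ?Cp k k" using tC(1)[OF k'] by (simp add: p_def)
      have Ak: "A k = msg_size L ((?C k k - ?C (k - 1) k) / ln 2)" unfolding A_def R ..
      show "real (A k * M k) \<le> exp (real L * (?Cp k k - 2 * \<sigma>))" "real L * (?C (k - 1) k - 4 * \<sigma>) \<le> ln (real (M k))"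
        using randomisation_size[OF \<sigma> L2' \<sigma>2[OF k] le cp Ak M_def] by auto
    qed
    have size_0: "A k = 1" "M k = 1" if k: "k \<in> {1..s}" "k \<notin> G" for k
    proof -
      have P0: "P k = 0" using k Pn[OF k(1)] by (simp add: G_def)
      show A1: "A k = 1" by (simp add: A_def msg_size_def P0)
      \<comment> \<open>The capacity is 0, so the floor vanishes and \<open>max 1\<close> leaves a
        single index.\<close>
      have "exp (real L * (0 - 2 * \<sigma>)) < 1" using L \<sigma> by simp
      then have "\<lfloor>exp (real L * (0 - 2 * \<sigma>))\<rfloor> = 0" by (simp add: floor_eq_iff)
      then show "M k = 1" using P0 by (simp add: M_def A1 layer_capacity_0 p_def)
    qed
    interpret superposition_code s L p h A M
      by unfold_locales (use pn hpos Apos in \<open>auto simp: M_def\<close>)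
    have C_le: "?Cp j k \<le> ?Cp j' k" if "j \<le> j'" "j' \<le> s" "k \<in> {1..s}" for j j' k
      using that by (intro layer_capacity_mono hpos hle pn) auto
    show "\<exists>enc dec. good_code s h Pmax ?R \<epsilon> L enc dec"
    proof (rule exists_good_code[OF \<sigma> L(1)])
      \<comment> \<open>In each of at most \<open>s\<close> layers, \<open>4 * \<sigma>\<close> is
        lost in the size of \<open>M\<close> and \<open>\<sigma>\<close> is allowed for the scaling
        of the powers.\<close>
      show "0 \<le> 5 * real s * \<sigma> * real L" using \<sigma> by simp
      show "A k = msg_size L (?R k)" for k by (rule A_def)
      \<comment> \<open>Receiver \<open>j\<close> has at least the gain of receiver
        \<open>k\<close>, for which the threshold was chosen.\<close>
      show "\<gamma> k \<le> real L * (1/2 * ln (vr j (k - 1) / vr j k) - \<sigma>)" if "j \<le> s" "k \<in> {1..j}" for j k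
      proof -
        have k: "k \<in> {1..s}" using that by auto
        show ?thesis unfolding \<gamma>_def vr_ratio_step[OF that(1) k]
          using C_le[of k j k] that k by (intro mult_left_mono) auto
      qed
      show "real L * (1/2 * ln (vr i i / vr i k)) - ln (T i k) \<le> 5 * real s * \<sigma> * real L" if i: "i \<le> s" and k: "k \<in> {i..s}" for i k
      proof -
        have "real L * (1/2 * ln (vr i i / vr i k)) - ln (T i k) = (\<Sum>l\<in>{i+1..k}. real L * ?Cp i l - ln (real (M l)))"
          using vr_ratio_eq_sum[OF i, of k] ln_T[of k i] k by (simp add: sum_subtractf sum_distrib_left)
        also have "\<dots> \<le> (\<Sum>l\<in>{i+1..k}. 5 * \<sigma> * real L)"
        proof (rule sum_mono)
          fix l assume l: "l \<in> {i+1..k}"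
          then have ls: "l \<in> {1..s}" using k by auto
          \<comment> \<open>Receiver \<open>i\<close> is no stronger than receiver
            \<open>l - 1\<close>, against which layer \<open>l\<close> is randomised.\<close>
          have "?Cp i l \<le> ?Cp (l - 1) l" using l ls by (intro C_le) auto
          then have 1: "real L * ?Cp i l \<le> real L * ?Cp (l - 1) l" by (intro mult_left_mono) auto
          show "real L * ?Cp i l - ln (real (M l)) \<le> 5 * \<sigma> * real L"
          proof (cases "l \<in> G")
            case True
            have "real L * ?Cp (l - 1) l \<le> real L * (?C (l - 1) l + \<sigma>)"
              using tC(2)[OF ls] by (intro mult_left_mono) (auto simp: p_def)
            with 1 size_pos(2)[OF True] show ?thesis by (simp add: algebra_simps)
          next
            case False
            then have "P l = 0" using Pn[OF ls] ls by (simp add: G_def)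
            then show ?thesis using size_0[OF ls False] \<sigma> by (simp add: layer_capacity_0 p_def)
          qed
        qed
        also have "\<dots> = real (card {i+1..k}) * (5 * \<sigma> * real L)" by simp
        also have "\<dots> \<le> real s * (5 * \<sigma> * real L)"
          using k \<sigma> by (intro mult_right_mono) auto
        finally show ?thesis by (simp add: mult_ac)
      qed
      show "(2 * real s + 3) * err_exp \<gamma> \<sigma> \<le> \<epsilon>"
      proof -
        have "err_exp \<gamma> \<sigma> \<le> (\<Sum>k\<in>{1..s}. 4 / (real L * \<sigma>\<^sup>2) + 1 / (real L * \<sigma>))"
          unfolding err_exp_def
        proof (intro sum_mono add_left_mono)
          fix k assume k: "k \<in> {1..s}"
          show "real (A k * M k - 1) * exp (- \<gamma> k) \<le> 1 / (real L * \<sigma>)"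
          proof (cases "k \<in> G")
            case True
            have "real (A k * M k - 1) \<le> exp (real L * (?Cp k k - 2 * \<sigma>))"
              using size_pos(1)[OF True] by linarith
            then have "real (A k * M k - 1) * exp (- \<gamma> k) \<le> exp (real L * (?Cp k k - 2 * \<sigma>)) * exp (- \<gamma> k)"
              by (intro mult_right_mono) auto
            \<comment> \<open>Size and threshold are \<open>L * \<sigma>\<close> apart in the
              exponent; the exponential decay is then weakened to a multiple of
              \<open>1 / L\<close>.\<close>
            also have "\<dots> = exp (- (real L * \<sigma>))" by (simp add: exp_add[symmetric] \<gamma>_def algebra_simps)
            also have "\<dots> \<le> 1 / (real L * \<sigma>)" using L \<sigma> by (intro exp_neg_le_inverse) simp
            finally show ?thesis .
          next
            case False
            \<comment> \<open>A layer of zero power has no competitor: \<open>A k * M k - 1\<close>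
              is 0.\<close>
            then show ?thesis using size_0[OF k False] L \<sigma> by simp
          qed
        qed
        also have "\<dots> = real s * (4 / \<sigma>\<^sup>2 + 1 / \<sigma>) / real L"
          using L \<sigma> by (simp add: field_simps)
        finally have "n * err_exp \<gamma> \<sigma> \<le> n * (real s * (4 / \<sigma>\<^sup>2 + 1 / \<sigma>) / real L)"
          using n by (intro mult_left_mono) auto
        with L3 show ?thesis unfolding n_def by (simp add: mult.assoc)
      qed
      show "(1 + (2 * real s + 3) * leak_exp (5 * real s * \<sigma> * real L)) / ln 2 / real L \<le> \<epsilon>"
      proof -
        have sq: "sqrt (real L) / real L = 1 / sqrt (real L)" using L by (simp add: real_div_sqrt field_simps)
        have "(1 + n * leak_exp (5 * real s * \<sigma> * real L)) / ln 2 / real L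
          = n * (real s + 1) * (5 * real s * \<sigma>) / ln 2 * (real L / real L) + ((1 + n * (1 + ln (real s + 2))) / ln 2) / real L
            + (n * (real s + 1) * (3/2) / ln 2) * (sqrt (real L) / real L)"
          unfolding leak_exp_def by (simp add: add_divide_distrib distrib_left distrib_right mult_ac)
        also have "\<dots> \<le> \<epsilon>" using L4 L unfolding sq by simp
        finally show ?thesis unfolding n_def .
      qed
      show "(\<forall>k\<in>{1..s}. p k = 0) \<or> (vr 0 0 * (real L + (2 * real s + 3) * (3/2 * sqrt (real L))) - real L) / h 0 \<le> real L * Pmax"
      proof (cases "0 < Ps")
        case False
        then have "Ps = 0" using Ps0 by simp
        then have "\<forall>k\<in>{1..s}. P k = 0" unfolding Ps_def using Pn by (subst (asm) sum_nonneg_eq_0_iff) auto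
        then show ?thesis by (simp add: p_def)
      next
        case True
        have v_eq: "vr 0 0 = v" unfolding vr_def tail_def v_def by (simp add: p_def Ps_def sum_distrib_left)
        have e1: "v * (n * (3/2)) / sqrt (real L) * real L \<le> h 0 * (t * Ps) * real L"
          using L5 True by (intro mult_right_mono) auto
        have e2: "v * (n * (3/2)) / sqrt (real L) * real L = v * (n * (3/2 * sqrt (real L)))"
          using real_div_sqrt[of "real L"] L by (simp add: field_simps)
        have "v * (n * (3/2 * sqrt (real L))) \<le> h 0 * (t * Ps) * real L"
          using e1 unfolding e2 .
        \<comment> \<open>The term \<open>(v - 1) * L\<close> is \<open>h 0\<close> times the scaled
          energy; with the reserve \<open>t * Ps\<close> it makes up the energy of the unscaled
          powers.\<close>
        then have "v * (real L + n * (3/2 * sqrt (real L))) - real L \<le> h 0 * (t * Ps) * real L + (v - 1) * real L"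
          by (simp add: algebra_simps)
        also have "\<dots> = h 0 * (real L * Ps)" by (simp add: v_def algebra_simps)
        also have "\<dots> \<le> h 0 * (real L * Pmax)" using Psum h0 unfolding Ps_def by (intro mult_left_mono) auto
        finally have "(v * (real L + n * (3/2 * sqrt (real L))) - real L) / h 0 \<le> real L * Pmax"
          using h0 by (simp add: divide_le_eq mult.commute)
        then show ?thesis unfolding v_eq n_def by simp
      qed
      show "0 \<le> Pmax" using Ps0 Psum unfolding Ps_def by simp
      show "0 < \<epsilon>" by (rule \<epsilon>)
    qed
  qed
qed

end
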